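(* Let $D=2$ and let $d\ge 2$, $r\ge 1$ be integers such that $$r\leq \min\left\{\frac{\lfloor d^2/4\rfloor}{2},\ \frac{e^{-1}}{7}\,d^2\right\}.$$ For $L\geq 2$ let $H_{\Lambda_L}$ be the random translation-invariant Hamiltonian on $\Lambda_L=((-L,L]\cap\mathbb Z)^2$ with local dimension $d$ and interaction rank $r$ (defined in the context), with periodic or open boundary conditions. Then there exist constants $p>0$ and $C>0$, independent of $L$, such that for every $L\geq 2$, with probability at least $p$, $H_{\Lambda_L}$ has a normalized ground state $\psi$ whose left-right entanglement entropy satisfies the area law $$S(\rho_\psi^{\mathrm{left}})\leq C L^{1+(\log L)^{-1/5}} .$$
   Context: Random translation-invariant Hamiltonian ($D=2$): let $\Lambda_L=((-L,L]\cap \mathbb Z)^2$, with Hilbert space $\mathcal H=\bigotimes_{x\in\Lambda_L}\mathbb C^d$, and let $e_1,e_2$ be the standard basis vectors of $\mathbb Z^2$. Given orthogonal projections $P^1,P^2$ on $\mathbb C^d\otimes\mathbb C^d$ of rank $r$, set $$H_{\Lambda_L}=\sum_{x\in \Lambda_L}\sum_{j=1}^2 P^j_{x,x+e_j},\qquad P^j_{x,x+e_j}=P^j\otimes \mathrm{Id}_{\Lambda_L\setminus\{x,x+e_j\}},$$ where $P^j$ acts on the ordered pair of tensor factors $(x,x+e_j)$. With periodic boundary conditions, $x+e_j$ is taken modulo $2L$ in each coordinate; with open boundary conditions, terms with $x+e_j\notin\Lambda_L$ are omitted. Randomness: $P^1,P^2$ are independent and identically distributed, each being the orthogonal projection onto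 the span of the first $r$ columns of a Haar-random $d^2\times d^2$ orthogonal matrix (columns being viewed as vectors of $\mathbb C^{d^2}\cong\mathbb C^d\otimes\mathbb C^d$ in the standard product basis). The same $P^1,P^2$ are used at all sites. Entanglement entropy: split $\mathcal H=\mathcal H_{\mathrm{left}}\otimes\mathcal H_{\mathrm{right}}$ according to the left half ($x_1\le 0$) and right half ($x_1\geq 1$) of the box. For a normalized vector $\psi\in\mathcal H$, let $\rho^{\mathrm{left}}_\psi=\mathrm{Tr}_{\mathcal H_{\mathrm{right}}}|\psi\rangle\langle\psi|$ and $S(\rho^{\mathrm{left}}_\psi)=-\mathrm{Tr}\,\rho^{\mathrm{left}}_\psi\log\rho^{\mathrm{left}}_\psi$. A ground state is an eigenvector for the smallest eigenvalue. *)

theory Defs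
  imports "HOL-Probability.Probability" "Jordan_Normal_Form.Schur_Decomposition"
begin

no_notation Matrix.vec_index (infixl "$" 100)

section \<open>Random interactions\<close>

text \<open>Left invariance determines this probability measure uniquely, since the orthogonal group
  is compact.\<close>

definition haar_orthogonal :: "(real^'n^'n) measure \<Rightarrow> bool" where
  "haar_orthogonal \<mu> \<longleftrightarrow>
     prob_space \<mu> \<and> sets \<mu> = sets borel \<and>
     (AE U in \<mu>. orthogonal_matrix U) \<and>
     (\<forall>V. orthogonal_matrix V \<longrightarrow> distr \<mu> \<mu> (\<lambda>U. V ** U) = \<mu>)"

text \<open>For orthogonal \<open>U\<close> this is the orthogonal projection onto the span of the columns
  \<open>c 0, ..., c (r - 1)\<close> of \<open>U\<close>; see the lemmas below. The map \<open>c\<close> enumerates the column indices,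
  as the index type need not carry an order.\<close>

definition columns_proj :: "(nat \<Rightarrow> 'n) \<Rightarrow> nat \<Rightarrow> real^'n^'n \<Rightarrow> real^'n^'n" where
  "columns_proj c r U =
     (\<chi> i j. \<Sum>k<r. column (c k) U $ i * column (c k) U $ j)"

lemma columns_proj_mult:
  "columns_proj c r U *v v = (\<Sum>k<r. (column (c k) U \<bullet> v) *\<^sub>R column (c k) U)"
proof (subst Finite_Cartesian_Product.vec_eq_iff, intro allI)
  fix i
  have "(columns_proj c r U *v v) $ i
      = (\<Sum>j\<in>UNIV. \<Sum>k<r. column (c k) U $ i * column (c k) U $ j * v $ j)"
    by (simp add: columns_proj_def matrix_vector_mult_def sum_distrib_right)
  also have "\<dots> = (\<Sum>k<r. \<Sum>j\<in>UNIV. column (c k) U $ i * column (c k) U $ j * v $ j)"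
    by (rule sum.swap)
  also have "\<dots> = (\<Sum>k<r. (column (c k) U \<bullet> v) * column (c k) U $ i)"
    by (intro sum.cong refl) (simp add: inner_vec_def sum_distrib_right sum_distrib_left mult_ac)
  finally show "(columns_proj c r U *v v) $ i
      = (\<Sum>k<r. (column (c k) U \<bullet> v) *\<^sub>R column (c k) U) $ i"
    by simp
qed

lemma columns_proj_transpose: "Finite_Cartesian_Product.transpose (columns_proj c r U) = columns_proj c r U"
  by (simp add: columns_proj_def Finite_Cartesian_Product.transpose_def Finite_Cartesian_Product.vec_eq_iff mult.commute)

lemma orthogonal_matrix_column_inner:
  fixes U :: "real^'n^'n"
  assumes "orthogonal_matrix U"
  shows "column i U \<bullet> column j U = (if i = j then 1 else 0)"
  using assms
  by (auto simp: orthogonal_matrix_orthonormal_columns norm_eq_1 real_inner_class.orthogonal_def)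

lemma columns_proj_column:
  fixes U :: "real^'n^'n"
  assumes "orthogonal_matrix U" "inj_on c {..<r}" "k < r"
  shows "columns_proj c r U *v column (c k) U = column (c k) U"
proof -
  have "columns_proj c r U *v column (c k) U
      = (\<Sum>l<r. (if l = k then column (c k) U else 0))"
    unfolding columns_proj_mult
  proof (intro sum.cong refl)
    fix l assume "l \<in> {..<r}"
    then have "c l = c k \<longleftrightarrow> l = k" using assms(2,3) by (auto simp: inj_on_def)
    then show "(column (c l) U \<bullet> column (c k) U) *\<^sub>R column (c l) U
        = (if l = k then column (c k) U else 0)"
      by (simp add: orthogonal_matrix_column_inner[OF assms(1)])
  qed
  then show ?thesis using assms(3) by simp
qed

lemma columns_proj_idem:
  fixes U :: "real^'n^'n"
  assumes "orthogonal_matrix U" "inj_on c {..<r}"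
  shows "columns_proj c r U ** columns_proj c r U = columns_proj c r U"
proof -
  have "columns_proj c r U *v (columns_proj c r U *v v) = columns_proj c r U *v v" for v
  proof -
    have "columns_proj c r U *v (columns_proj c r U *v v)
        = (\<Sum>k<r. (column (c k) U \<bullet> v) *\<^sub>R (columns_proj c r U *v column (c k) U))"
      by (subst (2) columns_proj_mult) (simp add: linear_sum linear_cmul o_def)
    also have "\<dots> = columns_proj c r U *v v"
      using columns_proj_column[OF assms] by (simp add: columns_proj_mult)
    finally show ?thesis .
  qed
  then show ?thesis
    by (simp add: matrix_eq flip: matrix_vector_mul_assoc)
qed

lemma columns_proj_range:
  fixes U :: "real^'n^'n"
  assumes "orthogonal_matrix U" "inj_on c {..<r}"
  shows "range ((*v) (columns_proj c r U)) = Real_Vector_Spaces.span ((\<lambda>k. column (c k) U) ` {..<r})"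
    (is "?R = ?S")
proof
  show "?R \<subseteq> ?S"
    by (auto simp: columns_proj_mult intro: real_vector.span_sum real_vector.span_scale real_vector.span_base)
  have "real_vector.subspace ?R"
    by (intro real_vector.linear_subspace_image) simp_all
  moreover have "(\<lambda>k. column (c k) U) ` {..<r} \<subseteq> ?R"
    using columns_proj_column[OF assms] by (force intro: range_eqI[OF sym])
  ultimately show "?S \<subseteq> ?R"
    by (rule real_vector.span_minimal[rotated])
qed


section \<open>Operators on functions over a finite index set\<close>

text \<open>A vector of the Hilbert space with orthonormal basis indexed by a finite set \<open>I\<close> is given by its
  coefficients \<open>\<psi> :: 'i \<Rightarrow> complex\<close>, an operator by its matrix elements. The enumeration
  \<^const>\<open>from_nat_into\<close> of \<open>I\<close> turns them into vectors and matrices; the notions below do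
  not depend on its choice.\<close>

definition vec_on :: "'i set \<Rightarrow> ('i \<Rightarrow> complex) \<Rightarrow> complex Matrix.vec" where
  "vec_on I \<psi> = Matrix.vec (card I) (\<lambda>i. \<psi> (from_nat_into I i))"

definition mat_on :: "'i set \<Rightarrow> ('i \<Rightarrow> 'i \<Rightarrow> complex) \<Rightarrow> complex Matrix.mat" where
  "mat_on I A = Matrix.mat (card I) (card I) (\<lambda>(i, j). A (from_nat_into I i) (from_nat_into I j))"

definition normalized_on :: "'i set \<Rightarrow> ('i \<Rightarrow> complex) \<Rightarrow> bool" where
  "normalized_on I \<psi> \<longleftrightarrow> (\<Sum>\<sigma>\<in>I. (cmod (\<psi> \<sigma>))\<^sup>2) = 1"

definition ground_state :: "complex Matrix.mat \<Rightarrow> complex Matrix.vec \<Rightarrow> bool" where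
  "ground_state H v \<longleftrightarrow> (\<exists>E::real. eigenvector H v (complex_of_real E) \<and>
     (\<forall>E'::real. eigenvalue H (complex_of_real E') \<longrightarrow> E \<le> E'))"


section \<open>The Hamiltonian\<close>

definition lattice_box :: "nat \<Rightarrow> (int \<times> int) set" where
  "lattice_box L = {- int L<..int L} \<times> {- int L<..int L}"

definition left_half :: "nat \<Rightarrow> (int \<times> int) set" where
  "left_half L = {x \<in> lattice_box L. fst x \<le> 0}"

definition right_half :: "nat \<Rightarrow> (int \<times> int) set" where
  "right_half L = {x \<in> lattice_box L. fst x \<ge> 1}"

text \<open>The product basis of the tensor product of the spaces \<open>\<complex>\<^sup>d\<close> over a set \<open>X\<close> of sites, where
  \<open>d = CARD('d)\<close>.\<close>

definition configs :: "(int \<times> int) set \<Rightarrow> (int \<times> int \<Rightarrow> 'd) set" where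
  "configs X = X \<rightarrow>\<^sub>E UNIV"

datatype boundary = Periodic | Open

text \<open>The representative of \<open>a\<close> modulo \<open>2 L\<close> in \<open>(-L, L]\<close>.\<close>

definition wrap :: "nat \<Rightarrow> int \<Rightarrow> int" where
  "wrap L a = (a + int L - 1) mod (2 * int L) - int L + 1"

text \<open>The ordered pairs of sites \<open>(x, x + e)\<close> on which the interaction in direction \<open>e\<close> acts.\<close>

definition bonds :: "boundary \<Rightarrow> nat \<Rightarrow> int \<times> int \<Rightarrow> ((int \<times> int) \<times> (int \<times> int)) set" where
  "bonds bc L e = (case bc of
     Periodic \<Rightarrow> {(x, (wrap L (fst (x + e)), wrap L (snd (x + e)))) | x. x \<in> lattice_box L}
   | Open \<Rightarrow> {(x, x + e) | x. x \<in> lattice_box L \<and> x + e \<in> lattice_box L})"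

text \<open>Matrix elements of \<open>P\<close> acting on the ordered pair of tensor factors \<open>(x, y)\<close>, \<open>x \<noteq> y\<close>, tensored
  with the identity on the other factors.\<close>

definition bond_term ::
  "real^('d::finite \<times> 'd)^('d \<times> 'd) \<Rightarrow> int \<times> int \<Rightarrow> int \<times> int \<Rightarrow>
   (int \<times> int \<Rightarrow> 'd) \<Rightarrow> (int \<times> int \<Rightarrow> 'd) \<Rightarrow> complex" where
  "bond_term P x y \<sigma> \<tau> =
     (if \<forall>z. z \<noteq> x \<and> z \<noteq> y \<longrightarrow> \<sigma> z = \<tau> z
      then complex_of_real (P $ (\<sigma> x, \<sigma> y) $ (\<tau> x, \<tau> y)) else 0)"

definition hamiltonian ::
  "boundary \<Rightarrow> nat \<Rightarrow> real^('d::finite \<times> 'd)^('d \<times> 'd) \<Rightarrow> real^('d \<times> 'd)^('d \<times> 'd) \<Rightarrow>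
   (int \<times> int \<Rightarrow> 'd) \<Rightarrow> (int \<times> int \<Rightarrow> 'd) \<Rightarrow> complex" where
  "hamiltonian bc L P1 P2 \<sigma> \<tau> =
     (\<Sum>(x, y)\<in>bonds bc L (1, 0). bond_term P1 x y \<sigma> \<tau>) +
     (\<Sum>(x, y)\<in>bonds bc L (0, 1). bond_term P2 x y \<sigma> \<tau>)"


section \<open>Entanglement entropy\<close>

definition unitary_diagonalization ::
  "complex Matrix.mat \<Rightarrow> complex Matrix.mat \<Rightarrow> (nat \<Rightarrow> real) \<Rightarrow> bool" where
  "unitary_diagonalization A U e \<longleftrightarrow>
     U \<in> carrier_mat (dim_row A) (dim_row A) \<and>
     U * mat_adjoint U = 1\<^sub>m (dim_row A) \<and> mat_adjoint U * U = 1\<^sub>m (dim_row A) \<and>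
     A = U * mat_diag (dim_row A) (\<lambda>i. complex_of_real (e i)) * mat_adjoint U"

text \<open>Functional calculus for Hermitian matrices: \<open>f\<close> is applied to the eigenvalues in an
  orthonormal eigenbasis. The result does not depend on the diagonalization; see the lemma
  below.\<close>

definition hermitian_fun :: "(real \<Rightarrow> real) \<Rightarrow> complex Matrix.mat \<Rightarrow> complex Matrix.mat" where
  "hermitian_fun f A = (THE B. \<exists>U e. unitary_diagonalization A U e \<and>
     B = U * mat_diag (dim_row A) (\<lambda>i. complex_of_real (f (e i))) * mat_adjoint U)"

definition mat_trace :: "complex Matrix.mat \<Rightarrow> complex" where
  "mat_trace A = sum_list (diag_mat A)"

text \<open>The value \<open>ln 0 = 0\<close> is immaterial, as \<open>ln \<rho>\<close> is multiplied by \<open>\<rho>\<close>.\<close>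

definition von_neumann_entropy :: "complex Matrix.mat \<Rightarrow> real" where
  "von_neumann_entropy \<rho> = - Re (mat_trace (\<rho> * hermitian_fun ln \<rho>))"

text \<open>Matrix elements of the partial trace over the right half of \<open>|\<psi>\<rangle>\<langle>\<psi>|\<close>.\<close>

definition rho_left ::
  "nat \<Rightarrow> ((int \<times> int \<Rightarrow> 'd) \<Rightarrow> complex) \<Rightarrow>
   (int \<times> int \<Rightarrow> 'd) \<Rightarrow> (int \<times> int \<Rightarrow> 'd) \<Rightarrow> complex" where
  "rho_left L \<psi> \<sigma> \<tau> =
     (\<Sum>\<omega>\<in>configs (right_half L).
        \<psi> (merge (left_half L) (right_half L) (\<sigma>, \<omega>)) *
        cnj (\<psi> (merge (left_half L) (right_half L) (\<tau>, \<omega>))))"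

definition entanglement_entropy ::
  "nat \<Rightarrow> ((int \<times> int \<Rightarrow> 'd) \<Rightarrow> complex) \<Rightarrow> real" where
  "entanglement_entropy L \<psi> =
     von_neumann_entropy (mat_on (configs (left_half L)) (rho_left L \<psi>))"

lemma mat_adjoint_carrier: "U \<in> carrier_mat n m \<Longrightarrow> mat_adjoint U \<in> carrier_mat m n"
  by (auto simp: mat_adjoint_def)

lemma hermitian_fun_eq:
  assumes "unitary_diagonalization A U e"
  shows "hermitian_fun f A =
    U * mat_diag (dim_row A) (\<lambda>i. complex_of_real (f (e i))) * mat_adjoint U"
proof -
  define n where "n = dim_row A"
  define D where "D g = mat_diag n (\<lambda>i. complex_of_real (g i))" for g :: "nat \<Rightarrow> real"
  have D: "D g \<in> carrier_mat n n" for g by (simp add: D_def)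
  have unique: "V * D (f \<circ> e') * mat_adjoint V = U * D (f \<circ> e) * mat_adjoint U"
    if V: "unitary_diagonalization A V e'" for V e'
  proof -
    have u: "U \<in> carrier_mat n n" "U * mat_adjoint U = 1\<^sub>m n" "mat_adjoint U * U = 1\<^sub>m n"
      and A_U: "A = U * D e * mat_adjoint U"
      using assms by (simp_all add: unitary_diagonalization_def n_def D_def)
    have v: "V \<in> carrier_mat n n" "V * mat_adjoint V = 1\<^sub>m n" "mat_adjoint V * V = 1\<^sub>m n"
      and A_V: "A = V * D e' * mat_adjoint V"
      using V by (simp_all add: unitary_diagonalization_def n_def D_def)
    have cu: "U \<in> carrier_mat n n" "mat_adjoint U \<in> carrier_mat n n"
      and cv: "V \<in> carrier_mat n n" "mat_adjoint V \<in> carrier_mat n n"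
      using u v by (auto intro: mat_adjoint_carrier)
    define W where "W = mat_adjoint V * U"
    have W: "W \<in> carrier_mat n n" using cu cv by (simp add: W_def)
    have assoc: "X * Y * Z = X * (Y * Z)"
      if "X \<in> carrier_mat n n" "Y \<in> carrier_mat n n" "Z \<in> carrier_mat n n"
      for X Y Z :: "complex Matrix.mat"
      using that by (rule assoc_mult_mat)
    have cancel: "mat_adjoint V * (V * X) = X" "V * (mat_adjoint V * X) = X"
      "mat_adjoint U * (U * X) = X" "U * (mat_adjoint U * X) = X"
      if "X \<in> carrier_mat n n" for X
      using that cu cv u v by (simp_all flip: assoc)
    have "W * D e = mat_adjoint V * (A * U)"
      by (subst A_U) (use u cu cv D[of e] in \<open>simp add: W_def assoc\<close>)
    also have "\<dots> = D e' * W"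
      by (subst A_V) (use cu cv D[of e'] in \<open>simp add: W_def assoc cancel\<close>)
    finally have comm: "W * D e = D e' * W" .
    have "W * D (f \<circ> e) = D (f \<circ> e') * W"
    proof (rule eq_matI)
      fix i j assume "i < dim_row (D (f \<circ> e') * W)" "j < dim_col (D (f \<circ> e') * W)"
      then have ij: "i < n" "j < n" using D[of "f \<circ> e'"] W by auto
      have "(W * D e) $$ (i, j) = (D e' * W) $$ (i, j)" by (simp add: comm)
      then have "W $$ (i, j) * e j = e' i * W $$ (i, j)"
        using ij by (simp add: D_def mat_diag_mult_left[OF W] mat_diag_mult_right[OF W])
      then have "W $$ (i, j) = 0 \<or> e j = e' i" by auto
      then show "(W * D (f \<circ> e)) $$ (i, j) = (D (f \<circ> e') * W) $$ (i, j)"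
        using ij by (auto simp: D_def mat_diag_mult_left[OF W] mat_diag_mult_right[OF W])
    qed (use D[of "f \<circ> e"] D[of "f \<circ> e'"] W in auto)
    then have "V * (W * D (f \<circ> e)) * mat_adjoint U = V * (D (f \<circ> e') * W) * mat_adjoint U"
      by simp
    then show ?thesis
      using cu cv D[of "f \<circ> e"] D[of "f \<circ> e'"] u by (simp add: W_def assoc cancel)
  qed
  show ?thesis
    unfolding hermitian_fun_def
  proof (rule the_equality)
    show "\<exists>V e'. unitary_diagonalization A V e' \<and>
        U * mat_diag (dim_row A) (\<lambda>i. complex_of_real (f (e i))) * mat_adjoint U =
        V * mat_diag (dim_row A) (\<lambda>i. complex_of_real (f (e' i))) * mat_adjoint V"
      using assms by blast
  qed (use unique in \<open>auto simp: D_def n_def o_def\<close>)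
qed

end

theory Submission
  imports Defs
begin

text \<open>
  We look for amplitudes \<open>\<psi>(\<sigma>)\<close> annihilated by all interaction terms. Choose, for each direction \<open>i\<close>, a
  set \<open>E i\<close> of \<open>r\<close> pairs of labels contained in a product of two label classes, the four classes being
  disjoint. If the range of the projection is close to a suitable space, it is the graph of a map
  over the span of \<open>E i\<close>, and being annihilated means \<open>\<psi>(\<sigma>) = \<Sum>\<^sub>f a(e, f) \<psi>(\<sigma>\<^sub>b\<^sub>:\<^sub>=\<^sub>f)\<close> whenever the
  bond \<open>b\<close> is bad in \<open>\<sigma>\<close>, that is, carries a pair \<open>e \<in> E i\<close>. Here \<open>a \<ge> 0\<close>, \<open>\<Sum>\<^sub>f a(e, f) \<le> 1\<close>, and nearly all
  the weight lies on one resting pair, which makes no bond bad. Distinct bad bonds share no site.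
  Hence repeated application of these substitutions to the constant \<open>1\<close> decreases to a positive
  solution: \<open>\<psi>(\<sigma>)\<close> is the survival probability of a subcritical particle system, and a bond at rest
  maximises it. As bad bonds disappear at a geometric rate, \<open>O(log L)\<close> sweeps approximate \<open>\<psi>\<close> up to
  a factor \<open>1 + 1/L\<close>, uniformly in \<open>\<sigma>\<close>. A sweep multiplies the Schmidt rank by \<open>d\<^sup>2\<close> for each bond
  crossing the cut, whence an entropy of order \<open>L log L\<close> by Gibbs' inequality. The projections for
  which this works contain an open set, which has positive Haar measure by invariance and
  compactness. Since a non-measurable set would have measure \<open>0\<close> here, the event has to be shown
  to be measurable; it is closed.
\<close>


section \<open>Bond substitutions\<close>

text \<open>Nonnegative coefficients spare any estimate of cancellations: the iteration is monotone,
  and its limit cannot vanish, since every bad bond comes to rest with probability at least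
  \<open>\<alpha>\<close>. Branching is controlled by the disjointness of bad bonds: a substitution
  changes two sites, each of which lies in at most one bad bond, so a jump has at most two
  offspring, and making all pairs but the resting one improbable gives subcriticality. The accuracy
  \<open>1/L\<close> is dictated by the entropy estimate: the error enters squared and is multiplied
  by the logarithm of the dimension, which is of order \<open>L^2\<close>, so it costs only
  \<open>O(1)\<close>. The bound on the rank enters through the labels: four disjoint classes have
  about \<open>d/4\<close> labels each, which leaves about \<open>d^2/16\<close> pairs per
  direction, and \<open>e^(-1)/7 < 1/16\<close>. The exponent in the claim absorbs the logarithm
  because \<open>L^((log L)^(-1/5)) = exp ((log L)^(4/5))\<close>.\<close>

fun upd :: "('s \<Rightarrow> 'l) \<Rightarrow> bool \<times> 's \<times> 's \<Rightarrow> 'l \<times> 'l \<Rightarrow> 's \<Rightarrow> 'l" where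
  "upd \<sigma> (i, x, y) (k, l) = \<sigma>(x := k, y := l)"

text \<open>A bond is a triple of its direction, \<open>False\<close> for horizontal and
  \<open>True\<close> for vertical in the application, and its two ordered ends. The direction
  selects the set \<open>E i\<close> of forbidden pairs.\<close>

fun pair_at :: "('s \<Rightarrow> 'l) \<Rightarrow> bool \<times> 's \<times> 's \<Rightarrow> 'l \<times> 'l" where
  "pair_at \<sigma> (i, x, y) = (\<sigma> x, \<sigma> y)"

fun sites :: "bool \<times> 's \<times> 's \<Rightarrow> 's set" where
  "sites (i, x, y) = {x, y}"

text \<open>The class of a label determines the only bond at its site that can be bad: the one of direction \<open>i\<close>
  leaving the site for \<open>Some (i, False)\<close>, entering it for \<open>Some (i, True)\<close>. Hence distinct bad bonds are
  disjoint.\<close>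

locale rewriting =
  fixes cls :: "'l::finite \<Rightarrow> (bool \<times> bool) option"
    and E :: "bool \<Rightarrow> ('l \<times> 'l) set"
    and rest :: "bool \<Rightarrow> 'l \<times> 'l"
    and a :: "bool \<Rightarrow> 'l \<times> 'l \<Rightarrow> 'l \<times> 'l \<Rightarrow> real"
    and B :: "(bool \<times> 's \<times> 's) set"
    and \<alpha> q :: real
  assumes E_cls: "(k, l) \<in> E i \<Longrightarrow> cls k = Some (i, False) \<and> cls l = Some (i, True)"
    and rest_notin: "rest i \<notin> E i"
    and rest_cls: "rest i = (k, l) \<Longrightarrow> cls k \<in> {None, Some (i, False)} \<and> cls l \<in> {None, Some (i, True)}"
    and a_nonneg: "e \<in> E i \<Longrightarrow> f \<notin> E i \<Longrightarrow> 0 \<le> a i e f"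
    and a_sum: "e \<in> E i \<Longrightarrow> (\<Sum>f\<in>- E i. a i e f) \<le> 1"
    and a_rest: "e \<in> E i \<Longrightarrow> \<alpha> \<le> a i e (rest i)"
    and a_other: "e \<in> E i \<Longrightarrow> (\<Sum>f\<in>- E i - {rest i}. a i e f) \<le> q * \<alpha>"
    and alpha: "0 < \<alpha>" "\<alpha> \<le> 1" "0 \<le> q" "q \<le> \<alpha> / 4"
    and finite_B: "finite B"
    and B_neq: "(i, x, y) \<in> B \<Longrightarrow> x \<noteq> y"
    and B_right_unique: "(i, x, y) \<in> B \<Longrightarrow> (i, x, y') \<in> B \<Longrightarrow> y = y'"
    and B_left_unique: "(i, x, y) \<in> B \<Longrightarrow> (i, x', y) \<in> B \<Longrightarrow> x = x'"
begin

section \<open>Bad bonds and functions monotone towards rest\<close>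

definition bad :: "('s \<Rightarrow> 'l) \<Rightarrow> bool \<times> 's \<times> 's \<Rightarrow> bool" where
  "bad \<sigma> b \<longleftrightarrow> pair_at \<sigma> b \<in> E (fst b)"

definition bads :: "('s \<Rightarrow> 'l) \<Rightarrow> (bool \<times> 's \<times> 's) set" where
  "bads \<sigma> = {b \<in> B. bad \<sigma> b}"

text \<open>Backward evolution of a killed jump process: at a bad bond the pair jumps to
  \<open>f\<close> with probability \<open>a (fst b) (pair_at \<sigma> b) f\<close>, the missing
  mass is death, and the operator takes the expectation of \<open>\<phi>\<close> after the
  jump.\<close>

definition step :: "bool \<times> 's \<times> 's \<Rightarrow> (('s \<Rightarrow> 'l) \<Rightarrow> real) \<Rightarrow> ('s \<Rightarrow> 'l) \<Rightarrow> real" where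
  "step b \<phi> \<sigma> = (if bad \<sigma> b
     then (\<Sum>f\<in>- E (fst b). a (fst b) (pair_at \<sigma> b) f * \<phi> (upd \<sigma> b f)) else \<phi> \<sigma>)"

text \<open>No bond touching \<open>S\<close> can turn bad as long as the labels on \<open>S\<close> stay the same, which are therefore
  never changed and irrelevant to the others.\<close>

definition frozen :: "'s set \<Rightarrow> ('s \<Rightarrow> 'l) \<Rightarrow> bool" where
  "frozen S \<sigma> \<longleftrightarrow> (\<forall>b\<in>B. sites b \<inter> S \<noteq> {} \<longrightarrow> (\<forall>\<tau>. (\<forall>x\<in>S. \<tau> x = \<sigma> x) \<longrightarrow> \<not> bad \<tau> b))"

abbreviation at_rest :: "('s \<Rightarrow> 'l) \<Rightarrow> bool \<times> 's \<times> 's \<Rightarrow> 's \<Rightarrow> 'l" where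
  "at_rest \<sigma> b \<equiv> upd \<sigma> b (rest (fst b))"

text \<open>The invariants of the iteration. The third clause, monotonicity towards rest, bounds the influence
  of the weights other than that of the resting pair.\<close>

definition tame :: "(('s \<Rightarrow> 'l) \<Rightarrow> real) \<Rightarrow> bool" where
  "tame \<phi> \<longleftrightarrow> (\<forall>\<sigma>. 0 \<le> \<phi> \<sigma>) \<and>
     (\<forall>S \<sigma> \<sigma>'. frozen S \<sigma> \<longrightarrow> frozen S \<sigma>' \<longrightarrow> (\<forall>x. x \<notin> S \<longrightarrow> \<sigma> x = \<sigma>' x) \<longrightarrow> \<phi> \<sigma> = \<phi> \<sigma>') \<and>
     (\<forall>\<sigma>. \<forall>b\<in>B. \<forall>f. \<phi> (upd \<sigma> b f) \<le> \<phi> (at_rest \<sigma> b)) \<and>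
     (\<forall>b\<in>B. \<forall>\<sigma>. step b \<phi> \<sigma> \<le> \<phi> \<sigma>)"

lemma
  assumes "tame \<phi>"
  shows tame_nonneg: "0 \<le> \<phi> \<sigma>"
    and tame_frozen: "frozen S \<sigma> \<Longrightarrow> frozen S \<sigma>' \<Longrightarrow> (\<And>x. x \<notin> S \<Longrightarrow> \<sigma> x = \<sigma>' x) \<Longrightarrow> \<phi> \<sigma> = \<phi> \<sigma>'"
    and tame_rest: "b \<in> B \<Longrightarrow> \<phi> (upd \<sigma> b f) \<le> \<phi> (at_rest \<sigma> b)"
    and tame_step_le: "b \<in> B \<Longrightarrow> step b \<phi> \<sigma> \<le> \<phi> \<sigma>"
  using assms unfolding tame_def by blast+

lemma upd_other: "x \<notin> sites b \<Longrightarrow> upd \<sigma> b f x = \<sigma> x"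
  by (cases b; cases f) auto

lemma pair_at_upd: "b \<in> B \<Longrightarrow> pair_at (upd \<sigma> b f) b = f"
  using B_neq by (cases b; cases f) auto

lemma pair_at_cong: "(\<And>x. x \<in> sites b \<Longrightarrow> \<sigma> x = \<tau> x) \<Longrightarrow> pair_at \<sigma> b = pair_at \<tau> b"
  by (cases b) auto

lemma bad_cong: "(\<And>x. x \<in> sites b \<Longrightarrow> \<sigma> x = \<tau> x) \<Longrightarrow> bad \<sigma> b = bad \<tau> b"
  unfolding bad_def using pair_at_cong by metis

lemma upd_upd: "upd (upd \<sigma> b f) b g = upd \<sigma> b g"
  by (cases b; cases f; cases g) (auto simp: fun_eq_iff)

lemma upd_commute: "sites b \<inter> sites c = {} \<Longrightarrow> upd (upd \<sigma> b f) c g = upd (upd \<sigma> c g) b f"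
  by (cases b; cases c; cases f; cases g) (auto simp: fun_eq_iff)

lemma bad_upd: "b \<in> B \<Longrightarrow> bad (upd \<sigma> b f) b \<longleftrightarrow> f \<in> E (fst b)"
  by (simp add: bad_def pair_at_upd)

lemma bad_upd_disjoint: "sites b \<inter> sites c = {} \<Longrightarrow> bad (upd \<sigma> b f) c = bad \<sigma> c"
  by (rule bad_cong, rule upd_other) auto

lemma pair_at_upd_disjoint: "sites b \<inter> sites c = {} \<Longrightarrow> pair_at (upd \<sigma> b f) c = pair_at \<sigma> c"
  by (rule pair_at_cong, rule upd_other) auto

text \<open>The position of a site in a bond, written in the format of \<open>cls\<close>, so that
  the class of a label can be compared with the bonds at its site.\<close>

fun slot :: "bool \<times> 's \<times> 's \<Rightarrow> 's \<Rightarrow> bool \<times> bool" where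
  "slot (i, x, y) z = (i, z = y)"

lemma bad_cls: "bad \<sigma> b \<Longrightarrow> b \<in> B \<Longrightarrow> z \<in> sites b \<Longrightarrow> cls (\<sigma> z) = Some (slot b z)"
  using E_cls B_neq by (cases b) (auto simp: bad_def)

lemma slot_unique:
  assumes "b \<in> B" "b' \<in> B" "z \<in> sites b" "z \<in> sites b'" "slot b z = slot b' z"
  shows "b = b'"
proof -
  obtain i x y i' x' y' where bb: "b = (i, x, y)" "b' = (i', x', y')" by (cases b; cases b') blast
  have i: "i' = i" and z: "z = y \<longleftrightarrow> z = y'" using assms(5) bb by auto
  show ?thesis
  proof (cases "z = y")
    case True
    then show ?thesis using z i bb B_left_unique[of i x y x'] assms(1,2) by auto
  next
    case False
    then show ?thesis using z i bb B_right_unique[of i x y y'] assms by auto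
  qed
qed

lemma bad_unique:
  assumes "bad \<tau> b" "bad \<tau> b'" "b \<in> B" "b' \<in> B" "z \<in> sites b" "z \<in> sites b'"
  shows "b = b'"
  using slot_unique[OF assms(3-6)] bad_cls[OF assms(1,3,5)] bad_cls[OF assms(2,4,6)] by simp

lemma at_rest_cls:
  assumes "b \<in> B" "z \<in> sites b"
  shows "cls (at_rest \<sigma> b z) \<in> {None, Some (slot b z)}"
  using rest_cls[of "fst b" "fst (rest (fst b))" "snd (rest (fst b))"] B_neq assms
  by (cases b; cases "rest (fst b)") (auto split: if_splits)

text \<open>A bad bond \<open>d\<close> meeting the region needs labels of class
  \<open>slot d z\<close> at its sites. At a site of \<open>b\<close> this forces
  \<open>d = b\<close>, which is at rest and hence not bad; at a remaining site of \<open>c\<close>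
  it forces \<open>d = c\<close>, which meets \<open>b\<close> and so falls under the former
  case.\<close>

lemma frozenI:
  assumes b: "b \<in> B" and c: "c \<in> B" and ov: "sites b \<inter> sites c \<noteq> {}"
    and \<tau>: "\<And>x. x \<in> sites b \<Longrightarrow> \<tau> x = at_rest \<sigma> b x"
    and cl: "\<And>w. w \<in> sites c - sites b \<Longrightarrow> cls (\<tau> w) \<in> {None, Some (slot c w)}"
  shows "frozen (sites b \<union> sites c) \<tau>"
  unfolding frozen_def
proof (intro ballI impI allI notI)
  fix d \<tau>' assume d: "d \<in> B" "sites d \<inter> (sites b \<union> sites c) \<noteq> {}"
    and \<tau>': "\<forall>x\<in>sites b \<union> sites c. \<tau>' x = \<tau> x" and bad: "bad \<tau>' d"
  have nb: False if z: "z \<in> sites d" "z \<in> sites b" for z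
  proof -
    have "cls (\<tau>' z) = Some (slot d z)" using bad_cls[OF bad d(1)] z by blast
    moreover have "cls (\<tau>' z) \<in> {None, Some (slot b z)}"
      using at_rest_cls[OF b z(2), of \<sigma>] \<tau>' \<tau> z by auto
    ultimately have "slot d z = slot b z" by auto
    then have "d = b" using slot_unique d b z by blast
    then have "bad (at_rest \<sigma> b) b" using bad \<tau>' \<tau> bad_cong[of b \<tau>' "at_rest \<sigma> b"] by auto
    then show False using bad_upd[OF b] rest_notin by auto
  qed
  then obtain z where z: "z \<in> sites d" "z \<in> sites c - sites b" using d by blast
  have "cls (\<tau>' z) = Some (slot d z)" using bad_cls[OF bad d(1)] z by blast
  moreover have "cls (\<tau>' z) \<in> {None, Some (slot c z)}" using cl[OF z(2)] \<tau>' z by auto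
  ultimately have "slot d z = slot c z" by auto
  then have "d = c" using slot_unique d c z by blast
  then show False using nb ov by blast
qed

lemma frozen_rest: "b \<in> B \<Longrightarrow> frozen (sites b) (at_rest \<sigma> b)"
  using frozenI[of b b "at_rest \<sigma> b" \<sigma>] by (cases b) auto

lemma frozen_cong: "frozen S \<sigma> \<Longrightarrow> (\<And>x. x \<in> S \<Longrightarrow> \<sigma> x = \<tau> x) \<Longrightarrow> frozen S \<tau>"
  unfolding frozen_def by simp

lemma frozen_not_bad: "frozen S \<sigma> \<Longrightarrow> b \<in> B \<Longrightarrow> sites b \<inter> S \<noteq> {} \<Longrightarrow> \<not> bad \<sigma> b"
  unfolding frozen_def by blast

lemma step_mono: "(\<And>\<sigma>. \<phi> \<sigma> \<le> \<xi> \<sigma>) \<Longrightarrow> step b \<phi> \<sigma> \<le> step b \<xi> \<sigma>"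
  unfolding step_def bad_def by (auto intro!: sum_mono mult_left_mono a_nonneg)

lemma step_bound:
  assumes "bad \<sigma> b" "\<And>f. \<phi> (upd \<sigma> b f) \<le> M" "0 \<le> M"
  shows "step b \<phi> \<sigma> \<le> M"
proof -
  have e: "pair_at \<sigma> b \<in> E (fst b)" using assms by (simp add: bad_def)
  have "step b \<phi> \<sigma> \<le> (\<Sum>f\<in>- E (fst b). a (fst b) (pair_at \<sigma> b) f * M)"
    unfolding step_def using assms e by (auto intro!: sum_mono mult_left_mono a_nonneg)
  also have "\<dots> = (\<Sum>f\<in>- E (fst b). a (fst b) (pair_at \<sigma> b) f) * M" by (simp add: sum_distrib_right)
  also have "\<dots> \<le> 1 * M" using a_sum[OF e] assms(3) by (intro mult_right_mono) auto
  finally show ?thesis by simp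
qed

lemma step_idem:
  assumes "c \<in> B" shows "step c (step c \<phi>) = step c \<phi>"
proof
  fix \<sigma> show "step c (step c \<phi>) \<sigma> = step c \<phi> \<sigma>"
  proof (cases "bad \<sigma> c")
    case True
    have "step c \<phi> (upd \<sigma> c f) = \<phi> (upd \<sigma> c f)" if "f \<notin> E (fst c)" for f
      using that bad_upd[OF assms] by (simp add: step_def)
    then show ?thesis using True by (simp add: step_def[of c _ \<sigma>])
  qed (simp add: step_def)
qed

lemma step_commute:
  assumes "sites b \<inter> sites c = {}" shows "step b (step c \<phi>) \<sigma> = step c (step b \<phi>) \<sigma>"
proof -
  have cb: "sites c \<inter> sites b = {}" using assms by blast
  have *: "step c \<phi> (upd \<sigma> b f) = (if bad \<sigma> c then (\<Sum>g\<in>- E (fst c). a (fst c) (pair_at \<sigma> c) g * \<phi> (upd (upd \<sigma> c g) b f)) else \<phi> (upd \<sigma> b f))" for f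
    by (simp add: step_def bad_upd_disjoint[OF assms] pair_at_upd_disjoint[OF assms] upd_commute[OF assms])
  have **: "step b \<phi> (upd \<sigma> c g) = (if bad \<sigma> b then (\<Sum>f\<in>- E (fst b). a (fst b) (pair_at \<sigma> b) f * \<phi> (upd (upd \<sigma> c g) b f)) else \<phi> (upd \<sigma> c g))" for g
    using cb by (simp add: step_def bad_upd_disjoint pair_at_upd_disjoint)
  show ?thesis
    unfolding step_def[of b "step c \<phi>" \<sigma>] step_def[of c "step b \<phi>" \<sigma>] * **
    by (auto simp: step_def sum_distrib_left mult_ac intro: sum.swap)
qed

text \<open>Substitutions at disjoint bonds commute, overlapping distinct bonds are never bad
  together, and a bond at rest keeps all bonds touching it from being bad. In each clause this
  reduces the claim for \<open>step c \<phi>\<close> to the same property of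
  \<open>\<phi>\<close>.\<close>

lemma tame_step:
  assumes t: "tame \<phi>" and c: "c \<in> B"
  shows "tame (step c \<phi>)"
  unfolding tame_def
proof (intro conjI allI ballI impI)
  fix \<sigma> show "0 \<le> step c \<phi> \<sigma>"
    unfolding step_def bad_def using tame_nonneg[OF t]
    by (auto simp del: split_paired_All split_paired_Ex intro!: sum_nonneg mult_nonneg_nonneg[OF a_nonneg])
next
  fix S \<sigma> \<sigma>' assume f: "frozen S \<sigma>" "frozen S \<sigma>'" and eq: "\<forall>x. x \<notin> S \<longrightarrow> \<sigma> x = \<sigma>' x"
  show "step c \<phi> \<sigma> = step c \<phi> \<sigma>'"
  proof (cases "sites c \<inter> S = {}")
    case True
    have s: "\<sigma> x = \<sigma>' x" if "x \<in> sites c" for x using that True eq by blast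
    have "\<phi> (upd \<sigma> c g) = \<phi> (upd \<sigma>' c g)" for g
    proof (rule tame_frozen[OF t])
      show "frozen S (upd \<sigma> c g)" "frozen S (upd \<sigma>' c g)"
        by (rule frozen_cong[OF f(1)] frozen_cong[OF f(2)], rule upd_other[symmetric], use True in blast)+
      show "upd \<sigma> c g x = upd \<sigma>' c g x" if "x \<notin> S" for x
        using that eq by (cases c; cases g) auto
    qed
    moreover have "\<phi> \<sigma> = \<phi> \<sigma>'" using tame_frozen[OF t f] eq by blast
    ultimately show ?thesis
      using bad_cong[of c \<sigma> \<sigma>'] pair_at_cong[of c \<sigma> \<sigma>'] s by (simp add: step_def)
  next
    case False
    then have "\<not> bad \<sigma> c" "\<not> bad \<sigma>' c" using frozen_not_bad f c by blast+
    then show ?thesis using tame_frozen[OF t f] eq by (simp add: step_def)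
  qed
next
  fix \<sigma> b f assume b: "b \<in> B"
  show "step c \<phi> (upd \<sigma> b f) \<le> step c \<phi> (at_rest \<sigma> b)"
  proof (cases "sites b \<inter> sites c = {}")
    case True
    have "\<phi> (upd (upd \<sigma> b f) c g) \<le> \<phi> (upd (at_rest \<sigma> b) c g)" for g
      using tame_rest[OF t b, of "upd \<sigma> c g" f] by (simp add: upd_commute[OF True])
    then show ?thesis using tame_rest[OF t b]
      by (auto simp: step_def bad_upd_disjoint[OF True] pair_at_upd_disjoint[OF True] bad_def
          intro!: sum_mono mult_left_mono a_nonneg)
  next
    case False
    have nb: "\<not> bad (at_rest \<sigma> b) c"
      using frozen_not_bad[OF frozen_rest[OF b] c] False by blast
    then have rhs: "step c \<phi> (at_rest \<sigma> b) = \<phi> (at_rest \<sigma> b)" by (simp add: step_def)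
    show ?thesis
    proof (cases "bad (upd \<sigma> b f) c")
      case bad: True
      \<comment> \<open>Putting \<open>c\<close> and afterwards \<open>b\<close> at rest can only
        raise \<open>\<phi>\<close>. The result differs from \<open>at_rest \<sigma> b\<close> only
        within the two bonds, which are frozen in both configurations, so \<open>\<phi>\<close>
        takes the same value there.\<close>
      let ?\<tau> = "at_rest (at_rest (upd \<sigma> b f) c) b"
      have 1: "\<phi> ?\<tau> = \<phi> (at_rest \<sigma> b)"
      proof (rule tame_frozen[OF t, of "sites b \<union> sites c"])
        show "frozen (sites b \<union> sites c) ?\<tau>"
        proof (rule frozenI[OF b c False])
          fix w assume w: "w \<in> sites c - sites b"
          then show "cls (?\<tau> w) \<in> {None, Some (slot c w)}"
            using at_rest_cls[OF c, of w "upd \<sigma> b f"] by (auto simp: upd_other)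
        qed simp
        show "frozen (sites b \<union> sites c) (at_rest \<sigma> b)"
        proof (rule frozenI[OF b c False])
          fix w assume w: "w \<in> sites c - sites b"
          then show "cls (at_rest \<sigma> b w) \<in> {None, Some (slot c w)}"
            using bad_cls[OF bad c, of w] by (auto simp: upd_other)
        qed simp
      qed (auto simp: upd_other)
      have "\<phi> (upd (upd \<sigma> b f) c g) \<le> \<phi> (at_rest \<sigma> b)" for g
      proof -
        have "\<phi> (upd (upd \<sigma> b f) c g) \<le> \<phi> (at_rest (upd \<sigma> b f) c)" by (rule tame_rest[OF t c])
        also have "at_rest (upd \<sigma> b f) c = upd (at_rest (upd \<sigma> b f) c) b (pair_at (at_rest (upd \<sigma> b f) c) b)"
          by (cases b) auto
        also have "\<phi> \<dots> \<le> \<phi> ?\<tau>" by (rule tame_rest[OF t b])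
        finally show ?thesis using 1 by simp
      qed
      then show ?thesis unfolding rhs by (intro step_bound bad tame_nonneg[OF t])
    next
      case False
      then show ?thesis unfolding rhs using tame_rest[OF t b] by (simp add: step_def)
    qed
  qed
next
  fix b \<sigma> assume b: "b \<in> B"
  show "step b (step c \<phi>) \<sigma> \<le> step c \<phi> \<sigma>"
  proof (cases "sites b \<inter> sites c = {}")
    case True
    have "step b (step c \<phi>) \<sigma> = step c (step b \<phi>) \<sigma>" by (rule step_commute[OF True])
    also have "\<dots> \<le> step c \<phi> \<sigma>" by (intro step_mono tame_step_le[OF t b])
    finally show ?thesis .
  next
    case False
    show ?thesis
    proof (cases "bad \<sigma> b \<and> b \<noteq> c")
      case True
      \<comment> \<open>Overlapping distinct bonds are never bad together, so at \<sigma> the step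
        at \<open>c\<close> does nothing.\<close>
      then have nc: "\<not> bad \<sigma> c" using bad_unique[of \<sigma> b c] b c False by blast
      have "step b (step c \<phi>) \<sigma> \<le> step b \<phi> \<sigma>" by (intro step_mono tame_step_le[OF t c])
      also have "\<dots> \<le> \<phi> \<sigma>" by (rule tame_step_le[OF t b])
      finally show ?thesis using nc by (simp add: step_def[of c \<phi> \<sigma>])
    next
      case False
      then have "step b (step c \<phi>) \<sigma> = step c \<phi> \<sigma>"
        by (cases "b = c") (simp_all add: step_idem[OF c] step_def[of b])
      then show ?thesis by simp
    qed
  qed
qed

lemma tame_one: "tame (\<lambda>_. 1)"
  unfolding tame_def by (auto simp: step_def bad_def a_sum)

text \<open>The resting pair is frozen, so no bond touching it is bad, and the other bonds do not
  notice the change. A jump to rest thus has no offspring.\<close>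

lemma bads_at_rest:
  assumes "c \<in> bads \<sigma>" shows "bads (at_rest \<sigma> c) \<subseteq> bads \<sigma> - {c}"
proof
  fix b assume b: "b \<in> bads (at_rest \<sigma> c)"
  have c: "c \<in> B" using assms by (simp add: bads_def)
  have bB: "b \<in> B" using b by (simp add: bads_def)
  have dis: "sites c \<inter> sites b = {}"
    using b frozen_not_bad[OF frozen_rest[OF c] bB] by (auto simp: bads_def)
  then have "bad \<sigma> b" using b bad_upd_disjoint by (simp add: bads_def)
  moreover have "b \<noteq> c" using dis by (cases c) auto
  ultimately show "b \<in> bads \<sigma> - {c}" using bB by (simp add: bads_def)
qed

section \<open>Geometric decay of the excess over a fixed point\<close>

lemma finite_bads: "finite (bads \<sigma>)"
  using finite_B by (simp add: bads_def)

text \<open>Since distinct bad bonds share no site, choosing a common site with \<open>c\<close> is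
  injective on them, and \<open>c\<close> has two sites. This bounds the offspring of a
  jump.\<close>

lemma bads_touching:
  assumes "c \<in> B"
  shows "card {b \<in> bads \<tau>. sites b \<inter> sites c \<noteq> {}} \<le> 2"
proof -
  let ?X = "{b \<in> bads \<tau>. sites b \<inter> sites c \<noteq> {}}"
  define h where "h b = (SOME z. z \<in> sites b \<inter> sites c)" for b
  have h: "h b \<in> sites b \<inter> sites c" if "b \<in> ?X" for b
    unfolding h_def by (rule someI_ex) (use that in blast)
  have "inj_on h ?X"
  proof (rule inj_onI)
    fix b b' assume "b \<in> ?X" "b' \<in> ?X" "h b = h b'"
    then show "b = b'" using h[of b] h[of b'] bad_unique[of \<tau> b b' "h b"] by (auto simp: bads_def)
  qed
  then have "card ?X \<le> card (sites c)"
    using h by (intro card_inj_on_le) (auto, cases c, auto)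
  also have "\<dots> \<le> 2" by (cases c) (auto simp: card_insert_if)
  finally show ?thesis .
qed

text \<open>Serves as a bound for the ratio of an iterate to the fixed point, with one factor per
  bad bond. The factor depends on the bond because within a sweep the factors are lowered one at a
  time.\<close>

definition weight :: "(bool \<times> 's \<times> 's \<Rightarrow> real) \<Rightarrow> ('s \<Rightarrow> 'l) \<Rightarrow> real" where
  "weight w \<sigma> = (\<Prod>b\<in>bads \<sigma>. w b)"

lemma sum_rest_split:
  "(\<Sum>f\<in>- E i. h f) = h (rest i) + (\<Sum>f\<in>- E i - {rest i}. h f)"
  using rest_notin by (intro sum.remove) auto

text \<open>Measured by the contributions to \<open>\<psi> \<sigma>\<close>, a jump of
  \<open>c\<close> goes to rest except for a fraction at most \<open>q\<close>. At rest the factor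
  of \<open>c\<close> disappears and none is added; otherwise at most two new bad bonds cost
  \<open>\<rho>^2\<close>. The average is \<open>1 + q * (\<rho>^2 - 1)\<close>.\<close>

lemma step_weight:
  assumes \<psi>: "tame \<psi>" "step c \<psi> = \<psi>" and c: "c \<in> B"
    and w: "\<And>b. 1 \<le> w b" "\<And>b. w b \<le> \<rho>"
    and \<phi>: "\<And>\<sigma>. \<phi> \<sigma> \<le> \<psi> \<sigma> * weight w \<sigma>"
  shows "step c \<phi> \<sigma> \<le> \<psi> \<sigma> * weight (w(c := 1 + q * (\<rho>\<^sup>2 - 1))) \<sigma>"
proof (cases "bad \<sigma> c")
  case False
  then have "weight (w(c := 1 + q * (\<rho>\<^sup>2 - 1))) \<sigma> = weight w \<sigma>"
    unfolding weight_def by (intro prod.cong) (auto simp: bads_def)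
  then show ?thesis using False \<phi> by (simp add: step_def)
next
  case True
  let ?e = "pair_at \<sigma> c" and ?i = "fst c"
  have e: "?e \<in> E ?i" using True by (simp add: bad_def)
  have cb: "c \<in> bads \<sigma>" using True c by (simp add: bads_def)
  define P where "P = (\<Prod>b\<in>bads \<sigma> - {c}. w b)"
  have w0: "0 \<le> w b" for b using w(1)[of b] by simp
  have \<rho>: "1 \<le> \<rho>" using w order_trans by blast
  have P0: "0 \<le> P" unfolding P_def by (intro prod_nonneg) (use w0 in auto)
  have W: "weight (w(c := 1 + q * (\<rho>\<^sup>2 - 1))) \<sigma> = (1 + q * (\<rho>\<^sup>2 - 1)) * P"
    unfolding weight_def P_def using cb finite_bads by (subst prod.remove[of _ c]) (auto intro!: prod.cong)
  have r1: "weight w (at_rest \<sigma> c) \<le> P"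
    unfolding weight_def P_def using bads_at_rest[OF cb] finite_bads w w0
    by (intro prod_mono2) auto
  have r2: "weight w (upd \<sigma> c f) \<le> \<rho>\<^sup>2 * P" for f
  proof -
    let ?\<tau> = "upd \<sigma> c f"
    let ?X = "{b \<in> bads ?\<tau>. sites b \<inter> sites c \<noteq> {}}"
    have "weight w ?\<tau> = (\<Prod>b\<in>?X. w b) * (\<Prod>b\<in>bads ?\<tau> - ?X. w b)"
      unfolding weight_def using finite_bads
      by (subst prod.subset_diff[of ?X]) (auto simp: mult.commute)
    moreover have "(\<Prod>b\<in>?X. w b) \<le> \<rho>\<^sup>2"
    proof -
      have "(\<Prod>b\<in>?X. w b) \<le> (\<Prod>b\<in>?X. \<rho>)" using w w0 by (intro prod_mono) auto
      also have "\<dots> = \<rho> ^ card ?X" by simp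
      also have "\<dots> \<le> \<rho>\<^sup>2" using bads_touching[OF c] \<rho> by (intro power_increasing) auto
      finally show ?thesis .
    qed
    moreover have "(\<Prod>b\<in>bads ?\<tau> - ?X. w b) \<le> P"
      unfolding P_def
    proof (intro prod_mono2)
      show "bads ?\<tau> - ?X \<subseteq> bads \<sigma> - {c}"
      proof
        fix b assume b: "b \<in> bads ?\<tau> - ?X"
        then have dis: "sites c \<inter> sites b = {}" by blast
        have "b \<noteq> c" using dis by (cases c) auto
        then show "b \<in> bads \<sigma> - {c}" using b bad_upd_disjoint[OF dis] by (simp add: bads_def)
      qed
    qed (use finite_bads w w0 in auto)
    moreover have "0 \<le> (\<Prod>b\<in>bads ?\<tau> - ?X. w b)" using w0 by (intro prod_nonneg) auto
    ultimately show ?thesis using \<rho> by (simp add: mult_mono)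
  qed
  let ?a = "a ?i ?e"
  let ?R = "rest ?i"
  have \<psi>0: "0 \<le> \<psi> \<tau>" for \<tau> by (rule tame_nonneg[OF \<psi>(1)])
  have b1: "\<phi> (at_rest \<sigma> c) \<le> \<psi> (at_rest \<sigma> c) * P"
    using \<phi>[of "at_rest \<sigma> c"] mult_left_mono[OF r1 \<psi>0[of "at_rest \<sigma> c"]] by linarith
  have b2: "\<phi> (upd \<sigma> c f) \<le> \<psi> (upd \<sigma> c f) * (\<rho>\<^sup>2 * P)" for f
    using \<phi>[of "upd \<sigma> c f"] mult_left_mono[OF r2 \<psi>0[of "upd \<sigma> c f"]] order_trans by blast
  define Z where "Z = (\<Sum>f\<in>- E ?i - {?R}. ?a f * \<psi> (upd \<sigma> c f))"
  have fix': "\<psi> \<sigma> = ?a ?R * \<psi> (at_rest \<sigma> c) + Z"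
  proof -
    have "\<psi> \<sigma> = step c \<psi> \<sigma>" using \<psi>(2) by simp
    then show ?thesis using True sum_rest_split[of "\<lambda>f. ?a f * \<psi> (upd \<sigma> c f)"]
      by (simp add: step_def Z_def)
  qed
  \<comment> \<open>The weights other than that of the resting pair sum to at most \<open>q\<close>
    times that weight, and rest maximises \<psi>, so they contribute at most the fraction
    \<open>q\<close> of the value.\<close>
  have Z: "Z \<le> q * \<psi> \<sigma>"
  proof -
    have "Z \<le> (\<Sum>f\<in>- E ?i - {?R}. ?a f * \<psi> (at_rest \<sigma> c))"
      unfolding Z_def using a_nonneg[OF e] tame_rest[OF \<psi>(1) c] by (intro sum_mono mult_left_mono) auto
    also have "\<dots> \<le> q * \<alpha> * \<psi> (at_rest \<sigma> c)"
      using a_other[OF e] \<psi>0 by (simp add: sum_distrib_right[symmetric] mult_right_mono)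
    also have "\<dots> \<le> q * (?a ?R * \<psi> (at_rest \<sigma> c))"
      using a_rest[OF e] alpha \<psi>0 by (simp add: mult_left_mono mult_right_mono mult.assoc)
    also have "\<dots> \<le> q * \<psi> \<sigma>"
    proof (rule mult_left_mono)
      have "0 \<le> Z" unfolding Z_def using a_nonneg[OF e] \<psi>0 by (intro sum_nonneg) auto
      then show "?a ?R * \<psi> (at_rest \<sigma> c) \<le> \<psi> \<sigma>" using fix' by simp
    qed (use alpha in auto)
    finally show ?thesis .
  qed
  have "step c \<phi> \<sigma> = ?a ?R * \<phi> (at_rest \<sigma> c) + (\<Sum>f\<in>- E ?i - {?R}. ?a f * \<phi> (upd \<sigma> c f))"
    using True sum_rest_split[of "\<lambda>f. ?a f * \<phi> (upd \<sigma> c f)"] by (simp add: step_def)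
  also have "\<dots> \<le> ?a ?R * (\<psi> (at_rest \<sigma> c) * P) + (\<Sum>f\<in>- E ?i - {?R}. ?a f * (\<psi> (upd \<sigma> c f) * (\<rho>\<^sup>2 * P)))"
    using b1 b2 a_nonneg[OF e] rest_notin by (intro add_mono mult_left_mono sum_mono) auto
  also have "\<dots> = ?a ?R * \<psi> (at_rest \<sigma> c) * P + Z * (\<rho>\<^sup>2 * P)"
    by (simp add: Z_def sum_distrib_right mult.assoc)
  also have "\<dots> = P * (\<psi> \<sigma> + (\<rho>\<^sup>2 - 1) * Z)" unfolding fix' by (simp add: algebra_simps)
  also have "\<dots> \<le> P * (\<psi> \<sigma> + (\<rho>\<^sup>2 - 1) * (q * \<psi> \<sigma>))"
    using P0 Z \<rho> by (intro mult_left_mono add_left_mono) auto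
  also have "\<dots> = \<psi> \<sigma> * weight (w(c := 1 + q * (\<rho>\<^sup>2 - 1))) \<sigma>" unfolding W by (simp add: algebra_simps)
  finally show ?thesis .
qed

text \<open>Every bond treated by the sweep has its factor lowered from \<rho> to the new value; the
  second condition on \<rho> ensures that \<rho> stays an upper bound for all factors on the
  way.\<close>

lemma sweep_weight:
  assumes \<psi>: "tame \<psi>" "\<And>c. c \<in> B \<Longrightarrow> step c \<psi> = \<psi>"
    and \<rho>: "1 \<le> \<rho>" "1 + q * (\<rho>\<^sup>2 - 1) \<le> \<rho>"
    and \<phi>: "\<And>\<sigma>. \<phi> \<sigma> \<le> \<psi> \<sigma> * \<rho> ^ card (bads \<sigma>)"
    and xs: "set xs \<subseteq> B"
  shows "foldr step xs \<phi> \<sigma> \<le> \<psi> \<sigma> * weight (\<lambda>b. if b \<in> set xs then 1 + q * (\<rho>\<^sup>2 - 1) else \<rho>) \<sigma>"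
  using xs
proof (induction xs arbitrary: \<sigma>)
  case Nil
  then show ?case using \<phi> by (simp add: weight_def)
next
  case (Cons x xs)
  let ?w = "\<lambda>b. if b \<in> set xs then 1 + q * (\<rho>\<^sup>2 - 1) else \<rho>"
  have eq: "?w(x := 1 + q * (\<rho>\<^sup>2 - 1)) = (\<lambda>b. if b \<in> set (x # xs) then 1 + q * (\<rho>\<^sup>2 - 1) else \<rho>)"
    by auto
  have q1: "0 \<le> q * (\<rho>\<^sup>2 - 1)" using alpha \<rho> by simp
  have "step x (foldr step xs \<phi>) \<sigma> \<le> \<psi> \<sigma> * weight (?w(x := 1 + q * (\<rho>\<^sup>2 - 1))) \<sigma>"
    by (rule step_weight) (use Cons \<psi> \<rho> q1 in auto)
  then show ?case by (simp only: eq foldr.simps o_apply)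
qed

lemma tame_foldr:
  assumes "tame \<phi>" "set xs \<subseteq> B"
  shows "tame (foldr step xs \<phi>)" "foldr step xs \<phi> \<sigma> \<le> \<phi> \<sigma>"
  using assms(2)
proof (induction xs arbitrary: \<sigma>)
  case (Cons x xs)
  { case 1 then show ?case using Cons by (auto intro: tame_step) }
  { case 2 then show ?case using Cons tame_step_le[of "foldr step xs \<phi>" x \<sigma>]
      by (auto intro: order_trans) }
qed (use assms in auto)

text \<open>No single step increases a tame function, so if the composite leaves it unchanged, every
  intermediate function is squeezed between equal ones.\<close>

lemma fixed_if_foldr_fixed:
  assumes "tame \<phi>" "set xs \<subseteq> B" "foldr step xs \<phi> = \<phi>"
  shows "b \<in> set xs \<Longrightarrow> step b \<phi> = \<phi>"
  using assms(2,3)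
proof (induction xs)
  case (Cons x xs)
  have x: "x \<in> B" and xs: "set xs \<subseteq> B" using Cons by auto
  have "\<phi> \<sigma> \<le> foldr step xs \<phi> \<sigma>" for \<sigma>
    using tame_step_le[OF tame_foldr(1)[OF assms(1) xs] x, of \<sigma>] Cons.prems(3) by simp
  then have eq: "foldr step xs \<phi> = \<phi>" using tame_foldr(2)[OF assms(1) xs] by (intro ext antisym) auto
  moreover have "step x \<phi> = \<phi>" using Cons.prems(3) eq by simp
  ultimately show ?case using Cons by auto
qed simp

section \<open>The limit of the sweeps\<close>

definition bond_list :: "(bool \<times> 's \<times> 's) list" where
  "bond_list = (SOME xs. set xs = B \<and> distinct xs)"

lemma bond_list: "set bond_list = B" "distinct bond_list"
  using someI_ex[OF finite_distinct_list[OF finite_B]] by (auto simp: bond_list_def)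

definition approx :: "nat \<Rightarrow> ('s \<Rightarrow> 'l) \<Rightarrow> real" where
  "approx T = (foldr step bond_list ^^ T) (\<lambda>_. 1)"

lemma approx_Suc: "approx (Suc T) = foldr step bond_list (approx T)"
  by (simp add: approx_def)

lemma tame_approx: "tame (approx T)"
  by (induction T) (auto simp: approx_def tame_one bond_list intro!: tame_foldr)

lemma approx_decseq: "decseq (\<lambda>T. approx T \<sigma>)"
  by (rule decseq_SucI) (auto simp: approx_Suc bond_list intro!: tame_foldr tame_approx)

definition limit_state :: "('s \<Rightarrow> 'l) \<Rightarrow> real" where
  "limit_state \<sigma> = lim (\<lambda>T. approx T \<sigma>)"

lemma approx_tendsto: "(\<lambda>T. approx T \<sigma>) \<longlonglongrightarrow> limit_state \<sigma>"
proof -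
  have "\<exists>l. (\<lambda>T. approx T \<sigma>) \<longlonglongrightarrow> l"
    using decseq_convergent[OF approx_decseq, of 0 \<sigma>] tame_nonneg[OF tame_approx] by metis
  then show ?thesis unfolding limit_state_def using convergent_LIMSEQ_iff convergent_def by blast
qed

lemma limit_state_le: "limit_state \<sigma> \<le> approx T \<sigma>"
  by (rule decseq_ge[OF approx_decseq approx_tendsto])

lemma step_tendsto:
  assumes "\<And>\<sigma>. (\<lambda>T. X T \<sigma>) \<longlonglongrightarrow> \<phi> \<sigma>"
  shows "(\<lambda>T. step b (X T) \<sigma>) \<longlonglongrightarrow> step b \<phi> \<sigma>"
  unfolding step_def using assms by (auto intro!: tendsto_intros)

lemma foldr_step_tendsto:
  assumes "\<And>\<sigma>. (\<lambda>T. X T \<sigma>) \<longlonglongrightarrow> \<phi> \<sigma>"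
  shows "(\<lambda>T. foldr step xs (X T) \<sigma>) \<longlonglongrightarrow> foldr step xs \<phi> \<sigma>"
  using assms by (induction xs arbitrary: \<sigma>) (auto intro: step_tendsto)

lemma tame_limit_state: "tame limit_state"
  unfolding tame_def
proof (intro conjI allI ballI impI)
  fix \<sigma> show "0 \<le> limit_state \<sigma>"
    using tame_nonneg[OF tame_approx] by (intro LIMSEQ_le_const[OF approx_tendsto]) auto
next
  fix S \<sigma> \<sigma>' assume "frozen S \<sigma>" "frozen S \<sigma>'" "\<forall>x. x \<notin> S \<longrightarrow> \<sigma> x = \<sigma>' x"
  then have "approx T \<sigma> = approx T \<sigma>'" for T using tame_frozen[OF tame_approx] by blast
  then show "limit_state \<sigma> = limit_state \<sigma>'" by (simp add: limit_state_def)
next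
  fix \<sigma> b f assume "b \<in> B"
  then show "limit_state (upd \<sigma> b f) \<le> limit_state (at_rest \<sigma> b)"
    using tame_rest[OF tame_approx] by (intro LIMSEQ_le[OF approx_tendsto approx_tendsto]) blast
next
  fix b \<sigma> assume "b \<in> B"
  then show "step b limit_state \<sigma> \<le> limit_state \<sigma>"
    using tame_step_le[OF tame_approx]
    by (intro LIMSEQ_le[OF step_tendsto[OF approx_tendsto] approx_tendsto]) blast
qed

lemma limit_state_fixed:
  assumes "b \<in> B" shows "step b limit_state = limit_state"
proof -
  have "foldr step bond_list limit_state = limit_state"
  proof
    fix \<sigma>
    have "(\<lambda>T. approx (Suc T) \<sigma>) \<longlonglongrightarrow> foldr step bond_list limit_state \<sigma>"
      unfolding approx_Suc by (rule foldr_step_tendsto[OF approx_tendsto])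
    then show "foldr step bond_list limit_state \<sigma> = limit_state \<sigma>"
      using LIMSEQ_Suc[OF approx_tendsto] LIMSEQ_unique by blast
  qed
  then show ?thesis
    using fixed_if_foldr_fixed[OF tame_limit_state _ _, of bond_list b] assms bond_list by auto
qed

lemma approx_eq_1: "bads \<sigma> = {} \<Longrightarrow> approx T \<sigma> = 1"
proof -
  assume \<sigma>: "bads \<sigma> = {}"
  have *: "foldr step xs \<phi> \<sigma> = \<phi> \<sigma>" if "set xs \<subseteq> B" for xs \<phi>
    using that
  proof (induction xs)
    case (Cons x xs)
    then have "\<not> bad \<sigma> x" using \<sigma> by (cases x) (auto simp: bads_def)
    then show ?case using Cons by (simp add: step_def)
  qed simp
  show ?thesis by (induction T) (use * bond_list in \<open>auto simp: approx_Suc approx_def\<close>)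
qed

text \<open>Send the bad bonds to rest one after the other: each move costs a factor of at least
  \<alpha> and creates no bad bond. This makes the limit positive and also provides the initial
  factor \<open>1 / \<alpha>\<close> for comparing the constant 1 with it.\<close>

lemma limit_state_ge: "\<alpha> ^ card (bads \<sigma>) \<le> limit_state \<sigma>"
proof (induction "card (bads \<sigma>)" arbitrary: \<sigma> rule: less_induct)
  case less
  show ?case
  proof (cases "bads \<sigma> = {}")
    case True
    then have "limit_state \<sigma> = 1"
      using approx_eq_1[OF True] by (simp add: limit_state_def)
    then show ?thesis using True by simp
  next
    case False
    then obtain c where c: "c \<in> bads \<sigma>" by blast
    then have cB: "c \<in> B" and bad: "bad \<sigma> c" by (auto simp: bads_def)
    have e: "pair_at \<sigma> c \<in> E (fst c)" using bad by (simp add: bad_def)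
    have "card (bads (at_rest \<sigma> c)) \<le> card (bads \<sigma> - {c})"
      using bads_at_rest[OF c] finite_bads by (intro card_mono) auto
    also have cs: "\<dots> = card (bads \<sigma>) - 1" using c finite_bads by simp
    finally have le: "card (bads (at_rest \<sigma> c)) \<le> card (bads \<sigma>) - 1" .
    moreover have pos: "0 < card (bads \<sigma>)" using c finite_bads card_gt_0_iff by blast
    ultimately have "\<alpha> ^ card (bads (at_rest \<sigma> c)) \<le> limit_state (at_rest \<sigma> c)" using less by simp
    moreover have "\<alpha> ^ (card (bads \<sigma>) - 1) \<le> \<alpha> ^ card (bads (at_rest \<sigma> c))"
      using le alpha by (intro power_decreasing) auto
    ultimately have "\<alpha> ^ (card (bads \<sigma>) - 1) \<le> limit_state (at_rest \<sigma> c)" by simp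
    then have "\<alpha> * \<alpha> ^ (card (bads \<sigma>) - 1) \<le> a (fst c) (pair_at \<sigma> c) (rest (fst c)) * limit_state (at_rest \<sigma> c)"
      using a_rest[OF e] alpha by (intro mult_mono) auto
    also have "\<dots> \<le> step c limit_state \<sigma>"
      using bad sum_rest_split[of "\<lambda>f. a (fst c) (pair_at \<sigma> c) f * limit_state (upd \<sigma> c f)" "fst c"]
        sum_nonneg[of "- E (fst c) - {rest (fst c)}" "\<lambda>f. a (fst c) (pair_at \<sigma> c) f * limit_state (upd \<sigma> c f)"]
        a_nonneg[OF e] tame_nonneg[OF tame_limit_state]
      by (simp add: step_def)
    also have "\<dots> = limit_state \<sigma>" by (simp add: limit_state_fixed[OF cB])
    finally show ?thesis using pos by (simp add: power_eq_if)
  qed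
qed

lemma limit_state_pos: "0 < limit_state \<sigma>"
  using limit_state_ge[of \<sigma>] alpha zero_less_power[of \<alpha>] by (meson less_le_trans)

text \<open>Each sweep halves the excess of the factor over 1: for \<open>\<rho> = 1 + z\<close> the
  new factor is \<open>1 + q * (\<rho> + 1) * z\<close>, and
  \<open>q * (\<rho> + 1) \<le> 1/2\<close> because \<open>\<rho> \<le> 1 / \<alpha>\<close> and
  \<open>q \<le> \<alpha> / 4\<close>.\<close>

lemma approx_le_weight:
  "approx T \<sigma> \<le> limit_state \<sigma> * (1 + (1 / \<alpha> - 1) / 2 ^ T) ^ card (bads \<sigma>)"
proof (induction T arbitrary: \<sigma>)
  case 0
  have "1 = \<alpha> ^ card (bads \<sigma>) * (1 / \<alpha>) ^ card (bads \<sigma>)"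
    using alpha by (simp add: power_one_over)
  also have "\<dots> \<le> limit_state \<sigma> * (1 / \<alpha>) ^ card (bads \<sigma>)"
    using limit_state_ge alpha by (intro mult_right_mono) auto
  finally show ?case by (simp add: approx_def)
next
  case (Suc T)
  define z where "z = (1 / \<alpha> - 1) / 2 ^ T"
  define \<rho> where "\<rho> = 1 + z"
  have a1: "1 \<le> 1 / \<alpha>" using alpha by simp
  have z: "0 \<le> z" "z \<le> 1 / \<alpha> - 1"
  proof -
    show "0 \<le> z" using a1 by (simp add: z_def)
    have "z \<le> (1 / \<alpha> - 1) / 1" unfolding z_def using a1 by (intro divide_left_mono) auto
    then show "z \<le> 1 / \<alpha> - 1" by simp
  qed
  have "q * (\<rho> + 1) \<le> \<alpha> / 4 * (1 / \<alpha> + 1)"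
    using alpha z a1 unfolding \<rho>_def by (intro mult_mono) auto
  also have "\<dots> = 1 / 4 + \<alpha> / 4" using alpha by (simp add: field_simps)
  also have "\<dots> \<le> 1 / 2" using alpha by simp
  finally have half: "q * (\<rho> + 1) \<le> 1 / 2" .
  have "1 + q * (\<rho>\<^sup>2 - 1) = 1 + q * (\<rho> + 1) * z"
    by (simp add: \<rho>_def power2_eq_square algebra_simps)
  also have "\<dots> \<le> 1 + 1 / 2 * z" using half z by (intro add_left_mono mult_right_mono) auto
  finally have \<rho>': "1 + q * (\<rho>\<^sup>2 - 1) \<le> 1 + z / 2" by simp
  have l1: "1 \<le> \<rho>" using z by (simp add: \<rho>_def)
  have "approx (Suc T) \<sigma> \<le> limit_state \<sigma> * weight (\<lambda>b. if b \<in> set bond_list then 1 + q * (\<rho>\<^sup>2 - 1) else \<rho>) \<sigma>"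
    unfolding approx_Suc
  proof (rule sweep_weight)
    show "1 + q * (\<rho>\<^sup>2 - 1) \<le> \<rho>" using \<rho>' z by (simp add: \<rho>_def)
    show "approx T \<sigma> \<le> limit_state \<sigma> * \<rho> ^ card (bads \<sigma>)" for \<sigma>
      using Suc by (simp add: \<rho>_def z_def)
  qed (use tame_limit_state limit_state_fixed l1 bond_list in auto)
  also have "weight (\<lambda>b. if b \<in> set bond_list then 1 + q * (\<rho>\<^sup>2 - 1) else \<rho>) \<sigma> = (1 + q * (\<rho>\<^sup>2 - 1)) ^ card (bads \<sigma>)"
    unfolding weight_def bond_list by (subst prod.cong[OF refl, of _ _ "\<lambda>_. 1 + q * (\<rho>\<^sup>2 - 1)"]) (auto simp: bads_def)
  also have "\<dots> \<le> (1 + z / 2) ^ card (bads \<sigma>)"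
    using \<rho>' alpha l1 by (intro power_mono) auto
  finally show ?case using limit_state_pos[of \<sigma>] by (simp add: z_def mult_left_mono field_simps)
qed

lemma approx_le:
  "approx T \<sigma> \<le> limit_state \<sigma> * (1 + (1 / \<alpha> - 1) / 2 ^ T) ^ card B"
proof -
  have "card (bads \<sigma>) \<le> card B" using finite_B by (intro card_mono) (auto simp: bads_def)
  then have "(1 + (1 / \<alpha> - 1) / 2 ^ T) ^ card (bads \<sigma>) \<le> (1 + (1 / \<alpha> - 1) / 2 ^ T) ^ card B"
    using alpha by (intro power_increasing) auto
  then have "limit_state \<sigma> * (1 + (1 / \<alpha> - 1) / 2 ^ T) ^ card (bads \<sigma>)
      \<le> limit_state \<sigma> * (1 + (1 / \<alpha> - 1) / 2 ^ T) ^ card B"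
    using limit_state_pos[of \<sigma>] by (intro mult_left_mono) auto
  then show ?thesis using approx_le_weight[of T \<sigma>] by linarith
qed

end

section \<open>Schmidt rank across a cut\<close>

definition depends_on :: "'s set \<Rightarrow> (('s \<Rightarrow> 'l) \<Rightarrow> real) \<Rightarrow> bool" where
  "depends_on S f \<longleftrightarrow> (\<forall>\<sigma> \<tau>. (\<forall>x\<in>S. \<sigma> x = \<tau> x) \<longrightarrow> f \<sigma> = f \<tau>)"

text \<open>Bounds the Schmidt rank across \<open>S\<close> by \<open>d^(2 n)\<close>, with
  \<open>d\<close> the number of labels. The products are indexed by lists of label pairs so that a
  substitution crossing the cut just prepends one entry.\<close>

definition separation ::
  "'s set \<Rightarrow> nat \<Rightarrow> (('s \<Rightarrow> 'l::finite) \<Rightarrow> real) \<Rightarrow> (('l \<times> 'l) list \<Rightarrow> ('s \<Rightarrow> 'l) \<Rightarrow> real) \<Rightarrow>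
    (('l \<times> 'l) list \<Rightarrow> ('s \<Rightarrow> 'l) \<Rightarrow> real) \<Rightarrow> bool" where
  "separation S n \<phi> f g \<longleftrightarrow> (\<forall>s. depends_on S (f s)) \<and> (\<forall>s. depends_on (- S) (g s)) \<and>
     (\<forall>\<sigma>. \<phi> \<sigma> = (\<Sum>s | length s = n. f s \<sigma> * g s \<sigma>))"

definition separable :: "'s set \<Rightarrow> nat \<Rightarrow> (('s \<Rightarrow> 'l::finite) \<Rightarrow> real) \<Rightarrow> bool" where
  "separable S n \<phi> \<longleftrightarrow> (\<exists>f g. separation S n \<phi> f g)"

lemma separableI:
  fixes f g :: "('l::finite \<times> 'l) list \<Rightarrow> ('s \<Rightarrow> 'l) \<Rightarrow> real"
  assumes "\<And>s. depends_on S (f s)" "\<And>s. depends_on (- S) (g s)"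
    "\<And>\<sigma>. \<phi> \<sigma> = (\<Sum>s | length s = n. f s \<sigma> * g s \<sigma>)"
  shows "separable S n \<phi>"
  using assms unfolding separable_def separation_def by (intro exI[of _ f] exI[of _ g]) simp

lemma separationD:
  assumes "separation S n \<phi> f g"
  shows "depends_on S (f s)" "depends_on (- S) (g s)"
    "\<phi> \<sigma> = (\<Sum>s | length s = n. f s \<sigma> * g s \<sigma>)"
  using assms unfolding separation_def by simp_all

lemma sum_pairs: "(\<Sum>p\<in>UNIV. H p) = (\<Sum>j\<in>UNIV. \<Sum>k\<in>UNIV. H (j, k) :: 'b::comm_monoid_add)"
  by (simp add: sum.cartesian_product split_def)

lemma sum_lists_Suc:
  fixes h :: "('l::finite \<times> 'l) list \<Rightarrow> real"
  shows "(\<Sum>s | length s = Suc n. h s) = (\<Sum>j\<in>UNIV. \<Sum>k\<in>UNIV. \<Sum>s | length s = n. h ((j, k) # s))"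
proof -
  have "(\<Sum>s | length s = Suc n. h s) = (\<Sum>(p, s)\<in>UNIV \<times> {s. length s = n}. h (p # s))"
    by (rule sum.reindex_bij_witness[of _ "\<lambda>(p, s). p # s" "\<lambda>s. (hd s, tl s)"])
       (auto simp: length_Suc_conv)
  also have "\<dots> = (\<Sum>p\<in>UNIV. \<Sum>s | length s = n. h (p # s))"
    by (rule sum.cartesian_product[symmetric])
  also have "\<dots> = (\<Sum>j\<in>UNIV. \<Sum>k\<in>UNIV. \<Sum>s | length s = n. h ((j, k) # s))"
    by (rule sum_pairs)
  finally show ?thesis .
qed

lemma separable_one: "separable S 0 (\<lambda>_ :: 'a \<Rightarrow> 'b::finite. 1)"
proof -
  have "{s :: ('b \<times> 'b) list. length s = 0} = {[]}" by auto
  then show ?thesis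
    by (intro separableI[of _ "\<lambda>_ _. 1" "\<lambda>_ _. 1"]) (simp_all add: depends_on_def)
qed

text \<open>The two sides communicate only through the label at \<open>x\<close>. The new list entry
  records its old value \<open>j\<close> and its new value \<open>k\<close>: the left factor checks
  that the label is \<open>j\<close> and inserts \<open>k\<close>, while the right factor absorbs
  the kernel and the sum over the new label at \<open>y\<close>.\<close>

lemma separable_cross:
  fixes \<phi> :: "('s \<Rightarrow> 'l::finite) \<Rightarrow> real"
  assumes sep: "separable S n \<phi>" and x: "x \<in> S" and y: "y \<notin> S"
    and eq: "\<And>\<sigma>. \<phi>' \<sigma> = (\<Sum>k\<in>UNIV. \<Sum>l\<in>UNIV. M (\<sigma> x) (\<sigma> y) k l * \<phi> (\<sigma>(x := k, y := l)))"
  shows "separable S (Suc n) \<phi>'"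
proof -
  obtain f g where fg: "separation S n \<phi> f g" using sep by (auto simp: separable_def)
  note f = separationD(1)[OF fg] and g = separationD(2)[OF fg] and \<phi> = separationD(3)[OF fg]
  define f' where "f' s \<sigma> = (if \<sigma> x = fst (hd s) then f (tl s) (\<sigma>(x := snd (hd s))) else 0)"
    for s :: "('l \<times> 'l) list" and \<sigma>
  define g' where "g' s \<sigma> = (\<Sum>l\<in>UNIV. M (fst (hd s)) (\<sigma> y) (snd (hd s)) l * g (tl s) (\<sigma>(y := l)))"
    for s :: "('l \<times> 'l) list" and \<sigma>
  have f1: "f s (\<sigma>(x := k, y := l)) = f s (\<sigma>(x := k))" for s \<sigma> k l
    by (rule f[of s, unfolded depends_on_def, rule_format]) (use y in auto)
  have g1: "g s (\<sigma>(x := k, y := l)) = g s (\<sigma>(y := l))" for s \<sigma> k l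
    by (rule g[of s, unfolded depends_on_def, rule_format]) (use x in auto)
  have fd: "depends_on S (f' s)" for s
    unfolding depends_on_def
  proof (intro allI impI)
    fix \<sigma> \<tau> :: "'s \<Rightarrow> 'l" assume e: "\<forall>z\<in>S. \<sigma> z = \<tau> z"
    have "f (tl s) (\<sigma>(x := snd (hd s))) = f (tl s) (\<tau>(x := snd (hd s)))"
      by (rule f[unfolded depends_on_def, rule_format]) (use e in auto)
    then show "f' s \<sigma> = f' s \<tau>" using e x by (simp add: f'_def)
  qed
  have gd: "depends_on (- S) (g' s)" for s
    unfolding depends_on_def
  proof (intro allI impI)
    fix \<sigma> \<tau> :: "'s \<Rightarrow> 'l" assume e: "\<forall>z\<in>- S. \<sigma> z = \<tau> z"
    have "g (tl s) (\<sigma>(y := l)) = g (tl s) (\<tau>(y := l))" for l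
      by (rule g[unfolded depends_on_def, rule_format]) (use e in auto)
    then show "g' s \<sigma> = g' s \<tau>" using e y by (simp add: g'_def)
  qed
  have "\<phi>' \<sigma> = (\<Sum>s | length s = Suc n. f' s \<sigma> * g' s \<sigma>)" for \<sigma>
  proof -
    have "(\<Sum>s | length s = Suc n. f' s \<sigma> * g' s \<sigma>) =
        (\<Sum>k\<in>UNIV. \<Sum>j\<in>UNIV. \<Sum>s | length s = n. f' ((j, k) # s) \<sigma> * g' ((j, k) # s) \<sigma>)"
      unfolding sum_lists_Suc by (rule sum.swap)
    also have "\<dots> = (\<Sum>k\<in>UNIV. \<Sum>s | length s = n. f s (\<sigma>(x := k)) * g' ((\<sigma> x, k) # s) \<sigma>)"
    proof (rule sum.cong[OF refl])
      fix k
      have "(\<Sum>j\<in>UNIV. \<Sum>s | length s = n. f' ((j, k) # s) \<sigma> * g' ((j, k) # s) \<sigma>)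
         = (\<Sum>j\<in>UNIV. if j = \<sigma> x then \<Sum>s | length s = n. f s (\<sigma>(x := k)) * g' ((\<sigma> x, k) # s) \<sigma> else 0)"
        by (intro sum.cong) (auto simp: f'_def)
      then show "(\<Sum>j\<in>UNIV. \<Sum>s | length s = n. f' ((j, k) # s) \<sigma> * g' ((j, k) # s) \<sigma>)
         = (\<Sum>s | length s = n. f s (\<sigma>(x := k)) * g' ((\<sigma> x, k) # s) \<sigma>)" by simp
    qed
    also have "\<dots> = (\<Sum>k\<in>UNIV. \<Sum>l\<in>UNIV. M (\<sigma> x) (\<sigma> y) k l *
        (\<Sum>s | length s = n. f s (\<sigma>(x := k)) * g s (\<sigma>(y := l))))"
    proof (rule sum.cong[OF refl])
      fix k
      show "(\<Sum>s | length s = n. f s (\<sigma>(x := k)) * g' ((\<sigma> x, k) # s) \<sigma>) =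
         (\<Sum>l\<in>UNIV. M (\<sigma> x) (\<sigma> y) k l * (\<Sum>s | length s = n. f s (\<sigma>(x := k)) * g s (\<sigma>(y := l))))"
        unfolding g'_def sum_distrib_left by (subst sum.swap) (simp add: mult_ac)
    qed
    also have "\<dots> = \<phi>' \<sigma>" unfolding eq \<phi> f1 g1 by simp
    finally show ?thesis by simp
  qed
  then show ?thesis by (rule separableI[OF fd gd])
qed

context rewriting
begin

lemma upd_cong: "\<sigma> x = \<tau> x \<Longrightarrow> upd \<sigma> c g x = upd \<tau> c g x"
  by (cases c; cases g) simp

lemma step_depends_on:
  assumes "sites c \<subseteq> S" "depends_on S f" shows "depends_on S (step c f)"
  unfolding depends_on_def
proof (intro allI impI)
  fix \<sigma> \<tau> :: "'s \<Rightarrow> 'l" assume e: "\<forall>x\<in>S. \<sigma> x = \<tau> x"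
  have s: "\<sigma> x = \<tau> x" if "x \<in> sites c" for x using that e assms(1) by blast
  have "f (upd \<sigma> c g) = f (upd \<tau> c g)" for g
    by (rule assms(2)[unfolded depends_on_def, rule_format]) (rule upd_cong, simp add: e)
  moreover have "f \<sigma> = f \<tau>" using assms(2) e unfolding depends_on_def by blast
  ultimately show "step c f \<sigma> = step c f \<tau>"
    using bad_cong[of c \<sigma> \<tau>] pair_at_cong[of c \<sigma> \<tau>] s by (simp add: step_def)
qed

lemma depends_on_upd:
  assumes "sites c \<inter> S = {}" "depends_on S f" shows "f (upd \<sigma> c g) = f \<sigma>"
  by (rule assms(2)[unfolded depends_on_def, rule_format], rule upd_other) (use assms(1) in blast)

lemma separable_step_same:
  assumes "separable S n \<phi>" "sites c \<subseteq> S \<or> sites c \<subseteq> - S"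
  shows "separable S n (step c \<phi>)"
proof -
  obtain f g where fg: "separation S n \<phi> f g" using assms(1) by (auto simp: separable_def)
  note f = separationD(1)[OF fg] and g = separationD(2)[OF fg] and \<phi> = separationD(3)[OF fg]
  show ?thesis using assms(2)
  proof
    assume c: "sites c \<subseteq> S"
    have g1: "g s (upd \<sigma> c h) = g s \<sigma>" for s \<sigma> h
      by (rule depends_on_upd[OF _ g]) (use c in blast)
    have "step c \<phi> \<sigma> = (\<Sum>s | length s = n. step c (f s) \<sigma> * g s \<sigma>)" for \<sigma>
      unfolding step_def \<phi> g1
      by (auto simp: sum_distrib_left sum_distrib_right mult.assoc intro: sum.swap)
    then show ?thesis
      by (intro separableI[of _ "\<lambda>s. step c (f s)" g] step_depends_on[OF c f] g)
  next
    assume c: "sites c \<subseteq> - S"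
    have f1: "f s (upd \<sigma> c h) = f s \<sigma>" for s \<sigma> h
      by (rule depends_on_upd[OF _ f]) (use c in blast)
    have "step c \<phi> \<sigma> = (\<Sum>s | length s = n. f s \<sigma> * step c (g s) \<sigma>)" for \<sigma>
      unfolding step_def \<phi> f1
      by (auto simp: sum_distrib_left sum_distrib_right mult_ac intro: sum.swap)
    then show ?thesis
      by (intro separableI[of _ f "\<lambda>s. step c (g s)"] step_depends_on[OF c g] f)
  qed
qed

lemma separable_step_cross:
  assumes sep: "separable S n \<phi>" and c: "c \<in> B" and cr: "\<not> sites c \<subseteq> S" "\<not> sites c \<subseteq> - S"
  shows "separable S (Suc n) (step c \<phi>)"
proof -
  obtain i x y where cx: "c = (i, x, y)" by (cases c) blast
  have neq: "x \<noteq> y" using B_neq c cx by blast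
  \<comment> \<open>The kernel of \<open>step c\<close> on all pairs of labels, with the identity at
    pairs outside \<open>E i\<close>, so that no case distinction on badness is left in the
    sum.\<close>
  define m where "m e h = (if e \<in> E i then if h \<in> E i then 0 else a i e h else if h = e then 1 else 0)" for e h
  have st: "step c \<phi> \<sigma> = (\<Sum>k\<in>UNIV. \<Sum>l\<in>UNIV. m (\<sigma> x, \<sigma> y) (k, l) * \<phi> (\<sigma>(x := k, y := l)))" for \<sigma>
  proof -
    have "(\<Sum>k\<in>UNIV. \<Sum>l\<in>UNIV. m (\<sigma> x, \<sigma> y) (k, l) * \<phi> (\<sigma>(x := k, y := l)))
        = (\<Sum>h\<in>UNIV. m (\<sigma> x, \<sigma> y) h * \<phi> (upd \<sigma> c h))"
      by (simp add: cx sum_pairs)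
    also have "\<dots> = step c \<phi> \<sigma>"
    proof (cases "bad \<sigma> c")
      case True
      then have "(\<sigma> x, \<sigma> y) \<in> E i" by (simp add: bad_def cx)
      then have "(\<Sum>h\<in>UNIV. m (\<sigma> x, \<sigma> y) h * \<phi> (upd \<sigma> c h))
          = (\<Sum>h\<in>- E i. a i (\<sigma> x, \<sigma> y) h * \<phi> (upd \<sigma> c h))"
        by (intro sum.mono_neutral_cong_right) (auto simp: m_def)
      then show ?thesis using True by (simp add: step_def cx)
    next
      case False
      then have "(\<sigma> x, \<sigma> y) \<notin> E i" by (simp add: bad_def cx)
      then have "(\<Sum>h\<in>UNIV. m (\<sigma> x, \<sigma> y) h * \<phi> (upd \<sigma> c h))
          = (\<Sum>h\<in>UNIV. if h = (\<sigma> x, \<sigma> y) then \<phi> (upd \<sigma> c h) else 0)"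
        by (intro sum.cong) (auto simp: m_def)
      then show ?thesis using False by (simp add: step_def cx)
    qed
    finally show ?thesis by simp
  qed
  consider "x \<in> S" "y \<notin> S" | "y \<in> S" "x \<notin> S" using cr cx by auto
  then show ?thesis
  proof cases
    case 1
    then show ?thesis using separable_cross[OF sep 1, of _ "\<lambda>j j' k l. m (j, j') (k, l)"] st by blast
  next
    case 2
    \<comment> \<open>Here the second end of the bond lies in \<open>S\<close>, so the ends exchange
      their roles.\<close>
    have "step c \<phi> \<sigma> = (\<Sum>l\<in>UNIV. \<Sum>k\<in>UNIV. m (\<sigma> x, \<sigma> y) (k, l) * \<phi> (\<sigma>(y := l, x := k)))" for \<sigma>
      unfolding st by (subst sum.swap) (simp add: fun_upd_twist[OF neq])
    then show ?thesis using separable_cross[OF sep 2, of _ "\<lambda>j' j l k. m (j, j') (k, l)"] by blast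
  qed
qed

definition crossing :: "'s set \<Rightarrow> (bool \<times> 's \<times> 's) set" where
  "crossing S = {c \<in> B. \<not> sites c \<subseteq> S \<and> \<not> sites c \<subseteq> - S}"

text \<open>A sweep meets every bond exactly once, as \<open>bond_list\<close> is distinct, and only
  the bonds crossing the cut lengthen the lists.\<close>

lemma separable_approx: "separable S (T * card (crossing S)) (approx T)"
proof (induction T)
  case 0
  then show ?case by (simp add: approx_def separable_one)
next
  case (Suc T)
  have "separable S (n + length (filter (\<lambda>c. c \<in> crossing S) xs)) (foldr step xs \<phi>)"
    if "set xs \<subseteq> B" "separable S n \<phi>" for xs n \<phi>
    using that(1)
  proof (induction xs)
    case (Cons x xs)
    then show ?case using separable_step_cross[of S _ _ x] separable_step_same[of S _ _ x]
      by (auto simp: crossing_def)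
  qed (use that in simp)
  from this[OF _ Suc, of bond_list]
  have "separable S (T * card (crossing S) + length (filter (\<lambda>c. c \<in> crossing S) bond_list)) (approx (Suc T))"
    by (simp add: bond_list approx_Suc)
  moreover have "length (filter (\<lambda>c. c \<in> crossing S) bond_list) = card (crossing S)"
    using distinct_card[of "filter (\<lambda>c. c \<in> crossing S) bond_list"] bond_list
    by (simp add: distinct_filter) (auto simp: crossing_def intro: arg_cong[where f = card])
  ultimately show ?case by (simp add: add.commute)
qed

end


section \<open>Hermitian matrices\<close>

lemma finite_index_convergent_subseq:
  fixes X :: "nat \<Rightarrow> 'i \<Rightarrow> 'b::heine_borel"
  assumes "finite I" "\<And>i. i \<in> I \<Longrightarrow> bounded (range (\<lambda>n. X n i))"
  shows "\<exists>r l. strict_mono r \<and> (\<forall>i\<in>I. (\<lambda>n. X (r n) i) \<longlonglongrightarrow> l i)"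
  using assms
proof (induction I rule: finite_induct)
  case empty
  then show ?case by (intro exI[of _ id]) (auto simp: strict_mono_def)
next
  case (insert j I)
  then obtain r l where r: "strict_mono r" and l: "\<And>i. i \<in> I \<Longrightarrow> (\<lambda>n. X (r n) i) \<longlonglongrightarrow> l i" by auto
  have "bounded (range (\<lambda>n. X (r n) j))"
    by (rule bounded_subset[OF insert.prems[of j]]) auto
  then obtain l' r' where r': "strict_mono r'" and l': "((\<lambda>n. X (r n) j) \<circ> r') \<longlonglongrightarrow> l'"
    using bounded_imp_convergent_subsequence[of "\<lambda>n. X (r n) j"] by metis
  have "(\<lambda>n. X ((r \<circ> r') n) i) \<longlonglongrightarrow> (l(j := l')) i" if "i \<in> insert j I" for i
    using l' LIMSEQ_subseq_LIMSEQ[OF l r', of i] that insert.hyps by (auto simp: o_def)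
  then show ?case using strict_mono_o[OF r r'] by blast
qed

text \<open>Vectors are functions of which only the first \<open>n\<close> entries count. This
  avoids carrier conditions, and limits can be taken entry by entry.\<close>

definition cinner :: "nat \<Rightarrow> (nat \<Rightarrow> complex) \<Rightarrow> (nat \<Rightarrow> complex) \<Rightarrow> complex" where
  "cinner n x y = (\<Sum>i<n. cnj (x i) * y i)"

definition mult_on :: "nat \<Rightarrow> (nat \<Rightarrow> nat \<Rightarrow> complex) \<Rightarrow> (nat \<Rightarrow> complex) \<Rightarrow> nat \<Rightarrow> complex" where
  "mult_on n a v i = (\<Sum>j<n. a i j * v j)"

lemma cinner_commute: "cinner n y x = cnj (cinner n x y)"
  by (simp add: cinner_def mult.commute)

lemma cinner_add: "cinner n x (\<lambda>i. y i + z i) = cinner n x y + cinner n x z"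
  "cinner n (\<lambda>i. y i + z i) x = cinner n y x + cinner n z x"
  by (simp_all add: cinner_def algebra_simps sum.distrib)

lemma cinner_diff: "cinner n x (\<lambda>i. y i - z i) = cinner n x y - cinner n x z"
  "cinner n (\<lambda>i. y i - z i) x = cinner n y x - cinner n z x"
  by (simp_all add: cinner_def algebra_simps sum_subtractf)

lemma cinner_scale: "cinner n x (\<lambda>i. c * y i) = c * cinner n x y"
  "cinner n (\<lambda>i. c * y i) x = cnj c * cinner n y x"
  by (simp_all add: cinner_def sum_distrib_left mult_ac)

lemma cinner_sum: "cinner n x (\<lambda>i. \<Sum>j\<in>J. y j i) = (\<Sum>j\<in>J. cinner n x (y j))"
  unfolding cinner_def by (simp add: sum_distrib_left) (rule sum.swap)

lemma cinner_self: "cinner n x x = of_real (\<Sum>i<n. (cmod (x i))\<^sup>2)"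
  by (simp add: cinner_def mult.commute complex_norm_square[symmetric] of_real_power)

lemma cinner_self_eq_0: "cinner n x x = 0 \<longleftrightarrow> (\<forall>i<n. x i = 0)"
  unfolding cinner_self of_real_eq_0_iff by (subst sum_nonneg_eq_0_iff) auto

lemma unit_sum_sq: "cinner n x x = 1 \<Longrightarrow> (\<Sum>i<n. (cmod (x i))\<^sup>2) = 1"
  unfolding cinner_self using of_real_eq_1_iff by blast

lemma unit_entry_le:
  assumes "cinner n x x = 1" "i < n" shows "cmod (x i) \<le> 1"
proof -
  have "(cmod (x i))\<^sup>2 \<le> (\<Sum>i<n. (cmod (x i))\<^sup>2)" using assms(2) by (intro member_le_sum) auto
  then show ?thesis using unit_sum_sq[OF assms(1)] power2_le_imp_le[of "cmod (x i)" 1] by simp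
qed

lemma unit_quadratic_form_le:
  assumes "cinner n x x = 1"
  shows "cmod (cinner n x (mult_on n a x)) \<le> (\<Sum>i<n. \<Sum>j<n. cmod (a i j))"
proof -
  have "cmod (cinner n x (mult_on n a x)) = cmod (\<Sum>i<n. \<Sum>j<n. cnj (x i) * (a i j * x j))"
    unfolding cinner_def mult_on_def by (simp add: sum_distrib_left)
  also have "\<dots> \<le> (\<Sum>i<n. \<Sum>j<n. cmod (cnj (x i) * (a i j * x j)))"
    by (intro sum_norm_le order_refl)
  also have "\<dots> \<le> (\<Sum>i<n. \<Sum>j<n. cmod (a i j))"
  proof (intro sum_mono)
    fix i j assume "i \<in> {..<n}" "j \<in> {..<n}"
    then have "cmod (x i) * cmod (x j) \<le> 1" using unit_entry_le[OF assms] by (simp add: mult_le_one)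
    then have "cmod (a i j) * (cmod (x i) * cmod (x j)) \<le> cmod (a i j)"
      using mult_left_mono[of _ 1 "cmod (a i j)"] by simp
    then show "cmod (cnj (x i) * (a i j * x j)) \<le> cmod (a i j)" by (simp add: norm_mult mult_ac)
  qed
  finally show ?thesis .
qed

lemma mult_on_add: "mult_on n a (\<lambda>i. y i + z i) = (\<lambda>i. mult_on n a y i + mult_on n a z i)"
  by (simp add: mult_on_def fun_eq_iff algebra_simps sum.distrib)

lemma mult_on_scale: "mult_on n a (\<lambda>i. c * y i) = (\<lambda>i. c * mult_on n a y i)"
  by (simp add: mult_on_def fun_eq_iff sum_distrib_left mult_ac)

lemma cinner_mult_on:
  assumes "\<And>i j. i < n \<Longrightarrow> j < n \<Longrightarrow> a j i = cnj (a i j)"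
  shows "cinner n x (mult_on n a y) = cinner n (mult_on n a x) y"
proof -
  have c: "cnj (a j i) = a i j" if "i < n" "j < n" for i j
    using assms[OF that] by simp
  have "cinner n x (mult_on n a y) = (\<Sum>j<n. \<Sum>i<n. cnj (x i) * a i j * y j)"
    unfolding cinner_def mult_on_def by (simp add: sum_distrib_left mult.assoc) (rule sum.swap)
  also have "\<dots> = cinner n (mult_on n a x) y"
    unfolding cinner_def mult_on_def
    by (intro sum.cong refl) (auto simp: sum_distrib_left c mult_ac intro!: sum.cong)
  finally show ?thesis .
qed

text \<open>A maximiser of the Rayleigh quotient on the orthogonal complement of the eigenvectors found so far
  is an eigenvector.\<close>

lemma hermitian_next_eigenvector:
  assumes herm: "\<And>i j. i < n \<Longrightarrow> j < n \<Longrightarrow> a j i = cnj (a i j)"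
    and k: "k < n"
    and ort: "\<And>j l. j < k \<Longrightarrow> l < k \<Longrightarrow> cinner n (u j) (u l) = (if j = l then 1 else 0)"
    and eig: "\<And>j i. j < k \<Longrightarrow> i < n \<Longrightarrow> mult_on n a (u j) i = of_real (e j) * u j i"
  shows "\<exists>v (c::real). cinner n v v = 1 \<and> (\<forall>j<k. cinner n (u j) v = 0) \<and> (\<forall>i<n. mult_on n a v i = of_real c * v i)"
proof -
  define K where "K v \<longleftrightarrow> cinner n v v = 1 \<and> (\<forall>j<k. cinner n (u j) v = 0)" for v
  define f where "f v = Re (cinner n v (mult_on n a v))" for v
  have sh: "cinner n x (mult_on n a y) = cinner n (mult_on n a x) y" for x y
    by (rule cinner_mult_on) (rule herm)
  have scaleK: "\<exists>s>0. Re (cinner n w w) = s\<^sup>2 \<and> K (\<lambda>i. of_real (1 / s) * w i)"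
    if w: "\<forall>j<k. cinner n (u j) w = 0" "i < n" "w i \<noteq> 0" for w i
  proof -
    define S where "S = (\<Sum>i<n. (cmod (w i))\<^sup>2)"
    have "0 < S" unfolding S_def using w by (intro sum_pos2[of _ i]) auto
    moreover have "cinner n (\<lambda>i. of_real (1 / sqrt S) * w i) (\<lambda>i. of_real (1 / sqrt S) * w i) = 1"
      unfolding cinner_scale cinner_self S_def[symmetric] using \<open>0 < S\<close>
      by (simp flip: of_real_mult)
    ultimately show ?thesis
      using w unfolding K_def
      by (intro exI[of _ "sqrt S"]) (simp add: cinner_scale cinner_self S_def[symmetric] del: of_real_divide)
  qed
  have "\<exists>v. K v"
  proof -
    \<comment> \<open>A dimension count: the squared lengths of the projections of the
      \<open>n\<close> unit vectors onto the span of the \<open>u j\<close> add up to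
      \<open>k < n\<close>. A unit vector with projection shorter than 1 leaves a nonzero remainder
      orthogonal to all \<open>u j\<close>.\<close>
    have "\<exists>i<n. (\<Sum>j<k. (cmod (u j i))\<^sup>2) < 1"
    proof (rule ccontr)
      assume "\<not> ?thesis"
      then have "(\<Sum>i<n. 1) \<le> (\<Sum>i<n. \<Sum>j<k. (cmod (u j i))\<^sup>2)" by (intro sum_mono) force
      also have "\<dots> = (\<Sum>j<k. \<Sum>i<n. (cmod (u j i))\<^sup>2)" by (rule sum.swap)
      also have "\<dots> = (\<Sum>j<k. 1)"
        using ort by (intro sum.cong) (auto intro!: unit_sum_sq)
      finally show False using k by simp
    qed
    then obtain m where m: "m < n" "(\<Sum>j<k. (cmod (u j m))\<^sup>2) < 1" by blast
    define w where "w i = (if i = m then 1 else 0) - (\<Sum>j<k. cnj (u j m) * u j i)" for i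
    have "cinner n (u l) w = 0" if l: "l < k" for l
    proof -
      have "cinner n (u l) w = cnj (u l m) - (\<Sum>j<k. cnj (u j m) * cinner n (u l) (u j))"
        unfolding w_def cinner_diff cinner_sum cinner_scale
        using m by (simp add: cinner_def if_distrib sum.If_cases cong: if_cong)
      also have "(\<Sum>j<k. cnj (u j m) * cinner n (u l) (u j)) = (\<Sum>j<k. if j = l then cnj (u l m) else 0)"
        using ort l by (intro sum.cong) auto
      finally show ?thesis using l by simp
    qed
    moreover have "w m \<noteq> 0"
    proof -
      have "w m = of_real (1 - (\<Sum>j<k. (cmod (u j m))\<^sup>2))"
        unfolding w_def by (simp add: mult.commute complex_norm_square[symmetric] of_real_power)
      then show ?thesis using m by (simp del: of_real_diff of_real_sum)
    qed
    ultimately show ?thesis using scaleK[of w m] m by blast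
  qed
  have le1: "cmod (v i) \<le> 1" if "K v" "i < n" for v i
    by (rule unit_entry_le) (use that in \<open>simp_all add: K_def\<close>)
  have bdd: "f v \<le> (\<Sum>i<n. \<Sum>j<n. cmod (a i j))" if "K v" for v
    unfolding f_def using that by (intro order_trans[OF complex_Re_le_cmod unit_quadratic_form_le]) (simp add: K_def)
  define S where "S = Sup (f ` Collect K)"
  have bd: "bdd_above (f ` Collect K)" using bdd by (intro bdd_aboveI) auto
  have ne: "f ` Collect K \<noteq> {}" using \<open>\<exists>v. K v\<close> by blast
  have "\<exists>v. K v \<and> S - 1 / real (Suc m) < f v" for m
  proof -
    have "S - 1 / real (Suc m) < Sup (f ` Collect K)" unfolding S_def by simp
    then show ?thesis using less_cSup_iff[OF ne bd] by auto
  qed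
  then obtain X where X: "\<And>m. K (X m)" "\<And>m. S - 1 / real (Suc m) < f (X m)" by metis
  have "bounded (range (\<lambda>m. X m i))" if "i \<in> {..<n}" for i
    unfolding bounded_iff using le1[OF X(1)] that by (intro exI[of _ 1]) auto
  then obtain r v where r: "strict_mono r" and v: "\<And>i. i \<in> {..<n} \<Longrightarrow> (\<lambda>m. X (r m) i) \<longlonglongrightarrow> v i"
    using finite_index_convergent_subseq[of "{..<n}" X] by auto
  have limc: "(\<lambda>m. cinner n w (X (r m))) \<longlonglongrightarrow> cinner n w v" for w
    unfolding cinner_def by (intro tendsto_intros v)
  have limcc: "(\<lambda>m. cinner n (X (r m)) (X (r m))) \<longlonglongrightarrow> cinner n v v"
    unfolding cinner_def by (intro tendsto_intros v)
  have limf: "(\<lambda>m. f (X (r m))) \<longlonglongrightarrow> f v"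
    unfolding f_def cinner_def mult_on_def by (intro tendsto_intros v)
  have Kv: "K v"
    unfolding K_def
  proof (intro conjI allI impI)
    show "cinner n v v = 1" using limcc X(1) unfolding K_def by (simp add: LIMSEQ_const_iff)
    show "cinner n (u j) v = 0" if "j < k" for j
      using limc[of "u j"] X(1) that unfolding K_def by (simp add: LIMSEQ_const_iff)
  qed
  have leS: "f w \<le> S" if "K w" for w unfolding S_def using that bd by (intro cSup_upper) auto
  have fvS: "f v = S"
  proof (rule antisym[OF leS[OF Kv]])
    have "(\<lambda>m. S - 1 / real (Suc (r m))) \<longlonglongrightarrow> S - 0"
      using LIMSEQ_subseq_LIMSEQ[OF LIMSEQ_inverse_real_of_nat r]
      by (intro tendsto_diff tendsto_const) (simp add: o_def inverse_eq_divide)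
    then have "S - 0 \<le> f v"
      using X(2) by (intro LIMSEQ_le[OF _ limf]) (auto intro: less_imp_le)
    then show "S \<le> f v" by simp
  qed
  \<comment> \<open>The residual of the eigenvalue equation at the maximiser; the goal is that its
    squared norm \<open>s\<close> vanishes.\<close>
  define w where "w i = mult_on n a v i - of_real S * v i" for i
  have vv: "cinner n v v = 1" using Kv by (simp add: K_def)
  have vAv: "cinner n v (mult_on n a v) = of_real S"
  proof -
    have "cinner n v (mult_on n a v) = cnj (cinner n v (mult_on n a v))"
      using sh[of v v] cinner_commute by metis
    then have "Im (cinner n v (mult_on n a v)) = 0" by (simp add: complex_eq_iff)
    then show ?thesis using fvS by (simp add: f_def complex_eq_iff)
  qed
  have vw: "cinner n v w = 0" unfolding w_def cinner_diff cinner_scale by (simp add: vAv vv)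
  have uw: "cinner n (u j) w = 0" if "j < k" for j
  proof -
    have "cinner n (u j) (mult_on n a v) = cinner n (\<lambda>i. of_real (e j) * u j i) v"
      by (subst sh) (use eig[OF that] in \<open>simp_all add: cinner_def\<close>)
    also have "\<dots> = 0" using Kv that by (simp add: cinner_scale K_def)
    finally show ?thesis unfolding w_def cinner_diff cinner_scale using Kv that by (simp add: K_def)
  qed
  define s where "s = Re (cinner n w w)"
  have ww: "cinner n w w = of_real s" unfolding s_def cinner_self by simp
  have s0: "0 \<le> s" unfolding s_def cinner_self by (simp add: sum_nonneg)
  have wv: "cinner n w v = 0" using vw cinner_commute[of n w v] by simp
  have wAv: "cinner n w (mult_on n a v) = of_real s"
  proof -
    have "mult_on n a v = (\<lambda>i. w i + of_real S * v i)" by (simp add: w_def fun_eq_iff)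
    then show ?thesis by (simp add: cinner_add cinner_scale wv ww)
  qed
  have vAw: "cinner n v (mult_on n a w) = of_real s"
    unfolding sh using cinner_commute[of n "mult_on n a v" w] wAv by simp
  \<comment> \<open>Perturb the maximiser to \<open>v + t w\<close>, which is again orthogonal to
    the \<open>u j\<close>. The Rayleigh quotient gains \<open>2 t s\<close> at first order in
    \<open>t\<close>, so maximality bounds \<open>s\<close> by a multiple of
    \<open>t\<close>.\<close>
  have key: "2 * s \<le> t * (S * s - f w)" if t: "0 < t" for t :: real
  proof -
    define z where "z i = v i + of_real t * w i" for i
    have zz: "cinner n z z = of_real (1 + t\<^sup>2 * s)"
      unfolding z_def cinner_add cinner_scale by (simp add: vv vw wv ww power2_eq_square algebra_simps)
    have fz: "f z = S + 2 * t * s + t\<^sup>2 * f w"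
      unfolding f_def z_def mult_on_add mult_on_scale cinner_add cinner_scale
      by (simp add: vAv vAw wAv power2_eq_square algebra_simps)
    have "\<exists>i<n. z i \<noteq> 0"
    proof (rule ccontr)
      assume "\<not> ?thesis"
      then have "cinner n z z = 0" by (simp add: cinner_self_eq_0)
      then have "1 + t\<^sup>2 * s = 0" unfolding zz using of_real_eq_0_iff by blast
      moreover have "0 \<le> t\<^sup>2 * s" using s0 by simp
      ultimately show False by linarith
    qed
    moreover have "\<forall>j<k. cinner n (u j) z = 0"
      unfolding z_def cinner_add cinner_scale using Kv uw by (simp add: K_def)
    ultimately obtain p where p: "0 < p" "Re (cinner n z z) = p\<^sup>2" "K (\<lambda>i. of_real (1 / p) * z i)"
      using scaleK[of z] by blast
    have "f (\<lambda>i. of_real (1 / p) * z i) = f z / p\<^sup>2"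
      unfolding f_def mult_on_scale cinner_scale by (simp add: power2_eq_square)
    then have "f z / p\<^sup>2 \<le> S" using leS[OF p(3)] by simp
    then have "f z \<le> S * p\<^sup>2" using p(1) by (simp add: field_simps)
    also have "p\<^sup>2 = 1 + t\<^sup>2 * s" using p(2) zz by simp
    finally have "t * (2 * s) \<le> t * (t * (S * s - f w))" unfolding fz by (simp add: power2_eq_square algebra_simps)
    then show ?thesis using t by simp
  qed
  have "s \<le> 0"
  proof (rule ccontr)
    assume "\<not> s \<le> 0"
    define C where "C = \<bar>S * s - f w\<bar> + 1"
    have C: "0 < C" "S * s - f w \<le> C" unfolding C_def by auto
    have "2 * s \<le> s / C * (S * s - f w)" using \<open>\<not> s \<le> 0\<close> C by (intro key) auto
    also have "\<dots> \<le> s / C * C" using \<open>\<not> s \<le> 0\<close> C by (intro mult_left_mono) auto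
    also have "\<dots> = s" using C by simp
    finally show False using \<open>\<not> s \<le> 0\<close> by simp
  qed
  then have "cinner n w w = 0" using s0 ww by simp
  then have "\<forall>i<n. mult_on n a v i = of_real S * v i"
    unfolding cinner_self_eq_0 w_def by simp
  then show ?thesis using Kv unfolding K_def by blast
qed

lemma hermitian_eigenbasis:
  assumes herm: "\<And>i j. i < n \<Longrightarrow> j < n \<Longrightarrow> a j i = cnj (a i j)"
  shows "\<exists>u (e :: nat \<Rightarrow> real). (\<forall>j<n. \<forall>l<n. cinner n (u j) (u l) = (if j = l then 1 else 0)) \<and>
    (\<forall>j<n. \<forall>i<n. mult_on n a (u j) i = of_real (e j) * u j i)"
proof -
  have "\<exists>u (e :: nat \<Rightarrow> real). (\<forall>j<k. \<forall>l<k. cinner n (u j) (u l) = (if j = l then 1 else 0)) \<and>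
    (\<forall>j<k. \<forall>i<n. mult_on n a (u j) i = of_real (e j) * u j i)" if "k \<le> n" for k
    using that
  proof (induction k)
    case (Suc k)
    then obtain u and e :: "nat \<Rightarrow> real"
      where u: "\<forall>j<k. \<forall>l<k. cinner n (u j) (u l) = (if j = l then 1 else 0)"
        and e: "\<forall>j<k. \<forall>i<n. mult_on n a (u j) i = of_real (e j) * u j i" by auto
    obtain v and c :: real where v: "cinner n v v = 1" "\<forall>j<k. cinner n (u j) v = 0"
      "\<forall>i<n. mult_on n a v i = of_real c * v i"
      using hermitian_next_eigenvector[of n a k u e, OF herm] Suc.prems u e by auto
    have v': "\<forall>j<k. cinner n v (u j) = 0" using v(2) cinner_commute[of n v] by simp
    show ?case
      by (intro exI[of _ "u(k := v)"] exI[of _ "e(k := c)"])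
         (use u e v v' in \<open>auto simp: less_Suc_eq\<close>)
  qed simp
  from this[of n] show ?thesis by simp
qed

text \<open>Entrywise form of a unitary diagonalization, where \<open>u k\<close> is the eigenvector
  for \<open>e k\<close>: orthonormality, completeness and the spectral decomposition are finite
  sums, hence preserved by entrywise limits.\<close>

definition diag_on :: "nat \<Rightarrow> (nat \<Rightarrow> nat \<Rightarrow> complex) \<Rightarrow> (nat \<Rightarrow> nat \<Rightarrow> complex) \<Rightarrow> (nat \<Rightarrow> real) \<Rightarrow> bool" where
  "diag_on n a u e \<longleftrightarrow>
     (\<forall>j<n. \<forall>l<n. cinner n (u j) (u l) = (if j = l then 1 else 0)) \<and>
     (\<forall>i<n. \<forall>j<n. (\<Sum>k<n. u k i * cnj (u k j)) = (if i = j then 1 else 0)) \<and>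
     (\<forall>i<n. \<forall>j<n. a i j = (\<Sum>k<n. u k i * of_real (e k) * cnj (u k j)))"

lemma mat_adjoint_mat:
  "mat_adjoint (Matrix.mat n m (\<lambda>(i, k). u k i)) = Matrix.mat m n (\<lambda>(k, i). cnj (u k i :: complex))"
  unfolding mat_adjoint_def
  by (rule eq_matI) (auto simp: mat_of_rows_def)

lemma mat_mult_mat:
  "Matrix.mat n m f * Matrix.mat m p g = Matrix.mat n p (\<lambda>(i, j). \<Sum>k<m. f (i, k) * g (k, j) :: complex)"
  by (rule eq_matI) (auto simp: scalar_prod_def atLeast0LessThan)

lemma mat_diag_mat: "mat_diag n d = Matrix.mat n n (\<lambda>(i, j). if i = j then d j else 0 :: complex)"
  by (rule eq_matI) (auto simp: mat_diag_def)

lemma one_mat: "1\<^sub>m n = Matrix.mat n n (\<lambda>(i, j). if i = j then 1 else 0 :: complex)"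
  by (rule eq_matI) auto

lemma conj_diag_mat:
  "Matrix.mat n n (\<lambda>(i, k). u k i) * mat_diag n d * Matrix.mat n n (\<lambda>(k, i). cnj (u k i)) =
   Matrix.mat n n (\<lambda>(i, j). \<Sum>k<n. u k i * d k * cnj (u k j) :: complex)"
  unfolding mat_diag_mat mat_mult_mat
  by (rule eq_matI) (auto simp: if_distrib cong: if_cong)

lemma diag_on_unitary:
  assumes "diag_on n a u e"
  shows "unitary_diagonalization (Matrix.mat n n (\<lambda>(i, j). a i j)) (Matrix.mat n n (\<lambda>(i, k). u k i)) e"
  unfolding unitary_diagonalization_def dim_row_mat mat_adjoint_mat conj_diag_mat unfolding mat_mult_mat one_mat
  using assms unfolding diag_on_def cinner_def
  by (auto intro!: eq_matI)

lemma ex_diag_on: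
  assumes herm: "\<And>i j. i < n \<Longrightarrow> j < n \<Longrightarrow> a j i = cnj (a i j)"
  shows "\<exists>u e. diag_on n a u e"
proof -
  have "\<exists>u (e :: nat \<Rightarrow> real). (\<forall>j<n. \<forall>l<n. cinner n (u j) (u l) = (if j = l then 1 else 0)) \<and>
    (\<forall>j<n. \<forall>i<n. mult_on n a (u j) i = of_real (e j) * u j i)"
    by (rule hermitian_eigenbasis) (rule herm)
  then obtain u and e :: "nat \<Rightarrow> real"
    where ue: "(\<forall>j<n. \<forall>l<n. cinner n (u j) (u l) = (if j = l then 1 else 0)) \<and>
    (\<forall>j<n. \<forall>i<n. mult_on n a (u j) i = of_real (e j) * u j i)" by blast
  then have ort: "\<And>j l. j < n \<Longrightarrow> l < n \<Longrightarrow> cinner n (u j) (u l) = (if j = l then 1 else 0)"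
      and eig: "\<And>j i. j < n \<Longrightarrow> i < n \<Longrightarrow> mult_on n a (u j) i = of_real (e j) * u j i"
    by blast+
  let ?U = "Matrix.mat n n (\<lambda>(i, k). u k i)" and ?V = "Matrix.mat n n (\<lambda>(k, i). cnj (u k i))"
  have "?V * ?U = 1\<^sub>m n"
    unfolding mat_mult_mat one_mat using ort by (intro eq_matI) (auto simp: cinner_def)
  \<comment> \<open>A left inverse of a square matrix is a right inverse, which turns orthonormality
    of the eigenvectors into completeness.\<close>
  then have UV: "?U * ?V = 1\<^sub>m n" by (intro mat_mult_left_right_inverse[of ?V n]) auto
  have comp: "(\<Sum>k<n. u k i * cnj (u k j)) = (if i = j then 1 else 0)" if "i < n" "j < n" for i j
  proof -
    have "(?U * ?V) $$ (i, j) = (if i = j then 1 else 0)" using that by (simp add: UV)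
    then show ?thesis using that by (simp add: mat_mult_mat)
  qed
  have "a i j = (\<Sum>k<n. u k i * of_real (e k) * cnj (u k j))" if ij: "i < n" "j < n" for i j
  proof -
    have "(\<Sum>k<n. u k i * of_real (e k) * cnj (u k j)) = (\<Sum>k<n. mult_on n a (u k) i * cnj (u k j))"
      using eig ij by (intro sum.cong) auto
    also have "\<dots> = (\<Sum>l<n. a i l * (\<Sum>k<n. u k l * cnj (u k j)))"
      unfolding mult_on_def by (simp add: sum_distrib_left sum_distrib_right mult.assoc) (rule sum.swap)
    also have "\<dots> = (\<Sum>l<n. if l = j then a i j else 0)"
      using comp ij by (intro sum.cong) auto
    also have "\<dots> = a i j" using ij by simp
    finally show ?thesis by simp
  qed
  then show ?thesis unfolding diag_on_def using ort comp by blast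
qed

lemma von_neumann_entropy_diag:
  assumes d: "diag_on n a u e"
  shows "von_neumann_entropy (Matrix.mat n n (\<lambda>(i, j). a i j)) = - (\<Sum>k<n. e k * ln (e k))"
proof -
  let ?A = "Matrix.mat n n (\<lambda>(i, j). a i j)"
  have A: "?A = Matrix.mat n n (\<lambda>(i, j). \<Sum>k<n. u k i * of_real (e k) * cnj (u k j))"
    using d by (intro eq_matI) (auto simp: diag_on_def)
  have H: "hermitian_fun ln ?A = Matrix.mat n n (\<lambda>(i, j). \<Sum>k<n. u k i * of_real (ln (e k)) * cnj (u k j))"
    unfolding hermitian_fun_eq[OF diag_on_unitary[OF d]] dim_row_mat mat_adjoint_mat conj_diag_mat ..
  have ort: "(\<Sum>i<n. cnj (u j i) * u l i) = (if j = l then 1 else 0)" if "j < n" "l < n" for j l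
    using d that by (simp add: diag_on_def cinner_def)
  let ?w = "\<lambda>i k l. u k i * cnj (u l i) * of_real (e k * ln (e l))"
  have "mat_trace (?A * hermitian_fun ln ?A) =
      (\<Sum>i<n. \<Sum>j<n. (\<Sum>k<n. u k i * of_real (e k) * cnj (u k j)) * (\<Sum>l<n. u l j * of_real (ln (e l)) * cnj (u l i)))"
    unfolding H unfolding A unfolding mat_mult_mat mat_trace_def diag_mat_def
    by (simp add: sum_list_sum_nth atLeast0LessThan)
  also have "\<dots> = (\<Sum>i<n. \<Sum>j<n. \<Sum>k<n. \<Sum>l<n. ?w i k l * (cnj (u k j) * u l j))"
    by (simp add: sum_product mult_ac)
  also have "\<dots> = (\<Sum>i<n. \<Sum>k<n. \<Sum>l<n. ?w i k l * (\<Sum>j<n. cnj (u k j) * u l j))"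
    unfolding sum_distrib_left
    by (rule sum.cong[OF refl], subst sum.swap, rule sum.cong[OF refl], rule sum.swap)
  also have "\<dots> = (\<Sum>i<n. \<Sum>k<n. ?w i k k)"
  proof (intro sum.cong refl)
    fix i k assume k: "k \<in> {..<n}"
    then have "(\<Sum>l<n. ?w i k l * (\<Sum>j<n. cnj (u k j) * u l j)) = (\<Sum>l<n. if l = k then ?w i k k else 0)"
      using ort by (intro sum.cong) auto
    then show "(\<Sum>l<n. ?w i k l * (\<Sum>j<n. cnj (u k j) * u l j)) = ?w i k k" using k by simp
  qed
  also have "\<dots> = (\<Sum>k<n. of_real (e k * ln (e k)) * (\<Sum>i<n. cnj (u k i) * u k i))"
    by (subst sum.swap) (simp add: sum_distrib_left mult_ac)
  also have "\<dots> = of_real (\<Sum>k<n. e k * ln (e k))"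
    using ort by simp
  finally show ?thesis unfolding von_neumann_entropy_def by simp
qed

lemma diag_on_eigenvalue:
  assumes d: "diag_on n a u e"
  shows "eigenvalue (Matrix.mat n n (\<lambda>(i, j). a i j)) c \<longleftrightarrow> (\<exists>k<n. c = of_real (e k))"
proof
  let ?A = "Matrix.mat n n (\<lambda>(i, j). a i j)"
  have ort: "cinner n (u j) (u l) = (if j = l then 1 else 0)" if "j < n" "l < n" for j l
    using d that by (simp add: diag_on_def)
  have comp: "(\<Sum>k<n. u k i * cnj (u k j)) = (if i = j then 1 else 0)" if "i < n" "j < n" for i j
    using d that by (simp add: diag_on_def)
  have Av: "vec_index (?A *\<^sub>v v) i = (\<Sum>k<n. u k i * of_real (e k) * cinner n (u k) (\<lambda>j. vec_index v j))"
    if "i < n" "v \<in> carrier_vec n" for i v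
  proof -
    have "vec_index (?A *\<^sub>v v) i = (\<Sum>j<n. a i j * vec_index v j)"
      using that by (auto simp: scalar_prod_def atLeast0LessThan)
    also have "\<dots> = (\<Sum>j<n. (\<Sum>k<n. u k i * of_real (e k) * cnj (u k j)) * vec_index v j)"
      using d that by (simp add: diag_on_def)
    also have "\<dots> = (\<Sum>k<n. u k i * of_real (e k) * cinner n (u k) (\<lambda>j. vec_index v j))"
      unfolding cinner_def by (simp add: sum_distrib_left sum_distrib_right mult.assoc) (rule sum.swap)
    finally show ?thesis .
  qed
  { assume "eigenvalue ?A c"
    then obtain v where v: "v \<in> carrier_vec n" "v \<noteq> 0\<^sub>v n" "?A *\<^sub>v v = c \<cdot>\<^sub>v v"
      unfolding eigenvalue_def eigenvector_def by auto
    have *: "of_real (e l) * cinner n (u l) (\<lambda>j. vec_index v j) = c * cinner n (u l) (\<lambda>j. vec_index v j)" if l: "l < n" for l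
    proof -
      have "c * cinner n (u l) (\<lambda>j. vec_index v j) = cinner n (u l) (\<lambda>i. vec_index (?A *\<^sub>v v) i)"
        unfolding v(3) cinner_def using v(1) by (auto simp: sum_distrib_left mult_ac intro!: sum.cong)
      also have "\<dots> = cinner n (u l) (\<lambda>i. \<Sum>k<n. of_real (e k) * cinner n (u k) (\<lambda>j. vec_index v j) * u k i)"
        unfolding cinner_def[of n "u l"] using Av v(1) by (intro sum.cong) (auto simp: mult_ac)
      also have "\<dots> = (\<Sum>k<n. of_real (e k) * cinner n (u k) (\<lambda>j. vec_index v j) * cinner n (u l) (u k))"
        unfolding cinner_sum cinner_scale ..
      also have "\<dots> = (\<Sum>k<n. if k = l then of_real (e l) * cinner n (u l) (\<lambda>j. vec_index v j) else 0)"
        using ort l by (intro sum.cong) auto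
      finally show ?thesis using l by auto
    qed
    have "\<exists>l<n. cinner n (u l) (\<lambda>j. vec_index v j) \<noteq> 0"
    proof (rule ccontr)
      assume z: "\<not> ?thesis"
      have "vec_index v i = 0" if i: "i < n" for i
      proof -
        have "(\<Sum>k<n. u k i * cinner n (u k) (\<lambda>j. vec_index v j)) = (\<Sum>j<n. (\<Sum>k<n. u k i * cnj (u k j)) * vec_index v j)"
          unfolding cinner_def by (simp add: sum_distrib_left sum_distrib_right mult.assoc) (rule sum.swap)
        also have "\<dots> = (\<Sum>j<n. if j = i then vec_index v i else 0)"
          using comp i by (intro sum.cong) auto
        also have "\<dots> = vec_index v i" using i by simp
        finally show ?thesis using z by simp
      qed
      then have "v = 0\<^sub>v n" using v(1) by (intro eq_vecI) auto
      then show False using v(2) by simp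
    qed
    then show "\<exists>k<n. c = of_real (e k)" using * by force }
  { assume "\<exists>k<n. c = of_real (e k)"
    then obtain k where k: "k < n" "c = of_real (e k)" by blast
    let ?v = "Matrix.vec n (u k)"
    have vin: "?v \<in> carrier_vec n" by simp
    have c': "cinner n x (\<lambda>j. vec_index ?v j) = cinner n x (u k)" for x unfolding cinner_def by simp
    have "?v \<noteq> 0\<^sub>v n"
    proof
      assume z: "?v = 0\<^sub>v n"
      have "u k i = 0" if "i < n" for i using arg_cong[OF z, of "\<lambda>v. vec_index v i"] that by simp
      then have "cinner n (u k) (u k) = 0" by (simp add: cinner_def)
      then show False using ort k by simp
    qed
    moreover have "?A *\<^sub>v ?v = c \<cdot>\<^sub>v ?v"
    proof (rule eq_vecI)
      fix i assume "i < dim_vec (c \<cdot>\<^sub>v ?v)"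
      then have i: "i < n" by simp
      have "vec_index (?A *\<^sub>v ?v) i = (\<Sum>l<n. u l i * of_real (e l) * cinner n (u l) (u k))"
        unfolding Av[OF i vin] c' ..
      also have "\<dots> = (\<Sum>l<n. if l = k then u k i * of_real (e k) else 0)"
        using ort k by (intro sum.cong) auto
      also have "\<dots> = vec_index (c \<cdot>\<^sub>v ?v) i" using k i by simp
      finally show "vec_index (?A *\<^sub>v ?v) i = vec_index (c \<cdot>\<^sub>v ?v) i" .
    qed simp
    ultimately show "eigenvalue ?A c" unfolding eigenvalue_def eigenvector_def by (intro exI[of _ ?v]) simp }
qed

lemma diag_on_quadratic:
  assumes d: "diag_on n a u e" and k: "k < n"
  shows "cinner n (u k) (mult_on n a (u k)) = of_real (e k)"
proof -
  have ort: "cinner n (u j) (u l) = (if j = l then 1 else 0)" if "j < n" "l < n" for j l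
    using d that by (simp add: diag_on_def)
  have "mult_on n a (u k) i = of_real (e k) * u k i" if i: "i < n" for i
  proof -
    have "mult_on n a (u k) i = (\<Sum>j<n. (\<Sum>l<n. u l i * of_real (e l) * cnj (u l j)) * u k j)"
      using d i by (simp add: mult_on_def diag_on_def)
    also have "\<dots> = (\<Sum>l<n. u l i * of_real (e l) * cinner n (u l) (u k))"
      unfolding cinner_def by (simp add: sum_distrib_left sum_distrib_right mult.assoc) (rule sum.swap)
    also have "\<dots> = (\<Sum>l<n. if l = k then u k i * of_real (e k) else 0)"
      using ort k by (intro sum.cong) auto
    finally show ?thesis using k by simp
  qed
  then have "cinner n (u k) (mult_on n a (u k)) = cinner n (u k) (\<lambda>i. of_real (e k) * u k i)"
    unfolding cinner_def by simp
  then show ?thesis using ort k by (simp add: cinner_scale)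
qed

lemma diag_on_entry_le: "diag_on n a u e \<Longrightarrow> k < n \<Longrightarrow> i < n \<Longrightarrow> cmod (u k i) \<le> 1"
  by (rule unit_entry_le) (simp_all add: diag_on_def)

lemma diag_on_eigenvalue_le:
  assumes "diag_on n a u e" "k < n" shows "\<bar>e k\<bar> \<le> (\<Sum>i<n. \<Sum>j<n. cmod (a i j))"
  using unit_quadratic_form_le[of n "u k" a] diag_on_quadratic[OF assms] assms by (simp add: diag_on_def)

text \<open>Entries of unit eigenvectors are bounded by 1 and eigenvalues by the sum of the absolute
  matrix entries, so a whole diagonalization converges along a subsequence. No ordering of the
  eigenvalues has to be chosen.\<close>

lemma diag_on_subseq_limit:
  assumes d: "\<And>m. diag_on n (a m) (u m) (e m)"
    and a: "\<And>i j. i < n \<Longrightarrow> j < n \<Longrightarrow> (\<lambda>m. a m i j) \<longlonglongrightarrow> a' i j"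
  shows "\<exists>r u' e'. strict_mono r \<and> diag_on n a' u' e' \<and> (\<forall>k<n. (\<lambda>m. e (r m) k) \<longlonglongrightarrow> e' k)"
proof -
  have "bounded (range (\<lambda>m. u m (fst p) (snd p)))" if "p \<in> {..<n} \<times> {..<n}" for p
    unfolding bounded_iff using diag_on_entry_le[OF d] that by (intro exI[of _ 1]) auto
  then have "\<exists>r l. strict_mono r \<and> (\<forall>p\<in>{..<n} \<times> {..<n}. (\<lambda>m. u (r m) (fst p) (snd p)) \<longlonglongrightarrow> l p)"
    by (intro finite_index_convergent_subseq) simp_all
  then obtain r1 l1 where r1: "strict_mono r1"
    and l1: "\<And>p. p \<in> {..<n} \<times> {..<n} \<Longrightarrow> (\<lambda>m. u (r1 m) (fst p) (snd p)) \<longlonglongrightarrow> l1 p"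
    by blast
  have "(\<lambda>m. \<Sum>i<n. \<Sum>j<n. cmod (a m i j)) \<longlonglongrightarrow> (\<Sum>i<n. \<Sum>j<n. cmod (a' i j))"
    by (intro tendsto_intros a) auto
  then have "Bseq (\<lambda>m. \<Sum>i<n. \<Sum>j<n. cmod (a m i j))" by (intro convergent_imp_Bseq convergentI)
  then obtain M where M: "\<And>m. norm (\<Sum>i<n. \<Sum>j<n. cmod (a m i j)) \<le> M" unfolding Bseq_def by blast
  have "norm (e (r1 m) k) \<le> M" if "k < n" for m k
    using diag_on_eigenvalue_le[OF d that, of "r1 m"] M[of "r1 m"] by simp
  then have "bounded (range (\<lambda>m. e (r1 m) k))" if "k \<in> {..<n}" for k
    unfolding bounded_iff using that by (intro exI[of _ M]) auto
  then have "\<exists>r l. strict_mono r \<and> (\<forall>k\<in>{..<n}. (\<lambda>m. e (r1 (r m)) k) \<longlonglongrightarrow> l k)"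
    by (intro finite_index_convergent_subseq) simp_all
  then obtain r2 e' where r2: "strict_mono r2" and e': "\<And>k. k \<in> {..<n} \<Longrightarrow> (\<lambda>m. e (r1 (r2 m)) k) \<longlonglongrightarrow> e' k"
    by blast
  let ?r = "r1 \<circ> r2"
  have r: "strict_mono ?r" by (rule strict_mono_o[OF r1 r2])
  define u' where "u' k i = l1 (k, i)" for k i
  have u': "(\<lambda>m. u (?r m) k i) \<longlonglongrightarrow> u' k i" if "k < n" "i < n" for k i
    using LIMSEQ_subseq_LIMSEQ[OF l1[of "(k, i)"] r2] that by (simp add: u'_def o_def)
  have ar: "(\<lambda>m. a (?r m) i j) \<longlonglongrightarrow> a' i j" if "i < n" "j < n" for i j
    using LIMSEQ_subseq_LIMSEQ[OF a[OF that] r] by (simp add: o_def)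
  have "diag_on n a' u' e'"
    unfolding diag_on_def
  proof (intro conjI allI impI)
    fix j l assume jl: "j < n" "l < n"
    have "(\<lambda>m. cinner n (u (?r m) j) (u (?r m) l)) \<longlonglongrightarrow> cinner n (u' j) (u' l)"
      unfolding cinner_def by (intro tendsto_intros u' jl) auto
    moreover have "(\<lambda>m. cinner n (u (?r m) j) (u (?r m) l)) = (\<lambda>m. if j = l then 1 else 0)"
      using d jl by (simp add: diag_on_def)
    ultimately show "cinner n (u' j) (u' l) = (if j = l then 1 else 0)"
      by (simp add: LIMSEQ_const_iff split: if_splits)
    have "(\<lambda>m. \<Sum>k<n. u (?r m) k j * cnj (u (?r m) k l)) \<longlonglongrightarrow> (\<Sum>k<n. u' k j * cnj (u' k l))"
      by (intro tendsto_intros u' jl) auto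
    moreover have "(\<lambda>m. \<Sum>k<n. u (?r m) k j * cnj (u (?r m) k l)) = (\<lambda>m. if j = l then 1 else 0)"
      using d jl by (simp add: diag_on_def)
    ultimately show "(\<Sum>k<n. u' k j * cnj (u' k l)) = (if j = l then 1 else 0)"
      by (simp add: LIMSEQ_const_iff split: if_splits)
    have "(\<lambda>m. \<Sum>k<n. u (?r m) k j * of_real (e (?r m) k) * cnj (u (?r m) k l)) \<longlonglongrightarrow> (\<Sum>k<n. u' k j * of_real (e' k) * cnj (u' k l))"
      using e' by (intro tendsto_intros u' jl) auto
    moreover have "(\<lambda>m. \<Sum>k<n. u (?r m) k j * of_real (e (?r m) k) * cnj (u (?r m) k l)) = (\<lambda>m. a (?r m) j l)"
      using d jl by (simp add: diag_on_def)
    ultimately show "a' j l = (\<Sum>k<n. u' k j * of_real (e' k) * cnj (u' k l))"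
      by (intro LIMSEQ_unique[OF ar[OF jl]]) simp
  qed
  moreover have "\<forall>k<n. (\<lambda>m. e (?r m) k) \<longlonglongrightarrow> e' k" using e' by (simp add: o_def)
  ultimately show ?thesis using r by blast
qed


section \<open>An entropy bound\<close>

definition rinner :: "nat \<Rightarrow> (nat \<Rightarrow> real) \<Rightarrow> (nat \<Rightarrow> real) \<Rightarrow> real" where
  "rinner n x y = (\<Sum>i<n. x i * y i)"

lemma rinner_commute: "rinner n x y = rinner n y x"
  by (simp add: rinner_def mult.commute)

lemma rinner_diff: "rinner n x (\<lambda>i. y i - z i) = rinner n x y - rinner n x z"
  "rinner n (\<lambda>i. y i - z i) x = rinner n y x - rinner n z x"
  by (simp_all add: rinner_def algebra_simps sum_subtractf)

lemma rinner_scale: "rinner n x (\<lambda>i. c * y i) = c * rinner n x y"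
  "rinner n (\<lambda>i. c * y i) x = c * rinner n y x"
  by (simp_all add: rinner_def sum_distrib_left mult_ac)

lemma rinner_sum: "rinner n x (\<lambda>i. \<Sum>j\<in>J. y j i) = (\<Sum>j\<in>J. rinner n x (y j))"
  "rinner n (\<lambda>i. \<Sum>j\<in>J. y j i) x = (\<Sum>j\<in>J. rinner n (y j) x)"
  unfolding rinner_def by (simp_all add: sum_distrib_left sum_distrib_right) (rule sum.swap)+

lemma rinner_self_nonneg: "0 \<le> rinner n x x"
  by (simp add: rinner_def sum_nonneg)

lemma rinner_self_eq_0: "rinner n x x = 0 \<Longrightarrow> i < n \<Longrightarrow> x i = 0"
  by (simp add: rinner_def sum_nonneg_eq_0_iff)

lemma rinner_eq_0: "rinner n x x = 0 \<Longrightarrow> rinner n x y = 0"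
  unfolding rinner_def[of n x y] using rinner_self_eq_0[of n x] by (intro sum.neutral) auto

text \<open>Zero vectors are admitted, so that a basis can be indexed by the same set as a spanning family.\<close>

definition near_orthonormal :: "nat \<Rightarrow> 'r set \<Rightarrow> ('r \<Rightarrow> nat \<Rightarrow> real) \<Rightarrow> bool" where
  "near_orthonormal n R b \<longleftrightarrow> (\<forall>s\<in>R. \<forall>t\<in>R. s \<noteq> t \<longrightarrow> rinner n (b s) (b t) = 0) \<and>
     (\<forall>s\<in>R. rinner n (b s) (b s) \<in> {0, 1})"

lemma near_orthonormal_basis:
  assumes "finite R"
  shows "\<exists>b c. near_orthonormal n R b \<and> (\<forall>s\<in>R. \<forall>i<n. f s i = (\<Sum>t\<in>R. c s t * b t i))"
  using assms
proof (induction R rule: finite_induct)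
  case empty
  then show ?case by (simp add: near_orthonormal_def)
next
  case (insert r R)
  then obtain b c where b: "near_orthonormal n R b"
    and c: "\<And>s i. s \<in> R \<Longrightarrow> i < n \<Longrightarrow> f s i = (\<Sum>t\<in>R. c s t * b t i)" by blast
  define h where "h i = f r i - (\<Sum>t\<in>R. rinner n (b t) (f r) * b t i)" for i
  have bh: "rinner n (b s) h = 0" if s: "s \<in> R" for s
  proof -
    have "rinner n (b s) h = rinner n (b s) (f r) - (\<Sum>t\<in>R. rinner n (b t) (f r) * rinner n (b s) (b t))"
      unfolding h_def rinner_diff rinner_sum rinner_scale ..
    also have "(\<Sum>t\<in>R. rinner n (b t) (f r) * rinner n (b s) (b t)) =
        (\<Sum>t\<in>R. if t = s then rinner n (b s) (f r) * rinner n (b s) (b s) else 0)"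
      using b s by (intro sum.cong) (auto simp: near_orthonormal_def)
    also have "\<dots> = rinner n (b s) (f r) * rinner n (b s) (b s)" using s insert.hyps by simp
    also have "\<dots> = rinner n (b s) (f r)"
    proof (cases "rinner n (b s) (b s) = 0")
      case True
      then have "rinner n (b s) (f r) = 0" by (rule rinner_eq_0)
      then show ?thesis by simp
    next
      case False
      then show ?thesis using b s by (auto simp: near_orthonormal_def)
    qed
    finally show ?thesis by simp
  qed
  define m where "m = sqrt (rinner n h h)"
  \<comment> \<open>If the remainder \<open>h\<close> vanishes, then \<open>m = 0\<close> and
    division by zero yields the zero vector, which a near orthonormal family may contain.\<close>
  define b' where "b' = b(r := (\<lambda>i. (1 / m) * h i))"
  define c' where "c' = (\<lambda>s t. if s = r then (if t = r then m else rinner n (b t) (f r)) else if t = r then 0 else c s t)"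
  have bb: "b' t = b t" if "t \<in> R" for t using that insert.hyps by (auto simp: b'_def)
  have z: "rinner n (b t) (\<lambda>i. h i / m) = 0" "rinner n (\<lambda>i. h i / m) (b t) = 0" if "t \<in> R" for t
    using rinner_scale(1)[of n "b t" "1 / m" h] rinner_scale(2)[of n "1 / m" h "b t"] bh[OF that] rinner_commute[of n h "b t"] by simp_all
  have "near_orthonormal n (insert r R) b'"
    unfolding near_orthonormal_def
  proof (intro conjI ballI impI)
    fix s t assume "s \<in> insert r R" "t \<in> insert r R" "s \<noteq> t"
    then show "rinner n (b' s) (b' t) = 0"
      using b z insert.hyps by (auto simp: b'_def near_orthonormal_def)
  next
    fix s assume s: "s \<in> insert r R"
    have "rinner n (\<lambda>i. (1 / m) * h i) (\<lambda>i. (1 / m) * h i) = rinner n h h / (m * m)"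
      by (simp only: rinner_scale) simp
    also have "m * m = rinner n h h" using rinner_self_nonneg[of n h] by (simp add: m_def)
    finally have "rinner n (\<lambda>i. (1 / m) * h i) (\<lambda>i. (1 / m) * h i) \<in> {0, 1}" by simp
    then show "rinner n (b' s) (b' s) \<in> {0, 1}"
      using s b insert.hyps by (cases "s = r") (auto simp: b'_def near_orthonormal_def)
  qed
  moreover have "\<forall>s\<in>insert r R. \<forall>i<n. f s i = (\<Sum>t\<in>insert r R. c' s t * b' t i)"
  proof (intro ballI allI impI)
    fix s i assume s: "s \<in> insert r R" and i: "i < n"
    show "f s i = (\<Sum>t\<in>insert r R. c' s t * b' t i)"
    proof (cases "s = r")
      case True
      have "m * (1 / m * h i) = h i"
        using rinner_self_eq_0[of n h i] i by (cases "m = 0") (auto simp: m_def)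
      moreover have "(\<Sum>t\<in>R. c' r t * b' t i) = (\<Sum>t\<in>R. rinner n (b t) (f r) * b t i)"
        using insert.hyps bb by (intro sum.cong) (auto simp: c'_def)
      ultimately show ?thesis using True insert.hyps by (simp add: c'_def b'_def h_def)
    next
      case False
      then have "(\<Sum>t\<in>R. c' s t * b' t i) = (\<Sum>t\<in>R. c s t * b t i)"
        using insert.hyps bb by (intro sum.cong) (auto simp: c'_def)
      then show ?thesis using False s i insert.hyps c by (simp add: c'_def)
    qed
  qed
  ultimately show ?case by blast
qed

lemma near_orthonormal_distance:
  assumes "finite R" "near_orthonormal n R b"
  shows "rinner n (\<lambda>i. x i - (\<Sum>s\<in>R. d s * b s i)) (\<lambda>i. x i - (\<Sum>s\<in>R. d s * b s i)) =
    rinner n x x - (\<Sum>s\<in>R. 2 * d s * rinner n (b s) x - (d s)\<^sup>2 * rinner n (b s) (b s))"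
proof -
  have "rinner n (\<lambda>i. \<Sum>s\<in>R. d s * b s i) (\<lambda>i. \<Sum>s\<in>R. d s * b s i) = (\<Sum>s\<in>R. \<Sum>t\<in>R. d t * (d s * rinner n (b s) (b t)))"
    by (simp add: rinner_sum rinner_scale) (rule sum.swap)
  also have "\<dots> = (\<Sum>s\<in>R. \<Sum>t\<in>R. if t = s then (d s)\<^sup>2 * rinner n (b s) (b s) else 0)"
    using assms(2) by (intro sum.cong refl) (auto simp: near_orthonormal_def power2_eq_square)
  also have "\<dots> = (\<Sum>s\<in>R. (d s)\<^sup>2 * rinner n (b s) (b s))" using assms(1) by simp
  finally have sq: "rinner n (\<lambda>i. \<Sum>s\<in>R. d s * b s i) (\<lambda>i. \<Sum>s\<in>R. d s * b s i) = \<dots>" .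
  have cr: "rinner n x (\<lambda>i. \<Sum>s\<in>R. d s * b s i) = (\<Sum>s\<in>R. d s * rinner n (b s) x)"
    by (simp add: rinner_sum rinner_scale rinner_commute[of n x])
  show ?thesis
    unfolding rinner_diff sq using cr rinner_commute[of n "\<lambda>i. \<Sum>s\<in>R. d s * b s i" x]
    by (simp add: sum_subtractf sum_distrib_left mult.assoc sum_negf)
qed

lemma near_orthonormal_coeff_sq:
  assumes "near_orthonormal n R b" "s \<in> R"
  shows "(rinner n (b s) x)\<^sup>2 * rinner n (b s) (b s) = (rinner n (b s) x)\<^sup>2"
proof (cases "rinner n (b s) (b s) = 0")
  case True
  then have "rinner n (b s) x = 0" by (rule rinner_eq_0)
  then show ?thesis by simp
next
  case False
  then show ?thesis using assms by (auto simp: near_orthonormal_def)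
qed

lemma bessel:
  assumes "finite R" "near_orthonormal n R b"
  shows "(\<Sum>s\<in>R. (rinner n (b s) x)\<^sup>2) \<le> rinner n x x"
proof -
  have "(\<Sum>s\<in>R. 2 * rinner n (b s) x * rinner n (b s) x - (rinner n (b s) x)\<^sup>2 * rinner n (b s) (b s))
      = (\<Sum>s\<in>R. (rinner n (b s) x)\<^sup>2)"
    using near_orthonormal_coeff_sq[OF assms(2)] by (intro sum.cong) (auto simp: power2_eq_square)
  then show ?thesis
    using near_orthonormal_distance[OF assms, of x "\<lambda>s. rinner n (b s) x"] rinner_self_nonneg by smt
qed

text \<open>The orthogonal projection is the best approximation: complete the square in each
  coefficient \<open>d s\<close>.\<close>

lemma near_orthonormal_distance_ge:
  assumes "finite R" "near_orthonormal n R b"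
  shows "rinner n x x - (\<Sum>s\<in>R. (rinner n (b s) x)\<^sup>2) \<le>
    rinner n (\<lambda>i. x i - (\<Sum>s\<in>R. d s * b s i)) (\<lambda>i. x i - (\<Sum>s\<in>R. d s * b s i))"
proof -
  have "(\<Sum>s\<in>R. 2 * d s * rinner n (b s) x - (d s)\<^sup>2 * rinner n (b s) (b s)) \<le> (\<Sum>s\<in>R. (rinner n (b s) x)\<^sup>2)"
  proof (rule sum_mono)
    fix s assume s: "s \<in> R"
    show "2 * d s * rinner n (b s) x - (d s)\<^sup>2 * rinner n (b s) (b s) \<le> (rinner n (b s) x)\<^sup>2"
    proof (cases "rinner n (b s) (b s) = 0")
      case True
      then show ?thesis using near_orthonormal_coeff_sq[OF assms(2) s, of x] by simp
    next
      case False
      then have "rinner n (b s) (b s) = 1" using assms(2) s by (auto simp: near_orthonormal_def)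
      moreover have "0 \<le> (d s - rinner n (b s) x)\<^sup>2" by simp
      ultimately show ?thesis by (simp add: power2_diff)
    qed
  qed
  then show ?thesis using near_orthonormal_distance[OF assms, of x d] by simp
qed

section \<open>Entropy of states close to low Schmidt rank\<close>

lemma gibbs_inequality:
  fixes p t :: "'k \<Rightarrow> real"
  assumes "finite K" "\<And>k. k \<in> K \<Longrightarrow> 0 \<le> p k" "\<And>k. k \<in> K \<Longrightarrow> 0 < t k" "(\<Sum>k\<in>K. t k) \<le> (\<Sum>k\<in>K. p k)"
  shows "- (\<Sum>k\<in>K. p k * ln (p k)) \<le> - (\<Sum>k\<in>K. p k * ln (t k))"
proof -
  have "p k * ln (t k) - p k * ln (p k) \<le> t k - p k" if k: "k \<in> K" for k
  proof (cases "p k = 0")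
    case False
    then have p: "0 < p k" using assms(2)[OF k] by simp
    have "ln (t k / p k) \<le> t k / p k - 1" using p assms(3)[OF k] by (intro ln_le_minus_one) simp
    then have "p k * ln (t k / p k) \<le> p k * (t k / p k - 1)" using p by (intro mult_left_mono) auto
    then show ?thesis using p assms(3)[OF k] by (simp add: ln_div right_diff_distrib)
  qed (use assms(3)[OF k] in simp)
  then have "(\<Sum>k\<in>K. p k * ln (t k) - p k * ln (p k)) \<le> (\<Sum>k\<in>K. t k - p k)" by (intro sum_mono)
  then show ?thesis using assms(4) by (simp add: sum_subtractf)
qed

text \<open>Concavity of \<open>ln\<close> at the points \<open>1 / R\<close> and
  \<open>1 / N\<close> with weights \<open>w\<close> and \<open>1 - w\<close>. In the application
  \<open>w\<close> is the weight of an eigenvector in the low-dimensional span.\<close>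

lemma ln_mix_ge:
  fixes w R N :: real
  assumes w: "0 \<le> w" "w \<le> 1" and "0 < R" "0 < N"
  shows "- ln (w / R + 1 / N) \<le> w * ln R + (1 - w) * ln N"
proof -
  have "ln ((1 - w) *\<^sub>R (1 / N) + w *\<^sub>R (1 / R)) \<ge> (1 - w) * ln (1 / N) + w * ln (1 / R)"
    using assms by (intro concave_onD[OF ln_concave]) auto
  moreover have "ln ((1 - w) *\<^sub>R (1 / N) + w *\<^sub>R (1 / R)) \<le> ln (w / R + 1 / N)"
  proof (subst ln_le_cancel_iff)
    have "0 \<le> w / R" "0 \<le> w / N" "0 < 1 / N" using assms by auto
    then show "0 < w / R + 1 / N" by linarith
    show "0 < (1 - w) *\<^sub>R (1 / N) + w *\<^sub>R (1 / R)"
      using assms by (cases "w = 0") (auto intro!: add_nonneg_pos)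
    show "(1 - w) *\<^sub>R (1 / N) + w *\<^sub>R (1 / R) \<le> w / R + 1 / N"
      using \<open>0 \<le> w / N\<close> by (simp add: diff_divide_distrib)
  qed
  ultimately show ?thesis using assms by (simp add: ln_div)
qed

lemma norm_sq_sum_real:
  fixes x :: "nat \<Rightarrow> complex" and b :: "nat \<Rightarrow> real"
  shows "(cmod (\<Sum>i<n. of_real (b i) * x i))\<^sup>2 = (rinner n b (\<lambda>i. Re (x i)))\<^sup>2 + (rinner n b (\<lambda>i. Im (x i)))\<^sup>2"
  unfolding cmod_power2 rinner_def by simp

lemma norm_sq_expand:
  fixes x :: "nat \<Rightarrow> complex" and b :: "nat \<Rightarrow> real"
  shows "of_real ((cmod (\<Sum>i<n. of_real (b i) * x i))\<^sup>2) = (\<Sum>i<n. \<Sum>j<n. of_real (b i * b j) * (x i * cnj (x j)))"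
  unfolding complex_norm_square by (simp add: sum_product mult_ac)

text \<open>Gibbs' inequality is applied with the even mixture of the normalised projection onto the span of the
  \<open>f s\<close> and the maximally mixed state.\<close>

lemma diag_on_entropy_le:
  fixes \<psi> :: "nat \<Rightarrow> 'w \<Rightarrow> real"
  assumes d: "diag_on n a u e" and n: "0 < n" and fin: "finite \<Omega>" "finite R" "R \<noteq> {}"
    and a: "\<And>i j. i < n \<Longrightarrow> j < n \<Longrightarrow> a i j = of_real (\<Sum>\<omega>\<in>\<Omega>. \<psi> i \<omega> * \<psi> j \<omega>)"
    and norm: "(\<Sum>i<n. \<Sum>\<omega>\<in>\<Omega>. (\<psi> i \<omega>)\<^sup>2) = 1"
    and approx: "(\<Sum>i<n. \<Sum>\<omega>\<in>\<Omega>. (\<psi> i \<omega> - (\<Sum>s\<in>R. f s i * g s \<omega>))\<^sup>2) \<le> \<epsilon>"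
  shows "- (\<Sum>k<n. e k * ln (e k)) \<le> ln (2 * real (card R)) + \<epsilon> * ln (2 * real n)"
proof -
  obtain b c where b: "near_orthonormal n R b"
    and c: "\<And>s i. s \<in> R \<Longrightarrow> i < n \<Longrightarrow> f s i = (\<Sum>t\<in>R. c s t * b t i)"
    using near_orthonormal_basis[OF fin(2), of n f] by blast
  have comp: "(\<Sum>k<n. u k i * cnj (u k j)) = (if i = j then 1 else 0)" if "i < n" "j < n" for i j
    using d that by (simp add: diag_on_def)
  have aeq: "(\<Sum>k<n. of_real (e k) * (u k i * cnj (u k j))) = a i j" if "i < n" "j < n" for i j
    using d that by (simp add: diag_on_def mult_ac)
  have usq: "(\<Sum>i<n. (cmod (u k i))\<^sup>2) = 1" if "k < n" for k
    using d that by (intro unit_sum_sq) (simp add: diag_on_def)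
  have e_eq: "e k = (\<Sum>\<omega>\<in>\<Omega>. (cmod (\<Sum>i<n. of_real (\<psi> i \<omega>) * u k i))\<^sup>2)" if k: "k < n" for k
  proof -
    have "complex_of_real (\<Sum>\<omega>\<in>\<Omega>. (cmod (\<Sum>i<n. of_real (\<psi> i \<omega>) * u k i))\<^sup>2)
        = (\<Sum>\<omega>\<in>\<Omega>. \<Sum>i<n. \<Sum>j<n. of_real (\<psi> i \<omega> * \<psi> j \<omega>) * (u k i * cnj (u k j)))"
      unfolding of_real_sum norm_sq_expand ..
    also have "\<dots> = (\<Sum>i<n. \<Sum>j<n. \<Sum>\<omega>\<in>\<Omega>. of_real (\<psi> i \<omega> * \<psi> j \<omega>) * (u k i * cnj (u k j)))"
      by (subst sum.swap, rule sum.cong[OF refl], rule sum.swap)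
    also have "\<dots> = (\<Sum>i<n. \<Sum>j<n. a i j * (u k i * cnj (u k j)))"
      by (intro sum.cong refl) (simp add: a sum_distrib_right)
    also have "\<dots> = (\<Sum>j<n. \<Sum>i<n. a i j * (u k i * cnj (u k j)))" by (rule sum.swap)
    also have "\<dots> = (\<Sum>j<n. \<Sum>i<n. cnj (u k j) * (a j i * u k i))"
      by (intro sum.cong refl) (simp add: a mult_ac)
    also have "\<dots> = cinner n (u k) (mult_on n a (u k))"
      unfolding cinner_def mult_on_def by (simp add: sum_distrib_left)
    also have "\<dots> = of_real (e k)" by (rule diag_on_quadratic[OF d k])
    finally show ?thesis unfolding of_real_eq_iff by (rule sym)
  qed
  then have e0: "0 \<le> e k" if "k < n" for k using that by (simp add: sum_nonneg)
  have e1: "(\<Sum>k<n. e k) = 1"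
  proof -
    have "complex_of_real (\<Sum>k<n. e k) = (\<Sum>k<n. of_real (e k) * of_real (\<Sum>i<n. (cmod (u k i))\<^sup>2))"
      using usq by simp
    also have "\<dots> = (\<Sum>k<n. \<Sum>i<n. of_real (e k) * (u k i * cnj (u k i)))"
      by (simp add: sum_distrib_left complex_norm_square[symmetric] of_real_power)
    also have "\<dots> = (\<Sum>i<n. \<Sum>k<n. of_real (e k) * (u k i * cnj (u k i)))" by (rule sum.swap)
    also have "\<dots> = (\<Sum>i<n. a i i)" using aeq by (intro sum.cong) auto
    also have "\<dots> = of_real (\<Sum>i<n. \<Sum>\<omega>\<in>\<Omega>. (\<psi> i \<omega>)\<^sup>2)" using a by (simp add: power2_eq_square)
    finally show ?thesis unfolding norm of_real_eq_iff .
  qed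
  \<comment> \<open>The squared length of the projection of the eigenvector \<open>u k\<close> onto
    the span of the \<open>f s\<close>, as the basis \<open>b\<close> is real. Bessel's inequality
    bounds it by 1, and its sum over \<open>k\<close> is the trace of the projection, at most the
    number of the \<open>f s\<close>.\<close>
  define W where "W k = (\<Sum>s\<in>R. (cmod (\<Sum>i<n. of_real (b s i) * u k i))\<^sup>2)" for k
  have W0: "0 \<le> W k" for k unfolding W_def by (intro sum_nonneg) simp
  have W1: "W k \<le> 1" if k: "k < n" for k
  proof -
    have "W k \<le> rinner n (\<lambda>i. Re (u k i)) (\<lambda>i. Re (u k i)) + rinner n (\<lambda>i. Im (u k i)) (\<lambda>i. Im (u k i))"
      unfolding W_def norm_sq_sum_real sum.distrib by (intro add_mono bessel fin b)
    also have "\<dots> = 1" using usq[OF k] unfolding cmod_power2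
      by (simp add: rinner_def power2_eq_square sum.distrib)
    finally show ?thesis .
  qed
  have Wsum: "(\<Sum>k<n. W k) \<le> real (card R)"
  proof -
    have "complex_of_real (\<Sum>k<n. W k) = (\<Sum>k<n. \<Sum>s\<in>R. \<Sum>i<n. \<Sum>j<n. of_real (b s i * b s j) * (u k i * cnj (u k j)))"
      unfolding W_def of_real_sum norm_sq_expand ..
    also have "\<dots> = (\<Sum>s\<in>R. \<Sum>i<n. \<Sum>j<n. \<Sum>k<n. of_real (b s i * b s j) * (u k i * cnj (u k j)))"
      by (subst sum.swap, rule sum.cong[OF refl], subst sum.swap, rule sum.cong[OF refl], rule sum.swap)
    also have "\<dots> = (\<Sum>s\<in>R. \<Sum>i<n. \<Sum>j<n. if j = i then of_real (b s i * b s j) else 0)"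
      using comp by (intro sum.cong refl) (simp add: sum_distrib_left[symmetric])
    also have "\<dots> = of_real (\<Sum>s\<in>R. rinner n (b s) (b s))" by (simp add: rinner_def)
    finally have "(\<Sum>k<n. W k) = (\<Sum>s\<in>R. rinner n (b s) (b s))" unfolding of_real_eq_iff .
    also have "\<dots> \<le> (\<Sum>s\<in>R. 1)" using b by (intro sum_mono) (auto simp: near_orthonormal_def)
    finally show ?thesis by simp
  qed
  \<comment> \<open>The left-out part of the state is small: for fixed \<omega> the approximating
    vector lies in the span, so its distance from the amplitudes is at least that of their
    projection. Summing over \<omega> compares this with \<epsilon>.\<close>
  have eW: "1 - \<epsilon> \<le> (\<Sum>k<n. e k * W k)"
  proof -
    have "complex_of_real (\<Sum>k<n. e k * W k) = (\<Sum>k<n. \<Sum>s\<in>R. \<Sum>i<n. \<Sum>j<n. of_real (e k) * (of_real (b s i * b s j) * (u k i * cnj (u k j))))"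
      unfolding W_def of_real_sum of_real_mult[of "e _"] norm_sq_expand by (simp add: sum_distrib_left)
    also have "\<dots> = (\<Sum>s\<in>R. \<Sum>i<n. \<Sum>j<n. \<Sum>k<n. of_real (e k) * (of_real (b s i * b s j) * (u k i * cnj (u k j))))"
      by (subst sum.swap, rule sum.cong[OF refl], subst sum.swap, rule sum.cong[OF refl], rule sum.swap)
    also have "\<dots> = (\<Sum>s\<in>R. \<Sum>i<n. \<Sum>j<n. of_real (b s i * b s j) * a i j)"
      by (intro sum.cong refl) (simp add: aeq[symmetric] sum_distrib_left mult_ac)
    also have "\<dots> = of_real (\<Sum>s\<in>R. \<Sum>i<n. \<Sum>j<n. \<Sum>\<omega>\<in>\<Omega>. (b s i * \<psi> i \<omega>) * (b s j * \<psi> j \<omega>))"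
      by (simp add: a sum_distrib_left mult_ac)
    finally have "(\<Sum>k<n. e k * W k) = (\<Sum>s\<in>R. \<Sum>i<n. \<Sum>j<n. \<Sum>\<omega>\<in>\<Omega>. (b s i * \<psi> i \<omega>) * (b s j * \<psi> j \<omega>))"
      unfolding of_real_eq_iff .
    also have "\<dots> = (\<Sum>s\<in>R. \<Sum>\<omega>\<in>\<Omega>. \<Sum>i<n. \<Sum>j<n. (b s i * \<psi> i \<omega>) * (b s j * \<psi> j \<omega>))"
      by (simp only: sum.swap[of _ \<Omega>])
    also have "\<dots> = (\<Sum>s\<in>R. \<Sum>\<omega>\<in>\<Omega>. (rinner n (b s) (\<lambda>i. \<psi> i \<omega>))\<^sup>2)"
      by (simp add: power2_eq_square rinner_def sum_product)
    also have "\<dots> = (\<Sum>\<omega>\<in>\<Omega>. \<Sum>s\<in>R. (rinner n (b s) (\<lambda>i. \<psi> i \<omega>))\<^sup>2)" by (rule sum.swap)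
    finally have eq: "(\<Sum>k<n. e k * W k) = \<dots>" .
    have "(\<Sum>\<omega>\<in>\<Omega>. rinner n (\<lambda>i. \<psi> i \<omega>) (\<lambda>i. \<psi> i \<omega>) - (\<Sum>s\<in>R. (rinner n (b s) (\<lambda>i. \<psi> i \<omega>))\<^sup>2)) \<le>
       (\<Sum>\<omega>\<in>\<Omega>. \<Sum>i<n. (\<psi> i \<omega> - (\<Sum>s\<in>R. f s i * g s \<omega>))\<^sup>2)"
    proof (rule sum_mono)
      fix \<omega>
      define dd where "dd t = (\<Sum>s\<in>R. c s t * g s \<omega>)" for t
      have ch: "(\<Sum>s\<in>R. f s i * g s \<omega>) = (\<Sum>t\<in>R. dd t * b t i)" if "i < n" for i
      proof -
        have "(\<Sum>s\<in>R. f s i * g s \<omega>) = (\<Sum>s\<in>R. \<Sum>t\<in>R. c s t * b t i * g s \<omega>)"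
          using c that by (simp add: sum_distrib_right)
        also have "\<dots> = (\<Sum>t\<in>R. \<Sum>s\<in>R. c s t * b t i * g s \<omega>)" by (rule sum.swap)
        finally show ?thesis unfolding dd_def by (simp add: sum_distrib_left mult_ac)
      qed
      have "rinner n (\<lambda>i. \<psi> i \<omega>) (\<lambda>i. \<psi> i \<omega>) - (\<Sum>s\<in>R. (rinner n (b s) (\<lambda>i. \<psi> i \<omega>))\<^sup>2) \<le>
        rinner n (\<lambda>i. \<psi> i \<omega> - (\<Sum>s\<in>R. dd s * b s i)) (\<lambda>i. \<psi> i \<omega> - (\<Sum>s\<in>R. dd s * b s i))"
        by (rule near_orthonormal_distance_ge[OF fin(2) b])
      also have "\<dots> = (\<Sum>i<n. (\<psi> i \<omega> - (\<Sum>s\<in>R. f s i * g s \<omega>))\<^sup>2)"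
        unfolding rinner_def power2_eq_square using ch by (intro sum.cong) auto
      finally show "rinner n (\<lambda>i. \<psi> i \<omega>) (\<lambda>i. \<psi> i \<omega>) - (\<Sum>s\<in>R. (rinner n (b s) (\<lambda>i. \<psi> i \<omega>))\<^sup>2) \<le>
        (\<Sum>i<n. (\<psi> i \<omega> - (\<Sum>s\<in>R. f s i * g s \<omega>))\<^sup>2)" .
    qed
    also have "\<dots> \<le> \<epsilon>" using approx by (subst sum.swap)
    finally have "(\<Sum>\<omega>\<in>\<Omega>. rinner n (\<lambda>i. \<psi> i \<omega>) (\<lambda>i. \<psi> i \<omega>)) - (\<Sum>k<n. e k * W k) \<le> \<epsilon>"
      unfolding eq by (simp add: sum_subtractf)
    moreover have "(\<Sum>\<omega>\<in>\<Omega>. rinner n (\<lambda>i. \<psi> i \<omega>) (\<lambda>i. \<psi> i \<omega>)) = 1"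
      unfolding rinner_def using norm by (subst sum.swap) (simp add: power2_eq_square)
    ultimately show ?thesis by simp
  qed
  have R1: "1 \<le> real (card R)" using fin by (simp add: Suc_le_eq card_gt_0_iff)
  have n1: "1 \<le> real n" using n by simp
  define t where "t k = W k / (2 * real (card R)) + 1 / (2 * real n)" for k
  have t0: "0 < t k" for k
    unfolding t_def using W0[of k] R1 n1 by (intro add_nonneg_pos) auto
  have tsum: "(\<Sum>k<n. t k) \<le> 1"
  proof -
    have "(\<Sum>k<n. t k) = (\<Sum>k<n. W k) / (2 * real (card R)) + 1 / 2"
      unfolding t_def sum.distrib sum_divide_distrib[symmetric] using n1 by simp
    also have "\<dots> \<le> 1 / 2 + 1 / 2" using Wsum R1 by (intro add_right_mono) (simp add: field_simps)
    finally show ?thesis by simp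
  qed
  have "- (\<Sum>k<n. e k * ln (e k)) \<le> - (\<Sum>k<n. e k * ln (t k))"
    using e0 t0 tsum e1 by (intro gibbs_inequality) auto
  also have "\<dots> = (\<Sum>k<n. e k * (- ln (t k)))" by (simp add: sum_negf)
  also have "\<dots> \<le> (\<Sum>k<n. e k * (W k * ln (2 * real (card R)) + (1 - W k) * ln (2 * real n)))"
    unfolding t_def using e0 W0 W1 R1 n1 by (intro sum_mono mult_left_mono ln_mix_ge) auto
  also have "\<dots> = (\<Sum>k<n. e k * W k) * ln (2 * real (card R)) + (1 - (\<Sum>k<n. e k * W k)) * ln (2 * real n)"
    using e1 by (simp add: algebra_simps sum.distrib sum_subtractf sum_distrib_left sum_distrib_right[symmetric])
  also have "\<dots> \<le> 1 * ln (2 * real (card R)) + \<epsilon> * ln (2 * real n)"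
  proof (intro add_mono mult_right_mono)
    have "(\<Sum>k<n. e k * W k) \<le> (\<Sum>k<n. e k * 1)" using e0 W1 by (intro sum_mono mult_left_mono) auto
    then show "(\<Sum>k<n. e k * W k) \<le> 1" using e1 by simp
    show "1 - (\<Sum>k<n. e k * W k) \<le> \<epsilon>" using eW by simp
    show "0 \<le> ln (2 * real (card R))" "0 \<le> ln (2 * real n)" using R1 n1 by auto
  qed
  finally show ?thesis by simp
qed


section \<open>Measurability of the event\<close>

lemma sum_from_nat_into:
  assumes "finite I"
  shows "(\<Sum>\<sigma>\<in>I. h \<sigma>) = (\<Sum>i<card I. h (from_nat_into I i))"
  using sum.reindex_bij_betw[OF bij_betw_from_nat_into_finite[OF assms], of h] by simp

lemma from_nat_into_mem: "i < card I \<Longrightarrow> from_nat_into I i \<in> I"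
  by (rule from_nat_into) auto

lemma ball_from_nat_into:
  assumes "finite I"
  shows "(\<forall>\<sigma>\<in>I. P \<sigma>) \<longleftrightarrow> (\<forall>i<card I. P (from_nat_into I i))"
  using bij_betw_imp_surj_on[OF bij_betw_from_nat_into_finite[OF assms]] by (metis imageE imageI lessThan_iff)

abbreviation indexed :: "'i set \<Rightarrow> ('i \<Rightarrow> 'i \<Rightarrow> complex) \<Rightarrow> nat \<Rightarrow> nat \<Rightarrow> complex" where
  "indexed I A \<equiv> (\<lambda>i j. A (from_nat_into I i) (from_nat_into I j))"

lemma mult_vec_on_nth:
  assumes "finite I" "i < card I"
  shows "vec_index (mat_on I A *\<^sub>v vec_on I \<psi>) i = (\<Sum>\<tau>\<in>I. A (from_nat_into I i) \<tau> * \<psi> \<tau>)"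
  using assms(2) unfolding sum_from_nat_into[OF assms(1)]
  by (simp add: mat_on_def vec_on_def scalar_prod_def atLeast0LessThan)

lemma eigenvector_on_iff:
  assumes "finite I"
  shows "eigenvector (mat_on I A) (vec_on I \<psi>) c \<longleftrightarrow>
    (\<exists>\<sigma>\<in>I. \<psi> \<sigma> \<noteq> 0) \<and> (\<forall>\<sigma>\<in>I. (\<Sum>\<tau>\<in>I. A \<sigma> \<tau> * \<psi> \<tau>) = c * \<psi> \<sigma>)"
proof -
  have 1: "mat_on I A *\<^sub>v vec_on I \<psi> = c \<cdot>\<^sub>v vec_on I \<psi> \<longleftrightarrow> (\<forall>\<sigma>\<in>I. (\<Sum>\<tau>\<in>I. A \<sigma> \<tau> * \<psi> \<tau>) = c * \<psi> \<sigma>)"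
    unfolding ball_from_nat_into[OF assms] using mult_vec_on_nth[OF assms, of _ A \<psi>]
    by (subst vec_eq_iff) (auto simp: mat_on_def vec_on_def)
  have 2: "vec_on I \<psi> = 0\<^sub>v (card I) \<longleftrightarrow> (\<forall>\<sigma>\<in>I. \<psi> \<sigma> = 0)"
    unfolding ball_from_nat_into[OF assms] by (subst vec_eq_iff) (auto simp: vec_on_def)
  show ?thesis unfolding eigenvector_def 1 using 2 by (auto simp: mat_on_def vec_on_def)
qed

lemma ground_state_on_iff:
  assumes I: "finite I" and d: "diag_on (card I) (indexed I A) u e"
  shows "ground_state (mat_on I A) (vec_on I \<psi>) \<longleftrightarrow>
    (\<exists>E::real. (\<exists>\<sigma>\<in>I. \<psi> \<sigma> \<noteq> 0) \<and> (\<forall>\<sigma>\<in>I. (\<Sum>\<tau>\<in>I. A \<sigma> \<tau> * \<psi> \<tau>) = of_real E * \<psi> \<sigma>) \<and> (\<forall>k<card I. E \<le> e k))"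
proof -
  have "eigenvalue (mat_on I A) (complex_of_real E') \<longleftrightarrow> (\<exists>k<card I. E' = e k)" for E'
    using diag_on_eigenvalue[OF d, of "of_real E'"] by (simp add: mat_on_def)
  then have "(\<forall>E'. eigenvalue (mat_on I A) (complex_of_real E') \<longrightarrow> E \<le> E') \<longleftrightarrow> (\<forall>k<card I. E \<le> e k)" for E
    by auto
  then show ?thesis unfolding ground_state_def eigenvector_on_iff[OF I] by (simp add: conj_assoc)
qed

text \<open>The only delicate point is \<open>l = 0\<close>, where \<open>ln 0 = 0\<close> gives the
  right value. There \<open>\<bar>x ln x\<bar> \<le> 2 sqrt x\<close> follows from
  \<open>ln y \<le> y - 1\<close> at \<open>y = 1 / sqrt x\<close>.\<close>

lemma tendsto_x_ln_x:
  fixes p :: "nat \<Rightarrow> real"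
  assumes p: "p \<longlonglongrightarrow> l" and p0: "\<And>m. 0 \<le> p m"
  shows "(\<lambda>m. p m * ln (p m)) \<longlonglongrightarrow> l * ln l"
proof (cases "l = 0")
  case False
  then show ?thesis using p by (intro tendsto_intros) auto
next
  case True
  have bound: "\<bar>x * ln x\<bar> \<le> 2 * sqrt x" if "0 \<le> x" "x \<le> 1" for x :: real
  proof (cases "x = 0")
    case False
    then have x: "0 < x" using that by simp
    have "ln (1 / sqrt x) \<le> 1 / sqrt x - 1" using x by (intro ln_le_minus_one) simp
    then have "- ln x \<le> 2 * (1 / sqrt x)" using x by (simp add: ln_div ln_sqrt)
    then have "x * (- ln x) \<le> x * (2 * (1 / sqrt x))" using x by (intro mult_left_mono) auto
    also have "\<dots> = 2 * (x / sqrt x)" by simp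
    also have "\<dots> = 2 * sqrt x" using x by (simp only: real_div_sqrt less_imp_le)
    finally show ?thesis using x that by (simp add: abs_mult)
  qed simp
  have "eventually (\<lambda>m. p m < 1) sequentially"
    using order_tendstoD(2)[OF p, of 1] True by simp
  then have "eventually (\<lambda>m. norm (p m * ln (p m)) \<le> 2 * sqrt (p m)) sequentially"
    by eventually_elim (use bound p0 in auto)
  moreover have "(\<lambda>m. 2 * sqrt (p m)) \<longlonglongrightarrow> 0"
    using tendsto_mult[OF tendsto_const tendsto_real_sqrt[OF p], of 2] True by simp
  ultimately have "(\<lambda>m. p m * ln (p m)) \<longlonglongrightarrow> 0"
    by (rule Lim_null_comparison)
  then show ?thesis using True by simp
qed

text \<open>The quadratic form of a Gram matrix is a sum of squared moduli. It is applied to reduced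
  density matrices and, with another index set, to the Hamiltonian.\<close>

lemma diag_on_gram_nonneg:
  assumes d: "diag_on n a u e" and k: "k < n"
    and a: "\<And>i j. i < n \<Longrightarrow> j < n \<Longrightarrow> a i j = (\<Sum>\<omega>\<in>\<Omega>. \<phi> i \<omega> * cnj (\<phi> j \<omega>))"
  shows "0 \<le> e k"
proof -
  have "complex_of_real (e k) = (\<Sum>i<n. \<Sum>j<n. cnj (u k i) * (a i j * u k j))"
    unfolding diag_on_quadratic[OF d k, symmetric] cinner_def mult_on_def by (simp add: sum_distrib_left)
  also have "\<dots> = (\<Sum>i<n. \<Sum>j<n. \<Sum>\<omega>\<in>\<Omega>. cnj (u k i) * \<phi> i \<omega> * (u k j * cnj (\<phi> j \<omega>)))"
    by (intro sum.cong refl) (simp add: a sum_distrib_left sum_distrib_right mult_ac)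
  also have "\<dots> = (\<Sum>\<omega>\<in>\<Omega>. \<Sum>i<n. \<Sum>j<n. cnj (u k i) * \<phi> i \<omega> * (u k j * cnj (\<phi> j \<omega>)))"
    by (simp only: sum.swap[of _ \<Omega>])
  also have "\<dots> = (\<Sum>\<omega>\<in>\<Omega>. (\<Sum>i<n. cnj (u k i) * \<phi> i \<omega>) * cnj (\<Sum>i<n. cnj (u k i) * \<phi> i \<omega>))"
    by (simp add: sum_product)
  also have "\<dots> = of_real (\<Sum>\<omega>\<in>\<Omega>. (cmod (\<Sum>i<n. cnj (u k i) * \<phi> i \<omega>))\<^sup>2)"
    by (simp only: complex_norm_square of_real_sum)
  finally have "e k = (\<Sum>\<omega>\<in>\<Omega>. (cmod (\<Sum>i<n. cnj (u k i) * \<phi> i \<omega>))\<^sup>2)" unfolding of_real_eq_iff .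
  then show ?thesis by (simp add: sum_nonneg)
qed

section \<open>Limits of reduced states and of ground states\<close>

lemma finite_lattice_box: "finite (lattice_box L)"
  by (simp add: lattice_box_def)

lemma finite_halves: "finite (left_half L)" "finite (right_half L)"
  using finite_lattice_box by (auto simp: left_half_def right_half_def)

lemma finite_configs: "finite X \<Longrightarrow> finite (configs X :: (int \<times> int \<Rightarrow> 'd::finite) set)"
  unfolding configs_def by (intro finite_PiE) auto

lemma merge_in_configs:
  assumes "\<sigma> \<in> configs (left_half L)" "\<omega> \<in> configs (right_half L)"
  shows "merge (left_half L) (right_half L) (\<sigma>, \<omega>) \<in> configs (lattice_box L)"
  using assms unfolding configs_def merge_def left_half_def right_half_def by (auto simp: PiE_iff extensional_def)

lemma rho_left_hermitian: "rho_left L \<psi> \<tau> \<sigma> = cnj (rho_left L \<psi> \<sigma> \<tau>)"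
  by (simp add: rho_left_def mult.commute)

lemma rho_left_tendsto:
  assumes "\<And>\<sigma>. \<sigma> \<in> configs (lattice_box L) \<Longrightarrow> (\<lambda>m. \<psi> m \<sigma>) \<longlonglongrightarrow> \<psi>' \<sigma>"
    and "\<sigma> \<in> configs (left_half L)" "\<tau> \<in> configs (left_half L)"
  shows "(\<lambda>m. rho_left L (\<psi> m) \<sigma> \<tau>) \<longlonglongrightarrow> rho_left L \<psi>' \<sigma> \<tau>"
  unfolding rho_left_def by (intro tendsto_intros assms merge_in_configs)

lemma entanglement_entropy_limit:
  fixes \<psi> :: "nat \<Rightarrow> (int \<times> int \<Rightarrow> 'd::finite) \<Rightarrow> complex"
  assumes lim: "\<And>\<sigma>. \<sigma> \<in> configs (lattice_box L) \<Longrightarrow> (\<lambda>m. \<psi> m \<sigma>) \<longlonglongrightarrow> \<psi>' \<sigma>"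
    and le: "\<And>m. entanglement_entropy L (\<psi> m) \<le> K"
  shows "entanglement_entropy L \<psi>' \<le> K"
proof -
  let ?J = "configs (left_half L) :: (int \<times> int \<Rightarrow> 'd) set"
  let ?n = "card ?J"
  have "\<exists>u e. diag_on ?n (indexed ?J (rho_left L (\<psi> m))) u e" for m
    by (rule ex_diag_on) (rule rho_left_hermitian)
  then obtain u e where d: "\<And>m. diag_on ?n (indexed ?J (rho_left L (\<psi> m))) (u m) (e m)" by metis
  have "(\<lambda>m. indexed ?J (rho_left L (\<psi> m)) i j) \<longlonglongrightarrow> indexed ?J (rho_left L \<psi>') i j" if "i < ?n" "j < ?n" for i j
    using that by (intro rho_left_tendsto lim from_nat_into_mem)
  from diag_on_subseq_limit[OF d this]
  obtain r u' e' where r: "strict_mono r" and d': "diag_on ?n (indexed ?J (rho_left L \<psi>')) u' e'"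
    and e': "\<And>k. k < ?n \<Longrightarrow> (\<lambda>m. e (r m) k) \<longlonglongrightarrow> e' k" by blast
  have "0 \<le> e m k" if "k < ?n" for m k
    by (rule diag_on_gram_nonneg[OF d that, unfolded rho_left_def]) (rule refl)
  then have "(\<lambda>m. - (\<Sum>k<?n. e (r m) k * ln (e (r m) k))) \<longlonglongrightarrow> - (\<Sum>k<?n. e' k * ln (e' k))"
    using e' by (intro tendsto_minus tendsto_sum tendsto_x_ln_x) auto
  moreover have "- (\<Sum>k<?n. e m k * ln (e m k)) = entanglement_entropy L (\<psi> m)" for m
    using von_neumann_entropy_diag[OF d] by (simp add: entanglement_entropy_def mat_on_def)
  moreover have "- (\<Sum>k<?n. e' k * ln (e' k)) = entanglement_entropy L \<psi>'"
    using von_neumann_entropy_diag[OF d'] by (simp add: entanglement_entropy_def mat_on_def)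
  ultimately have "(\<lambda>m. entanglement_entropy L (\<psi> (r m))) \<longlonglongrightarrow> entanglement_entropy L \<psi>'" by simp
  then show ?thesis by (rule LIMSEQ_le_const2) (use le in blast)
qed

text \<open>Normalized vectors over a finite index set form a compact set, so the ground states
  converge along a subsequence. Taking a subsequence along which the spectra converge too keeps the
  energy below the whole limiting spectrum.\<close>

lemma ground_state_limit:
  fixes A :: "nat \<Rightarrow> 'i \<Rightarrow> 'i \<Rightarrow> complex"
  assumes I: "finite I"
    and herm: "\<And>m \<sigma> \<tau>. A m \<tau> \<sigma> = cnj (A m \<sigma> \<tau>)"
    and A: "\<And>\<sigma> \<tau>. \<sigma> \<in> I \<Longrightarrow> \<tau> \<in> I \<Longrightarrow> (\<lambda>m. A m \<sigma> \<tau>) \<longlonglongrightarrow> A' \<sigma> \<tau>"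
    and norm: "\<And>m. normalized_on I (\<psi> m)"
    and gs: "\<And>m. ground_state (mat_on I (A m)) (vec_on I (\<psi> m))"
  shows "\<exists>r \<psi>'. strict_mono r \<and> (\<forall>\<sigma>\<in>I. (\<lambda>m. \<psi> (r m) \<sigma>) \<longlonglongrightarrow> \<psi>' \<sigma>) \<and>
    normalized_on I \<psi>' \<and> ground_state (mat_on I A') (vec_on I \<psi>')"
proof -
  let ?n = "card I"
  have le1: "cmod (\<psi> m \<sigma>) \<le> 1" if "\<sigma> \<in> I" for m \<sigma>
  proof -
    have "(cmod (\<psi> m \<sigma>))\<^sup>2 \<le> (\<Sum>\<sigma>\<in>I. (cmod (\<psi> m \<sigma>))\<^sup>2)" using that I by (intro member_le_sum) auto
    then show ?thesis using norm[of m] power2_le_imp_le[of "cmod (\<psi> m \<sigma>)" 1] by (simp add: normalized_on_def)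
  qed
  have "\<exists>u e. diag_on ?n (indexed I (A m)) u e" for m
    by (rule ex_diag_on) (rule herm)
  then obtain u e where d: "\<And>m. diag_on ?n (indexed I (A m)) (u m) (e m)" by metis
  have "(\<lambda>m. indexed I (A m) i j) \<longlonglongrightarrow> indexed I A' i j" if "i < ?n" "j < ?n" for i j
    using that by (intro A from_nat_into_mem)
  from diag_on_subseq_limit[OF d this]
  obtain r1 u' e' where r1: "strict_mono r1" and d': "diag_on ?n (indexed I A') u' e'"
    and e': "\<And>k. k < ?n \<Longrightarrow> (\<lambda>m. e (r1 m) k) \<longlonglongrightarrow> e' k" by blast
  have "bounded (range (\<lambda>m. \<psi> (r1 m) \<sigma>))" if "\<sigma> \<in> I" for \<sigma>
    unfolding bounded_iff using le1[OF that] by (intro exI[of _ 1]) auto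
  then have "\<exists>r l. strict_mono r \<and> (\<forall>\<sigma>\<in>I. (\<lambda>m. \<psi> (r1 (r m)) \<sigma>) \<longlonglongrightarrow> l \<sigma>)"
    by (intro finite_index_convergent_subseq I)
  then obtain r2 \<psi>' where r2: "strict_mono r2" and \<psi>': "\<And>\<sigma>. \<sigma> \<in> I \<Longrightarrow> (\<lambda>m. \<psi> (r1 (r2 m)) \<sigma>) \<longlonglongrightarrow> \<psi>' \<sigma>"
    by blast
  define r where "r = r1 \<circ> r2"
  have r: "strict_mono r" unfolding r_def by (rule strict_mono_o[OF r1 r2])
  have \<psi>r: "(\<lambda>m. \<psi> (r m) \<sigma>) \<longlonglongrightarrow> \<psi>' \<sigma>" if "\<sigma> \<in> I" for \<sigma> using \<psi>'[OF that] by (simp add: r_def)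
  have er: "(\<lambda>m. e (r m) k) \<longlonglongrightarrow> e' k" if "k < ?n" for k
    using LIMSEQ_subseq_LIMSEQ[OF e'[OF that] r2] by (simp add: r_def o_def)
  have Ar: "(\<lambda>m. A (r m) \<sigma> \<tau>) \<longlonglongrightarrow> A' \<sigma> \<tau>" if "\<sigma> \<in> I" "\<tau> \<in> I" for \<sigma> \<tau>
    using LIMSEQ_subseq_LIMSEQ[OF A[OF that] r] by (simp add: o_def)
  have "\<exists>E::real. (\<forall>\<sigma>\<in>I. (\<Sum>\<tau>\<in>I. A m \<sigma> \<tau> * \<psi> m \<tau>) = of_real E * \<psi> m \<sigma>) \<and> (\<forall>k<?n. E \<le> e m k)" for m
    using gs[of m] unfolding ground_state_on_iff[OF I d] by blast
  then obtain E where E: "\<And>m \<sigma>. \<sigma> \<in> I \<Longrightarrow> (\<Sum>\<tau>\<in>I. A m \<sigma> \<tau> * \<psi> m \<tau>) = complex_of_real (E m) * \<psi> m \<sigma>"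
    and Ele: "\<And>m k. k < ?n \<Longrightarrow> E m \<le> e m k" by metis
  have "(\<lambda>m. \<Sum>\<sigma>\<in>I. (cmod (\<psi> (r m) \<sigma>))\<^sup>2) \<longlonglongrightarrow> (\<Sum>\<sigma>\<in>I. (cmod (\<psi>' \<sigma>))\<^sup>2)"
    by (intro tendsto_intros \<psi>r)
  then have norm': "normalized_on I \<psi>'"
    using norm by (simp add: normalized_on_def LIMSEQ_const_iff)
  \<comment> \<open>As a Rayleigh quotient the energy is a polynomial in the entries of the matrix
    and of the state and their conjugates, so it converges with them.\<close>
  have E_eq: "complex_of_real (E m) = (\<Sum>\<sigma>\<in>I. cnj (\<psi> m \<sigma>) * (\<Sum>\<tau>\<in>I. A m \<sigma> \<tau> * \<psi> m \<tau>))" for m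
  proof -
    have "(\<Sum>\<sigma>\<in>I. cnj (\<psi> m \<sigma>) * (\<Sum>\<tau>\<in>I. A m \<sigma> \<tau> * \<psi> m \<tau>)) = (\<Sum>\<sigma>\<in>I. of_real (E m) * (\<psi> m \<sigma> * cnj (\<psi> m \<sigma>)))"
      by (intro sum.cong) (auto simp: E)
    also have "\<dots> = of_real (E m) * of_real (\<Sum>\<sigma>\<in>I. (cmod (\<psi> m \<sigma>))\<^sup>2)"
      by (simp add: sum_distrib_left complex_norm_square[symmetric])
    finally show ?thesis unfolding norm[of m, unfolded normalized_on_def] by simp
  qed
  define E' where "E' = Re (\<Sum>\<sigma>\<in>I. cnj (\<psi>' \<sigma>) * (\<Sum>\<tau>\<in>I. A' \<sigma> \<tau> * \<psi>' \<tau>))"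
  have "(\<lambda>m. Re (complex_of_real (E (r m)))) \<longlonglongrightarrow> E'"
    unfolding E_eq E'_def by (intro tendsto_intros \<psi>r Ar)
  then have Er: "(\<lambda>m. E (r m)) \<longlonglongrightarrow> E'" by simp
  have "(\<Sum>\<tau>\<in>I. A' \<sigma> \<tau> * \<psi>' \<tau>) = of_real E' * \<psi>' \<sigma>" if \<sigma>: "\<sigma> \<in> I" for \<sigma>
  proof -
    have "(\<lambda>m. \<Sum>\<tau>\<in>I. A (r m) \<sigma> \<tau> * \<psi> (r m) \<tau>) \<longlonglongrightarrow> (\<Sum>\<tau>\<in>I. A' \<sigma> \<tau> * \<psi>' \<tau>)"
      using \<sigma> by (intro tendsto_intros Ar \<psi>r)
    moreover have "(\<lambda>m. \<Sum>\<tau>\<in>I. A (r m) \<sigma> \<tau> * \<psi> (r m) \<tau>) \<longlonglongrightarrow> of_real E' * \<psi>' \<sigma>"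
      unfolding E[OF \<sigma>] by (intro tendsto_intros Er \<psi>r \<sigma>)
    ultimately show ?thesis by (rule LIMSEQ_unique)
  qed
  moreover have "E' \<le> e' k" if "k < ?n" for k
    using LIMSEQ_le[OF Er er[OF that]] Ele[OF that] by blast
  moreover have "\<exists>\<sigma>\<in>I. \<psi>' \<sigma> \<noteq> 0"
  proof (rule ccontr)
    assume "\<not> ?thesis"
    then show False using norm' by (simp add: normalized_on_def)
  qed
  ultimately have "ground_state (mat_on I A') (vec_on I \<psi>')"
    unfolding ground_state_on_iff[OF I d'] by blast
  then show ?thesis using r \<psi>r norm' by blast
qed

lemma hamiltonian_hermitian:
  fixes U1 U2 :: "real^('d::finite \<times> 'd)^('d \<times> 'd)"
  shows "hamiltonian bc L (columns_proj c r U1) (columns_proj c r U2) \<tau> \<sigma> =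
    cnj (hamiltonian bc L (columns_proj c r U1) (columns_proj c r U2) \<sigma> \<tau>)"
proof -
  have sym: "columns_proj c r U $ p $ p' = columns_proj c r U $ p' $ p" for U :: "real^('d \<times> 'd)^('d \<times> 'd)" and p p'
    by (simp add: columns_proj_def mult.commute)
  have "bond_term (columns_proj c r U) x y \<tau> \<sigma> = cnj (bond_term (columns_proj c r U) x y \<sigma> \<tau>)"
    for U :: "real^('d \<times> 'd)^('d \<times> 'd)" and x y
    using sym by (auto simp: bond_term_def)
  then show ?thesis by (simp add: hamiltonian_def split_def)
qed

lemma continuous_on_if_const:
  "continuous_on S f \<Longrightarrow> continuous_on S g \<Longrightarrow> continuous_on S (\<lambda>x. if P then f x else g x)"
  by (cases P) auto

lemma continuous_hamiltonian:
  "continuous_on UNIV (\<lambda>p :: (real^('d::finite \<times> 'd)^('d \<times> 'd)) \<times> (real^('d \<times> 'd)^('d \<times> 'd)).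
     hamiltonian bc L (columns_proj c r (fst p)) (columns_proj c r (snd p)) \<sigma> \<tau>)"
  unfolding hamiltonian_def bond_term_def columns_proj_def split_def Finite_Cartesian_Product.column_def
  by (intro continuous_on_add continuous_on_sum continuous_on_if_const continuous_intros)

text \<open>The existential quantifier over \<psi> is handled by compactness of the unit sphere.
  Since \<open>columns_proj\<close> is polynomial in its matrix and always symmetric, the set is
  closed in the space of all pairs of matrices.\<close>

lemma closed_low_entropy_ground_state:
  "closed {p :: (real^('d::finite \<times> 'd)^('d \<times> 'd)) \<times> (real^('d \<times> 'd)^('d \<times> 'd)).
     \<exists>\<psi> :: (int \<times> int \<Rightarrow> 'd) \<Rightarrow> complex.
       normalized_on (configs (lattice_box L)) \<psi> \<and>
       ground_state (mat_on (configs (lattice_box L))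
         (hamiltonian bc L (columns_proj c r (fst p)) (columns_proj c r (snd p))))
         (vec_on (configs (lattice_box L)) \<psi>) \<and>
       entanglement_entropy L \<psi> \<le> K}"
  (is "closed {p. \<exists>\<psi>. ?P p \<psi>}")
  unfolding closed_sequential_limits mem_Collect_eq
proof (intro allI impI, elim conjE)
  fix x p assume "\<forall>m :: nat. \<exists>\<psi>. ?P (x m) \<psi>" and x: "x \<longlonglongrightarrow> p"
  then obtain \<psi> where \<psi>: "\<And>m. ?P (x m) (\<psi> m)" by metis
  let ?I = "configs (lattice_box L) :: (int \<times> int \<Rightarrow> 'd) set"
  let ?H = "\<lambda>p. hamiltonian bc L (columns_proj c r (fst p)) (columns_proj c r (snd p))"
  have "\<exists>s \<psi>'. strict_mono s \<and> (\<forall>\<sigma>\<in>?I. (\<lambda>m. \<psi> (s m) \<sigma>) \<longlonglongrightarrow> \<psi>' \<sigma>) \<and>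
    normalized_on ?I \<psi>' \<and> ground_state (mat_on ?I (?H p)) (vec_on ?I \<psi>')"
  proof (rule ground_state_limit[where A = "\<lambda>m. ?H (x m)"])
    show "(\<lambda>m. ?H (x m) \<sigma> \<tau>) \<longlonglongrightarrow> ?H p \<sigma> \<tau>" for \<sigma> \<tau>
      using continuous_on_tendsto_compose[OF continuous_hamiltonian x] by simp
    show "?H (x m) \<tau> \<sigma> = cnj (?H (x m) \<sigma> \<tau>)" for m \<sigma> \<tau> by (rule hamiltonian_hermitian)
  qed (use \<psi> finite_configs[OF finite_lattice_box] in auto)
  then obtain s \<psi>' where s: "\<And>\<sigma>. \<sigma> \<in> ?I \<Longrightarrow> (\<lambda>m. \<psi> (s m) \<sigma>) \<longlonglongrightarrow> \<psi>' \<sigma>"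
    and *: "normalized_on ?I \<psi>'" "ground_state (mat_on ?I (?H p)) (vec_on ?I \<psi>')" by blast
  have "entanglement_entropy L \<psi>' \<le> K"
    by (rule entanglement_entropy_limit[OF s]) (use \<psi> in auto)
  then show "\<exists>\<psi>. ?P p \<psi>" using * by blast
qed


section \<open>Positivity of the Haar measure on open sets\<close>

lemma continuous_on_matrix_mult:
  fixes f :: "'x::topological_space \<Rightarrow> real^'n^'m" and g :: "'x \<Rightarrow> real^'k^'n"
  assumes "continuous_on S f" "continuous_on S g"
  shows "continuous_on S (\<lambda>x. f x ** g x)"
  unfolding matrix_matrix_mult_def by (intro continuous_intros assms)

lemma compact_orthogonal_matrices: "compact {U :: real^'n^'n. orthogonal_matrix U}"
proof -
  have "continuous_on UNIV (\<lambda>U :: real^'n^'n. Finite_Cartesian_Product.transpose U ** U)"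
    unfolding Finite_Cartesian_Product.transpose_def
    by (intro continuous_on_matrix_mult continuous_intros)
  then have "closed {U :: real^'n^'n. Finite_Cartesian_Product.transpose U ** U = Finite_Cartesian_Product.mat 1}"
    by (intro closed_Collect_eq continuous_intros)
  moreover have "bounded {U :: real^'n^'n. orthogonal_matrix U}"
    unfolding bounded_iff
  proof (intro exI ballI)
    fix U :: "real^'n^'n" assume "U \<in> {U. orthogonal_matrix U}"
    then have "norm (Finite_Cartesian_Product.row i U) = 1" for i
      by (simp add: orthogonal_matrix_orthonormal_rows)
    then have "norm (U $ i) = 1" for i by (simp add: Finite_Cartesian_Product.row_def)
    moreover have "norm U \<le> (\<Sum>i\<in>UNIV. norm (U $ i))"
      unfolding norm_vec_def by (rule L2_set_le_sum) auto
    ultimately show "norm U \<le> real CARD('n)" by simp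
  qed
  ultimately show ?thesis
    by (simp add: compact_eq_bounded_closed orthogonal_matrix)
qed

text \<open>If \<open>N\<close> were a null set, so would be its preimages under left
  multiplications by orthogonal matrices. Finitely many of these preimages cover the orthogonal
  group, which has full measure.\<close>

lemma haar_orthogonal_open_pos:
  fixes \<mu> :: "(real^'n^'n) measure"
  assumes haar: "haar_orthogonal \<mu>" and N: "open N" and U0: "U0 \<in> N" "orthogonal_matrix U0"
  shows "0 < measure \<mu> N"
proof (rule ccontr)
  assume "\<not> 0 < measure \<mu> N"
  then have m0: "measure \<mu> N = 0" using measure_nonneg[of \<mu> N] by linarith
  interpret prob_space \<mu> using haar by (simp add: haar_orthogonal_def)
  have sets: "sets \<mu> = sets borel" and inv: "\<And>V. orthogonal_matrix V \<Longrightarrow> distr \<mu> \<mu> (\<lambda>U. V ** U) = \<mu>"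
    and orth: "AE U in \<mu>. orthogonal_matrix U"
    using haar by (auto simp: haar_orthogonal_def)
  have sp: "space \<mu> = UNIV" using sets_eq_imp_space_eq[OF sets] by simp
  \<comment> \<open>Left multiplication by \<open>W V\<close> carries an orthogonal \<open>V\<close>
    to \<open>U0\<close>, so \<open>V\<close> lies in the preimage \<open>NV V\<close>, and these
    sets form an open cover.\<close>
  define W where "W V = U0 ** Finite_Cartesian_Product.transpose V" for V :: "real^'n^'n"
  define NV where "NV V = (\<lambda>U. W V ** U) -` N" for V
  have cont: "continuous_on UNIV (\<lambda>U. W V ** U)" for V
    by (intro continuous_on_matrix_mult continuous_intros)
  have opn: "open (NV V)" for V
    unfolding NV_def using open_vimage[OF N cont] .
  have null: "NV V \<in> null_sets \<mu>" if V: "orthogonal_matrix V" for V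
  proof -
    have "orthogonal_matrix (W V)"
      unfolding W_def using U0(2) V by (intro orthogonal_matrix_mul) simp_all
    then have "emeasure \<mu> N = emeasure (distr \<mu> \<mu> (\<lambda>U. W V ** U)) N" using inv by simp
    also have "\<dots> = emeasure \<mu> ((\<lambda>U. W V ** U) -` N \<inter> space \<mu>)"
    proof (rule emeasure_distr)
      have "(\<lambda>U. W V ** U) \<in> borel_measurable borel"
        using cont by (rule borel_measurable_continuous_onI)
      then show "(\<lambda>U. W V ** U) \<in> measurable \<mu> \<mu>" using sets by (simp cong: measurable_cong_sets)
      show "N \<in> sets \<mu>" using N sets by simp
    qed
    finally have "emeasure \<mu> (NV V) = 0" using m0 by (simp add: NV_def sp emeasure_eq_measure)
    then show ?thesis using opn[of V] sets by (simp add: null_sets_def)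
  qed
  let ?O = "{U :: real^'n^'n. orthogonal_matrix U}"
  have cover: "?O \<subseteq> (\<Union>V\<in>?O. NV V)"
  proof
    fix V assume "V \<in> ?O"
    then have V: "orthogonal_matrix V" by simp
    have "W V ** V = U0 ** (Finite_Cartesian_Product.transpose V ** V)"
      unfolding W_def by (simp add: matrix_mul_assoc)
    also have "\<dots> = U0" using V by (simp add: orthogonal_matrix)
    finally have "V \<in> NV V" using U0 by (simp add: NV_def)
    then show "V \<in> (\<Union>V\<in>?O. NV V)" using V by blast
  qed
  obtain C where C: "C \<subseteq> ?O" "finite C" "?O \<subseteq> (\<Union>V\<in>C. NV V)"
    by (rule compactE_image[OF compact_orthogonal_matrices _ cover]) (use opn in auto)
  have "(\<Union>V\<in>C. NV V) \<in> null_sets \<mu>"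
    using C null by (intro null_sets_UN') (auto intro: countable_finite)
  then have "AE U in \<mu>. U \<notin> (\<Union>V\<in>C. NV V)" by (rule AE_not_in)
  with orth have "AE U in \<mu>. False" by eventually_elim (use C in blast)
  then show False by simp
qed


section \<open>The lattice Hamiltonian\<close>

definition lattice_bonds :: "boundary \<Rightarrow> nat \<Rightarrow> (bool \<times> (int \<times> int) \<times> (int \<times> int)) set" where
  "lattice_bonds bc L = Pair False ` bonds bc L (1, 0) \<union> Pair True ` bonds bc L (0, 1)"

definition cyclic_succ :: "nat \<Rightarrow> int \<Rightarrow> int" where
  "cyclic_succ L z = (if z = int L then 1 - int L else z + 1)"

text \<open>Serves both boundary conditions: the open bonds are those cyclic ones that do not wrap
  around.\<close>

definition neighbour :: "nat \<Rightarrow> bool \<Rightarrow> int \<times> int \<Rightarrow> int \<times> int" where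
  "neighbour L i x = (if i then (fst x, cyclic_succ L (snd x)) else (cyclic_succ L (fst x), snd x))"

lemma wrap_id: "z \<in> {- int L<..int L} \<Longrightarrow> wrap L z = z"
  unfolding wrap_def by (subst mod_pos_pos_trivial) auto

lemma wrap_succ:
  assumes "z \<in> {- int L<..int L}" shows "wrap L (z + 1) = cyclic_succ L z"
proof (cases "z = int L")
  case True
  have "wrap L (z + 1) = (2 * int L) mod (2 * int L) - int L + 1" unfolding wrap_def True by (simp add: algebra_simps)
  then show ?thesis using True by (simp add: cyclic_succ_def)
next
  case False
  then show ?thesis using assms by (subst wrap_id) (auto simp: cyclic_succ_def)
qed

lemma cyclic_succ_mem: "z \<in> {- int L<..int L} \<Longrightarrow> cyclic_succ L z \<in> {- int L<..int L}"
  by (auto simp: cyclic_succ_def)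

lemma neighbour_mem: "x \<in> lattice_box L \<Longrightarrow> neighbour L i x \<in> lattice_box L"
  using cyclic_succ_mem by (auto simp: lattice_box_def neighbour_def)

lemma lattice_bondsD:
  assumes "(i, x, y) \<in> lattice_bonds bc L"
  shows "x \<in> lattice_box L" "y = neighbour L i x"
proof -
  define e :: "int \<times> int" where "e = (if i then (0, 1) else (1, 0))"
  have b: "(x, y) \<in> bonds bc L e" using assms by (auto simp: lattice_bonds_def e_def)
  have y: "x \<in> lattice_box L \<and> y = (wrap L (fst (x + e)), wrap L (snd (x + e)))"
  proof (cases bc)
    case Open
    then have "x \<in> lattice_box L" "y = x + e" "x + e \<in> lattice_box L" using b by (auto simp: bonds_def)
    then show ?thesis using wrap_id[of "fst (x + e)" L] wrap_id[of "snd (x + e)" L]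
      by (simp add: lattice_box_def mem_Times_iff prod_eq_iff)
  qed (use b in \<open>auto simp: bonds_def\<close>)
  then show "x \<in> lattice_box L" by simp
  then have "fst x \<in> {- int L<..int L}" "snd x \<in> {- int L<..int L}" by (auto simp: lattice_box_def)
  then show "y = neighbour L i x" using y wrap_succ wrap_id
    by (simp add: neighbour_def e_def)
qed

lemma lattice_bonds_subset:
  "lattice_bonds bc L \<subseteq> (\<lambda>(i, x). (i, x, neighbour L i x)) ` (UNIV \<times> lattice_box L)"
  using lattice_bondsD by (force simp: image_iff)

lemma finite_lattice_bonds: "finite (lattice_bonds bc L)"
  by (rule finite_subset[OF lattice_bonds_subset]) (intro finite_imageI finite_cartesian_product finite finite_lattice_box)

lemma card_lattice_box: "card (lattice_box L) = 4 * L\<^sup>2"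
proof -
  have "card (lattice_box L) = card {- int L<..int L} * card {- int L<..int L}"
    unfolding lattice_box_def by (rule card_cartesian_product)
  also have "card {- int L<..int L} = 2 * L" by simp
  finally show ?thesis by (simp add: power2_eq_square)
qed

lemma card_lattice_bonds: "card (lattice_bonds bc L) \<le> 8 * L\<^sup>2"
proof -
  have "card (lattice_bonds bc L) \<le> card ((UNIV :: bool set) \<times> lattice_box L)"
    using lattice_bonds_subset finite_lattice_box
    by (intro surj_card_le[where f = "\<lambda>(i, x). (i, x, neighbour L i x)"]) auto
  then show ?thesis by (simp add: card_cartesian_product card_lattice_box card_UNIV_bool)
qed

text \<open>Only horizontal bonds change the half: those from first coordinate 0 to 1 and, with
  periodic boundary, those from \<open>L\<close> to \<open>1 - L\<close>. Each column has
  \<open>2 * L\<close> sites.\<close>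

lemma card_crossing_lattice_bonds:
  "card {c \<in> lattice_bonds bc L. \<not> sites c \<subseteq> left_half L \<and> \<not> sites c \<subseteq> - left_half L} \<le> 4 * L"
proof -
  let ?X = "{0, int L} \<times> {- int L<..int L}"
  have "{c \<in> lattice_bonds bc L. \<not> sites c \<subseteq> left_half L \<and> \<not> sites c \<subseteq> - left_half L}
    \<subseteq> (\<lambda>x. (False, x, neighbour L False x)) ` ?X"
  proof
    fix c assume c: "c \<in> {c \<in> lattice_bonds bc L. \<not> sites c \<subseteq> left_half L \<and> \<not> sites c \<subseteq> - left_half L}"
    obtain i x y where cx: "c = (i, x, y)" by (cases c) blast
    then have x: "x \<in> lattice_box L" and y: "y = neighbour L i x"
      using c lattice_bondsD[of i x y bc L] by auto
    have yb: "y \<in> lattice_box L" using neighbour_mem[OF x] y by simp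
    have ne: "(x \<in> left_half L) \<noteq> (y \<in> left_half L)" using c cx by auto
    then have "(fst x \<le> 0) \<noteq> (fst y \<le> 0)" using x yb by (auto simp: left_half_def)
    then have "\<not> i \<and> (fst x = 0 \<or> fst x = int L)"
      using y x by (auto simp: neighbour_def cyclic_succ_def lattice_box_def split: if_splits)
    moreover have "snd x \<in> {- int L<..int L}" using x by (auto simp: lattice_box_def)
    ultimately have "x \<in> ?X" "c = (False, x, neighbour L False x)" using cx y by (auto simp: mem_Times_iff)
    then show "c \<in> (\<lambda>x. (False, x, neighbour L False x)) ` ?X" by blast
  qed
  then have "card {c \<in> lattice_bonds bc L. \<not> sites c \<subseteq> left_half L \<and> \<not> sites c \<subseteq> - left_half L} \<le> card ?X"
    by (intro surj_card_le) auto
  also have "\<dots> = card {0, int L} * card {- int L<..int L}" by (rule card_cartesian_product)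
  also have "\<dots> \<le> 2 * (2 * L)"
  proof (rule mult_le_mono)
    show "card {0, int L} \<le> 2" by (simp add: card_insert_if)
    show "card {- int L<..int L} \<le> 2 * L" by simp
  qed
  finally show ?thesis by simp
qed

lemma lattice_bonds_unique:
  assumes "1 \<le> L"
  shows "(i, x, y) \<in> lattice_bonds bc L \<Longrightarrow> x \<noteq> y"
    and "(i, x, y) \<in> lattice_bonds bc L \<Longrightarrow> (i, x, y') \<in> lattice_bonds bc L \<Longrightarrow> y = y'"
    and "(i, x, y) \<in> lattice_bonds bc L \<Longrightarrow> (i, x', y) \<in> lattice_bonds bc L \<Longrightarrow> x = x'"
proof -
  have neq: "cyclic_succ L z \<noteq> z" for z using assms by (auto simp: cyclic_succ_def)
  have inj: "z = z'" if "cyclic_succ L z = cyclic_succ L z'" "z \<in> {- int L<..int L}" "z' \<in> {- int L<..int L}" for z z'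
    using that by (auto simp: cyclic_succ_def split: if_splits)
  show "x \<noteq> y" if "(i, x, y) \<in> lattice_bonds bc L"
    using lattice_bondsD[OF that] neq[of "fst x"] neq[of "snd x"] by (auto simp: neighbour_def prod_eq_iff)
  show "y = y'" if "(i, x, y) \<in> lattice_bonds bc L" "(i, x, y') \<in> lattice_bonds bc L"
    using lattice_bondsD(2)[OF that(1)] lattice_bondsD(2)[OF that(2)] by simp
  show "x = x'" if "(i, x, y) \<in> lattice_bonds bc L" "(i, x', y) \<in> lattice_bonds bc L"
  proof -
    have "neighbour L i x = neighbour L i x'" using lattice_bondsD(2)[OF that(1)] lattice_bondsD(2)[OF that(2)] by simp
    moreover have "fst x \<in> {- int L<..int L}" "snd x \<in> {- int L<..int L}" "fst x' \<in> {- int L<..int L}" "snd x' \<in> {- int L<..int L}"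
      using lattice_bondsD(1)[OF that(1)] lattice_bondsD(1)[OF that(2)] by (auto simp: lattice_box_def)
    ultimately show ?thesis using inj[of "fst x" "fst x'"] inj[of "snd x" "snd x'"]
      by (cases i) (simp_all add: neighbour_def prod_eq_iff)
  qed
qed

lemma hamiltonian_eq_sum:
  "hamiltonian bc L P1 P2 \<sigma> \<tau> = (\<Sum>(i, x, y)\<in>lattice_bonds bc L. bond_term (if i then P2 else P1) x y \<sigma> \<tau>)"
proof -
  have fin: "finite (Pair False ` bonds bc L (1, 0))" "finite (Pair True ` bonds bc L (0, 1))"
    using finite_lattice_bonds[of bc L] unfolding lattice_bonds_def by (meson finite_Un)+
  have "(\<Sum>(i, x, y)\<in>lattice_bonds bc L. bond_term (if i then P2 else P1) x y \<sigma> \<tau>) =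
     (\<Sum>(i, x, y)\<in>Pair False ` bonds bc L (1, 0). bond_term (if i then P2 else P1) x y \<sigma> \<tau>) +
     (\<Sum>(i, x, y)\<in>Pair True ` bonds bc L (0, 1). bond_term (if i then P2 else P1) x y \<sigma> \<tau>)"
    unfolding lattice_bonds_def using fin by (intro sum.union_disjoint) auto
  then show ?thesis unfolding hamiltonian_def
    by (simp add: sum.reindex inj_on_def split_def)
qed

section \<open>Single bond terms\<close>

context
  fixes L :: nat and x y :: "int \<times> int"
  assumes xy: "x \<in> lattice_box L" "y \<in> lattice_box L" "x \<noteq> y"
begin

lemma upd_in_configs:
  "\<sigma> \<in> configs (lattice_box L) \<Longrightarrow> \<sigma>(x := k, y := l) \<in> configs (lattice_box L)"
  using xy by (auto simp: configs_def PiE_iff extensional_def)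

lemma bond_term_sum:
  fixes P :: "real^('d::finite \<times> 'd)^('d \<times> 'd)"
  assumes \<sigma>: "\<sigma> \<in> configs (lattice_box L)"
  shows "(\<Sum>\<tau>\<in>configs (lattice_box L). bond_term P x y \<sigma> \<tau> * \<psi> \<tau>) =
    (\<Sum>p\<in>UNIV. of_real (P $ (\<sigma> x, \<sigma> y) $ p) * \<psi> (\<sigma>(x := fst p, y := snd p)))"
proof -
  let ?I = "configs (lattice_box L) :: (int \<times> int \<Rightarrow> 'd) set"
  let ?J = "{\<tau> \<in> ?I. \<forall>z. z \<noteq> x \<and> z \<noteq> y \<longrightarrow> \<sigma> z = \<tau> z}"
  have "(\<Sum>\<tau>\<in>?I. bond_term P x y \<sigma> \<tau> * \<psi> \<tau>) = (\<Sum>\<tau>\<in>?J. of_real (P $ (\<sigma> x, \<sigma> y) $ (\<tau> x, \<tau> y)) * \<psi> \<tau>)"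
    using finite_configs[OF finite_lattice_box]
    by (intro sum.mono_neutral_cong_right) (auto simp: bond_term_def)
  also have "\<dots> = (\<Sum>p\<in>UNIV. of_real (P $ (\<sigma> x, \<sigma> y) $ p) * \<psi> (\<sigma>(x := fst p, y := snd p)))"
  proof (rule sum.reindex_bij_witness[of _ "\<lambda>p. \<sigma>(x := fst p, y := snd p)" "\<lambda>\<tau>. (\<tau> x, \<tau> y)"])
    fix \<tau> assume "\<tau> \<in> ?J"
    then show "\<sigma>(x := fst (\<tau> x, \<tau> y), y := snd (\<tau> x, \<tau> y)) = \<tau>" by (auto simp: fun_eq_iff)
    then show "of_real (P $ (\<sigma> x, \<sigma> y) $ (\<tau> x, \<tau> y)) * \<psi> (\<sigma>(x := fst (\<tau> x, \<tau> y), y := snd (\<tau> x, \<tau> y))) =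
      of_real (P $ (\<sigma> x, \<sigma> y) $ (\<tau> x, \<tau> y)) * \<psi> \<tau>" by simp
  next
    fix p :: "'d \<times> 'd"
    show "\<sigma>(x := fst p, y := snd p) \<in> ?J" using upd_in_configs[OF \<sigma>] by auto
    show "((\<sigma>(x := fst p, y := snd p)) x, (\<sigma>(x := fst p, y := snd p)) y) = p" using xy(3) by simp
  qed simp
  finally show ?thesis .
qed

text \<open>The projection is a sum of outer products of columns, indexed by \<open>k\<close>, and
  the identity on the other sites is one over configurations with the labels at \<open>x\<close> and
  \<open>y\<close> erased, indexed by \<open>\<eta>\<close>. The fixed label
  \<open>undefined\<close> marks the erased sites.\<close>

lemma bond_term_gram:
  fixes U :: "real^('d::finite \<times> 'd)^('d \<times> 'd)"
  assumes "\<sigma> \<in> configs (lattice_box L)" "\<tau> \<in> configs (lattice_box L)"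
  shows "bond_term (columns_proj c r U) x y \<sigma> \<tau> =
    (\<Sum>\<eta>\<in>configs (lattice_box L). \<Sum>k<r.
       (if \<eta> = \<sigma>(x := undefined, y := undefined) then of_real (U $ (\<sigma> x, \<sigma> y) $ c k) else 0) *
       cnj (if \<eta> = \<tau>(x := undefined, y := undefined) then of_real (U $ (\<tau> x, \<tau> y) $ c k) else 0))"
proof -
  let ?u = "\<lambda>\<sigma>. \<sigma>(x := undefined, y := undefined)"
  have eq: "(\<forall>z. z \<noteq> x \<and> z \<noteq> y \<longrightarrow> \<sigma> z = \<tau> z) \<longleftrightarrow> ?u \<sigma> = ?u \<tau>" by (auto simp: fun_eq_iff)
  have "(\<Sum>\<eta>\<in>configs (lattice_box L). \<Sum>k<r.
       (if \<eta> = ?u \<sigma> then complex_of_real (U $ (\<sigma> x, \<sigma> y) $ c k) else 0) *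
       cnj (if \<eta> = ?u \<tau> then of_real (U $ (\<tau> x, \<tau> y) $ c k) else 0)) =
     (\<Sum>\<eta>\<in>configs (lattice_box L). if \<eta> = ?u \<sigma> then (if ?u \<sigma> = ?u \<tau> then
        \<Sum>k<r. complex_of_real (U $ (\<sigma> x, \<sigma> y) $ c k) * of_real (U $ (\<tau> x, \<tau> y) $ c k) else 0) else 0)"
    by (intro sum.cong) auto
  also have "\<dots> = (if ?u \<sigma> = ?u \<tau> then \<Sum>k<r. complex_of_real (U $ (\<sigma> x, \<sigma> y) $ c k) * of_real (U $ (\<tau> x, \<tau> y) $ c k) else 0)"
    using upd_in_configs[OF assms(2)] by (auto simp: finite_configs finite_lattice_box)
  also have "\<dots> = bond_term (columns_proj c r U) x y \<sigma> \<tau>"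
    unfolding bond_term_def eq columns_proj_def Finite_Cartesian_Product.column_def by simp
  finally show ?thesis by simp
qed

end

text \<open>The Hamiltonian is a sum of Gram matrices, so its eigenvalues are nonnegative. A vector
  orthogonal to the chosen columns at every bond is annihilated by every term and thus attains the
  energy 0.\<close>

lemma annihilated_ground_state:
  fixes U1 U2 :: "real^('d::finite \<times> 'd)^('d \<times> 'd)" and \<psi> :: "(int \<times> int \<Rightarrow> 'd) \<Rightarrow> complex"
  assumes L: "1 \<le> L"
    and nz: "\<exists>\<sigma>\<in>configs (lattice_box L). \<psi> \<sigma> \<noteq> 0"
    and ann: "\<And>i x y \<sigma> k. (i, x, y) \<in> lattice_bonds bc L \<Longrightarrow> \<sigma> \<in> configs (lattice_box L) \<Longrightarrow> k < r \<Longrightarrow>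
      (\<Sum>p\<in>UNIV. of_real ((if i then U2 else U1) $ p $ c k) * \<psi> (\<sigma>(x := fst p, y := snd p))) = 0"
  shows "ground_state (mat_on (configs (lattice_box L)) (hamiltonian bc L (columns_proj c r U1) (columns_proj c r U2)))
    (vec_on (configs (lattice_box L)) \<psi>)"
proof -
  let ?I = "configs (lattice_box L) :: (int \<times> int \<Rightarrow> 'd) set"
  let ?H = "hamiltonian bc L (columns_proj c r U1) (columns_proj c r U2)"
  let ?B = "lattice_bonds bc L"
  have I: "finite ?I" by (rule finite_configs[OF finite_lattice_box])
  have box: "x \<in> lattice_box L" "y \<in> lattice_box L" "x \<noteq> y" if "(i, x, y) \<in> ?B" for i x y
    using lattice_bondsD[OF that] neighbour_mem lattice_bonds_unique(1)[OF L that] by auto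
  have proj: "(if i then columns_proj c r U2 else columns_proj c r U1) = columns_proj c r (if i then U2 else U1)" for i
    by simp
  obtain u e where d: "diag_on (card ?I) (indexed ?I ?H) u e"
    using ex_diag_on[of "card ?I" "indexed ?I ?H"] hamiltonian_hermitian by metis
  have H0: "(\<Sum>\<tau>\<in>?I. ?H \<sigma> \<tau> * \<psi> \<tau>) = 0" if \<sigma>: "\<sigma> \<in> ?I" for \<sigma>
  proof -
    have "(\<Sum>\<tau>\<in>?I. bond_term (columns_proj c r (if i then U2 else U1)) x y \<sigma> \<tau> * \<psi> \<tau>) = 0" if b: "(i, x, y) \<in> ?B" for i x y
    proof -
      let ?U = "if i then U2 else U1"
      have "(\<Sum>\<tau>\<in>?I. bond_term (columns_proj c r ?U) x y \<sigma> \<tau> * \<psi> \<tau>) =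
        (\<Sum>p\<in>UNIV. of_real (columns_proj c r ?U $ (\<sigma> x, \<sigma> y) $ p) * \<psi> (\<sigma>(x := fst p, y := snd p)))"
        by (rule bond_term_sum[OF box[OF b] \<sigma>])
      also have "\<dots> = (\<Sum>p\<in>UNIV. \<Sum>k<r. of_real (?U $ (\<sigma> x, \<sigma> y) $ c k) * (of_real (?U $ p $ c k) * \<psi> (\<sigma>(x := fst p, y := snd p))))"
        by (simp add: columns_proj_def Finite_Cartesian_Product.column_def sum_distrib_right mult.assoc)
      also have "\<dots> = (\<Sum>k<r. of_real (?U $ (\<sigma> x, \<sigma> y) $ c k) * (\<Sum>p\<in>UNIV. of_real (?U $ p $ c k) * \<psi> (\<sigma>(x := fst p, y := snd p))))"
        by (subst sum.swap) (simp only: sum_distrib_left)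
      also have "\<dots> = 0" using ann[OF b \<sigma>] by (intro sum.neutral) simp
      finally show ?thesis .
    qed
    then have "(\<Sum>b\<in>?B. \<Sum>\<tau>\<in>?I. (case b of (i, x, y) \<Rightarrow> bond_term (columns_proj c r (if i then U2 else U1)) x y \<sigma> \<tau> * \<psi> \<tau>)) = 0"
      by (intro sum.neutral) auto
    then show ?thesis
      unfolding hamiltonian_eq_sum proj sum_distrib_right by (subst sum.swap) (simp add: split_def)
  qed
  have "0 \<le> e k" if k: "k < card ?I" for k
  proof (rule diag_on_gram_nonneg[OF d k])
    fix i j assume ij: "i < card ?I" "j < card ?I"
    let ?f = "from_nat_into ?I"
    let ?\<phi> = "\<lambda>i ((s, x, y), \<eta>, k). if \<eta> = (?f i)(x := undefined, y := undefined) then complex_of_real ((if s then U2 else U1) $ (?f i x, ?f i y) $ c k) else 0"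
    have "indexed ?I ?H i j = (\<Sum>b\<in>?B. \<Sum>\<eta>\<in>?I. \<Sum>k<r. ?\<phi> i (b, \<eta>, k) * cnj (?\<phi> j (b, \<eta>, k)))"
      unfolding hamiltonian_eq_sum proj
    proof (rule sum.cong[OF refl])
      fix b assume b: "b \<in> ?B"
      obtain s x y where bx: "b = (s, x, y)" by (cases b) blast
      show "(case b of (s, x, y) \<Rightarrow> bond_term (columns_proj c r (if s then U2 else U1)) x y (?f i) (?f j)) =
        (\<Sum>\<eta>\<in>?I. \<Sum>k<r. ?\<phi> i (b, \<eta>, k) * cnj (?\<phi> j (b, \<eta>, k)))"
        unfolding bx prod.case using bond_term_gram[OF box[of s x y] from_nat_into_mem[OF ij(1)] from_nat_into_mem[OF ij(2)]] b bx
        by simp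
    qed
    then show "indexed ?I ?H i j = (\<Sum>\<omega>\<in>?B \<times> ?I \<times> {..<r}. ?\<phi> i \<omega> * cnj (?\<phi> j \<omega>))"
      by (simp only: sum.cartesian_product split_def fst_conv snd_conv prod.collapse)
  qed
  then show ?thesis unfolding ground_state_on_iff[OF I d] using nz H0 by (intro exI[of _ 0]) simp
qed


section \<open>Projections near a Householder reflection\<close>

lemma inj_on_extends_to_bij:
  fixes f :: "'n::finite \<Rightarrow> 'n"
  assumes "inj_on f E"
  shows "\<exists>p. bij p \<and> (\<forall>x\<in>E. p x = f x)"
proof -
  have "card (- E) = card (- f ` E)"
    using card_image[OF assms] by (simp add: Compl_eq_Diff_UNIV card_Diff_subset)
  then obtain h where h: "bij_betw h (- E) (- f ` E)"
    using finite_same_card_bij[of "- E" "- f ` E"] by auto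
  define p where "p x = (if x \<in> E then f x else h x)" for x
  have "bij_betw p E (f ` E)" using assms by (auto simp: bij_betw_def p_def inj_on_def)
  moreover have "bij_betw p (- E) (- f ` E)" using h bij_betw_cong[of "- E" p h] by (simp add: p_def)
  ultimately have "bij_betw p (E \<union> - E) (f ` E \<union> - f ` E)" by (intro bij_betw_combine) auto
  then show ?thesis by (intro exI[of _ p]) (simp add: p_def)
qed

text \<open>Column \<open>j\<close> is column \<open>p j\<close> of the reflection in the hyperplane
  orthogonal to \<open>w\<close>; a permutation of columns keeps them orthonormal.\<close>

lemma householder_orthogonal:
  fixes w :: "'n::finite \<Rightarrow> real"
  assumes p: "bij p" and w: "(\<Sum>i\<in>UNIV. (w i)\<^sup>2) \<noteq> 0"
  shows "orthogonal_matrix (\<chi> i j. (if i = p j then 1 else 0) - 2 / (\<Sum>i\<in>UNIV. (w i)\<^sup>2) * w i * w (p j) :: real^'n^'n)"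
proof -
  define S where "S = (\<Sum>i\<in>UNIV. (w i)\<^sup>2)"
  have pinj: "p j = p l \<longleftrightarrow> j = l" for j l using p by (auto simp: bij_def inj_def)
  have "(\<Sum>i\<in>UNIV. ((if i = p j then 1 else 0) - 2 / S * w i * w (p j)) * ((if i = p l then 1 else 0) - 2 / S * w i * w (p l)))
      = (if j = l then 1 else 0)" for j l
  proof -
    have "(\<Sum>i\<in>UNIV. ((if i = p j then 1 else 0) - 2 / S * w i * w (p j)) * ((if i = p l then 1 else 0) - 2 / S * w i * w (p l)))
      = (\<Sum>i\<in>UNIV. (if i = p j then (if i = p l then 1 else 0) - 2 / S * w i * w (p l) else 0)
          - (if i = p l then 2 / S * w i * w (p j) else 0) + 2 / S * w (p j) * (2 / S * w (p l)) * (w i)\<^sup>2)"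
      by (intro sum.cong) (auto simp: algebra_simps power2_eq_square)
    also have "\<dots> = (if p j = p l then 1 else 0) - 2 / S * w (p j) * w (p l) - 2 / S * w (p l) * w (p j)
        + 2 / S * w (p j) * (2 / S * w (p l)) * S"
      unfolding sum.distrib sum_subtractf
      by (simp only: sum_distrib_left[symmetric] S_def[symmetric]) simp
    also have "\<dots> = (if j = l then 1 else 0)" using w[folded S_def] by (simp add: pinj)
    finally show ?thesis .
  qed
  then show ?thesis
    unfolding orthogonal_matrix S_def[symmetric]
    by (simp add: Finite_Cartesian_Product.vec_eq_iff matrix_matrix_mult_def Finite_Cartesian_Product.transpose_def Finite_Cartesian_Product.mat_def)
qed

section \<open>Solving the orthogonality equations for the entries in \<open>E\<close>\<close>

context
  fixes E :: "'n::finite set" and p :: "'n \<Rightarrow> 'n"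
begin

text \<open>The columns \<open>p j\<close> for \<open>j \<in> E\<close>, filled up to a square
  matrix by unit vectors. It is invertible exactly when orthogonality of a vector to these columns
  can be solved uniquely for its entries in \<open>E\<close>.\<close>

definition completed :: "real^'n^'n \<Rightarrow> real^'n^'n" where
  "completed U = (\<chi> i j. if j \<in> E then U $ i $ p j else if i = j then 1 else 0)"

text \<open>By Cramer's rule, this is the inverse of \<^const>\<open>completed\<close> where the latter is invertible; the
  quotient makes its continuity evident.\<close>

definition solved :: "real^'n^'n \<Rightarrow> real^'n^'n" where
  "solved U = (\<chi> f e. Determinants.det (\<chi> i j. if j = f then axis e 1 $ i else completed U $ i $ j) / Determinants.det (completed U))"

lemma solved_unique:
  assumes "Determinants.det (completed U) \<noteq> 0" "completed U *v x = axis e 1"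
  shows "x $ f = solved U $ f $ e"
  using cramer[OF assms(1), of x "axis e 1"] assms(2) by (simp add: solved_def)

lemma completed_solved:
  assumes "Determinants.det (completed U) \<noteq> 0"
  shows "completed U ** solved U = Finite_Cartesian_Product.mat 1"
proof -
  have "completed U *v (\<chi> f. solved U $ f $ e) = axis e 1" for e
    using cramer[OF assms, of "\<chi> f. solved U $ f $ e" "axis e 1"] by (simp add: solved_def)
  then show ?thesis
    by (simp add: Finite_Cartesian_Product.vec_eq_iff matrix_matrix_mult_def matrix_vector_mult_def
        Finite_Cartesian_Product.mat_def axis_def)
qed

text \<open>For \<open>f\<close> outside \<open>E\<close>, row \<open>f\<close> of
  \<open>solved U ** completed U = 1\<close> says that column \<open>p j\<close> of \<open>U\<close>
  is orthogonal to the vector with entry 1 at \<open>f\<close>, the coefficients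
  \<open>solved U $ f $ e\<close> on \<open>E\<close>, and 0 elsewhere. By the equations for
  \<open>v\<close>, the vector \<open>v\<close> is a combination of these.\<close>

lemma annihilates_columns:
  assumes det: "Determinants.det (completed U) \<noteq> 0" and j: "j \<in> E"
    and v: "\<And>e. e \<in> E \<Longrightarrow> v e = (\<Sum>f\<in>- E. solved U $ f $ e * v f)"
  shows "(\<Sum>i\<in>UNIV. U $ i $ p j * v i) = 0"
proof -
  have inv: "solved U ** completed U = Finite_Cartesian_Product.mat 1"
    using completed_solved[OF det] by (simp add: matrix_left_right_inverse)
  have id: "solved U $ f $ f' = (if f = f' then 1 else 0)" if "f' \<notin> E" for f f'
  proof -
    have "completed U *v axis f' 1 = axis f' 1"
      using that unfolding matrix_vector_mult_basis
      by (auto simp: Finite_Cartesian_Product.vec_eq_iff Finite_Cartesian_Product.column_def completed_def axis_def)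
    then show ?thesis using solved_unique[OF det, of "axis f' 1" f' f] by (simp add: axis_def eq_commute)
  qed
  have key: "(\<Sum>e\<in>E. solved U $ f $ e * U $ e $ p j) + U $ f $ p j = 0" if f: "f \<notin> E" for f
  proof -
    have "0 = (solved U ** completed U) $ f $ j" using f j unfolding inv by (auto simp: Finite_Cartesian_Product.mat_def)
    also have "\<dots> = (\<Sum>i\<in>UNIV. solved U $ f $ i * U $ i $ p j)"
      using j by (simp add: matrix_matrix_mult_def completed_def)
    also have "\<dots> = (\<Sum>e\<in>E. solved U $ f $ e * U $ e $ p j) + (\<Sum>f'\<in>- E. solved U $ f $ f' * U $ f' $ p j)"
      by (subst sum.union_disjoint[symmetric]) auto
    also have "(\<Sum>f'\<in>- E. solved U $ f $ f' * U $ f' $ p j) = (\<Sum>f'\<in>- E. if f' = f then U $ f $ p j else 0)"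
      using id by (intro sum.cong) auto
    finally show ?thesis using f by simp
  qed
  have "(\<Sum>i\<in>UNIV. U $ i $ p j * v i) = (\<Sum>e\<in>E. U $ e $ p j * v e) + (\<Sum>f\<in>- E. U $ f $ p j * v f)"
    by (subst sum.union_disjoint[symmetric]) auto
  also have "(\<Sum>e\<in>E. U $ e $ p j * v e) = (\<Sum>e\<in>E. \<Sum>f\<in>- E. U $ e $ p j * (solved U $ f $ e * v f))"
    using v by (simp add: sum_distrib_left)
  also have "\<dots> = (\<Sum>f\<in>- E. \<Sum>e\<in>E. U $ e $ p j * (solved U $ f $ e * v f))" by (rule sum.swap)
  also have "\<dots> + (\<Sum>f\<in>- E. U $ f $ p j * v f) =
      (\<Sum>f\<in>- E. v f * ((\<Sum>e\<in>E. solved U $ f $ e * U $ e $ p j) + U $ f $ p j))"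
    unfolding sum.distrib[symmetric]
    by (rule sum.cong[OF refl]) (simp add: sum_distrib_left distrib_left mult_ac)
  also have "\<dots> = 0" using key by (intro sum.neutral) auto
  finally show ?thesis .
qed

lemma continuous_completed: "continuous_on UNIV (\<lambda>U. completed U $ i $ j)"
  unfolding completed_def
  by (simp only: vec_lambda_beta, intro continuous_on_if_const continuous_intros)

lemma continuous_det_completed: "continuous_on UNIV (\<lambda>U. Determinants.det (completed U))"
  unfolding Determinants.det_def by (intro continuous_intros continuous_completed)

lemma isCont_solved:
  assumes "Determinants.det (completed U) \<noteq> 0" shows "isCont (\<lambda>U. solved U $ f $ e) U"
proof -
  have "continuous_on UNIV (\<lambda>U. Determinants.det (\<chi> i j. if j = f then axis e 1 $ i else completed U $ i $ j))"
    unfolding Determinants.det_def by (simp only: vec_lambda_beta, intro continuous_intros continuous_on_if_const continuous_completed)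
  then have "isCont (\<lambda>U. Determinants.det (\<chi> i j. if j = f then axis e 1 $ i else completed U $ i $ j)) U"
    by (simp add: continuous_on_eq_continuous_at)
  moreover have "isCont (\<lambda>U. Determinants.det (completed U)) U"
    using continuous_det_completed by (simp add: continuous_on_eq_continuous_at)
  ultimately show ?thesis unfolding solved_def using assms by (simp add: continuous_intros)
qed

text \<open>Sherman--Morrison: for a Householder reflection, \<^const>\<open>completed\<close> is a rank-one perturbation of
  the identity.\<close>

lemma solved_householder:
  fixes w :: "'n \<Rightarrow> real"
  assumes U: "\<And>i j. j \<in> E \<Longrightarrow> U $ i $ p j = (if i = j then 1 else 0) - \<kappa> * w i * w j"
    and s: "1 - \<kappa> * (\<Sum>e\<in>E. (w e)\<^sup>2) \<noteq> 0"
  shows "Determinants.det (completed U) \<noteq> 0"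
    and "e \<in> E \<Longrightarrow> f \<notin> E \<Longrightarrow> solved U $ f $ e = \<kappa> * w e / (1 - \<kappa> * (\<Sum>e\<in>E. (w e)\<^sup>2)) * w f"
proof -
  define S where "S = (\<Sum>e\<in>E. (w e)\<^sup>2)"
  define t where "t j = (if j \<in> E then \<kappa> * w j / (1 - \<kappa> * S) else 0)" for j
  define Y :: "real^'n^'n" where "Y = (\<chi> i j. (if i = j then 1 else 0) + t j * w i)"
  have C: "completed U $ i $ j = (if i = j then 1 else 0) - (if j \<in> E then \<kappa> * w i * w j else 0)" for i j
    using U by (auto simp: completed_def)
  have tt: "t j - (if j \<in> E then \<kappa> * w j else 0) - \<kappa> * t j * S = 0" for j
  proof (cases "j \<in> E")
    case True
    have "t j * (1 - \<kappa> * S) = \<kappa> * w j" using s True by (simp add: t_def S_def)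
    then show ?thesis using True by (simp add: algebra_simps)
  qed (simp add: t_def)
  have CY: "completed U ** Y = Finite_Cartesian_Product.mat 1"
  proof -
    have "(\<Sum>l\<in>UNIV. completed U $ i $ l * Y $ l $ j) = (if i = j then 1 else 0)" for i j
    proof -
      have "(\<Sum>l\<in>UNIV. completed U $ i $ l * Y $ l $ j) =
         (\<Sum>l\<in>UNIV. (if l = i then (if i = j then 1 else 0) + t j * w i else 0) -
            (if l = j then if j \<in> E then \<kappa> * w i * w j else 0 else 0) - (if l \<in> E then \<kappa> * w i * t j * (w l)\<^sup>2 else 0))"
        unfolding C Y_def by (intro sum.cong) (auto simp: algebra_simps power2_eq_square)
      also have "\<dots> = (if i = j then 1 else 0) + t j * w i - (if j \<in> E then \<kappa> * w i * w j else 0) - \<kappa> * w i * t j * S"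
        by (simp add: sum_subtractf sum.If_cases S_def sum_distrib_left)
      also have "\<dots> = (if i = j then 1 else 0) + w i * (t j - (if j \<in> E then \<kappa> * w j else 0) - \<kappa> * t j * S)"
        by (simp add: algebra_simps)
      finally show ?thesis unfolding tt by simp
    qed
    then show ?thesis
      by (simp add: Finite_Cartesian_Product.vec_eq_iff matrix_matrix_mult_def Finite_Cartesian_Product.mat_def)
  qed
  then have "Determinants.det (completed U) * Determinants.det Y = 1" by (metis Determinants.det_mul Determinants.det_I)
  then show det: "Determinants.det (completed U) \<noteq> 0" by auto
  assume ef: "e \<in> E" "f \<notin> E"
  have "completed U *v (\<chi> i. Y $ i $ e) = axis e 1"
    using CY by (simp add: Finite_Cartesian_Product.vec_eq_iff matrix_matrix_mult_def matrix_vector_mult_def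
        Finite_Cartesian_Product.mat_def axis_def)
  from solved_unique[OF det this, of f] have "Y $ f $ e = solved U $ f $ e" by simp
  moreover have "f \<noteq> e" using ef by auto
  ultimately show "solved U $ f $ e = \<kappa> * w e / (1 - \<kappa> * (\<Sum>e\<in>E. (w e)\<^sup>2)) * w f"
    using ef by (simp add: Y_def t_def S_def)
qed

end

text \<open>The requirements of \<open>rewriting\<close> on the coefficients of one direction, with
  \<open>q = \<alpha> / 4\<close>, together with the fact that solutions of the substitution
  equations are orthogonal to the first \<open>r\<close> columns.\<close>

definition substitution_weights ::
  "'n::finite set \<Rightarrow> 'n \<Rightarrow> real \<Rightarrow> (nat \<Rightarrow> 'n) \<Rightarrow> nat \<Rightarrow> real^'n^'n \<Rightarrow> ('n \<Rightarrow> 'n \<Rightarrow> real) \<Rightarrow> bool" where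
  "substitution_weights E rest \<alpha> c r U a \<longleftrightarrow>
     (\<forall>e\<in>E. \<forall>f\<in>- E. 0 \<le> a e f) \<and> (\<forall>e\<in>E. (\<Sum>f\<in>- E. a e f) \<le> 1) \<and>
     (\<forall>e\<in>E. \<alpha> \<le> a e rest) \<and> (\<forall>e\<in>E. (\<Sum>f\<in>- E - {rest}. a e f) \<le> \<alpha> / 4 * \<alpha>) \<and>
     (\<forall>v. (\<forall>e\<in>E. v e = (\<Sum>f\<in>- E. a e f * v f)) \<longrightarrow> (\<forall>k<r. (\<Sum>i\<in>UNIV. U $ i $ c k * v i) = 0))"

text \<open>For a Householder reflection along \<open>w\<close> the solved coefficients are
  \<open>t * w f\<close>, so \<open>w\<close> prescribes the weights directly: 1 on the resting pair
  and a tiny positive value on the other pairs outside \<open>E\<close>. All requirements hold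
  strictly, hence also nearby.\<close>

lemma open_neighbourhood_coefficients:
  fixes c :: "nat \<Rightarrow> 'n::finite" and E :: "'n set"
  assumes c: "inj_on c {..<r}" and E: "card E = r" and rest: "rest \<notin> E"
    and \<alpha>: "\<alpha> = 1 / (8 * real CARD('n))"
  shows "\<exists>N U0. open N \<and> U0 \<in> N \<and> orthogonal_matrix U0 \<and>
    (\<forall>U :: real^'n^'n \<in> N. \<exists>a. substitution_weights E rest \<alpha> c r U a)"
proof -
  obtain g where g: "bij_betw g E {..<r}"
    using finite_same_card_bij[of E "{..<r}"] E by auto
  have "inj_on (c \<circ> g) E" using g c by (auto simp: bij_betw_def intro: comp_inj_on)
  then obtain p where p: "bij p" "\<And>e. e \<in> E \<Longrightarrow> p e = c (g e)"
    using inj_on_extends_to_bij[of "c \<circ> g" E] by auto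
  define n where "n = real CARD('n)"
  have n1: "1 \<le> n" unfolding n_def by (simp add: Suc_le_eq)
  \<comment> \<open>This \<theta> keeps \<open>r * \<theta>^2 \<le> 1/16\<close>, so that the scalar
    \<open>D\<close> in the denominator stays near 1 and \<open>t\<close> is between \<theta> and
    \<open>32/15 * \<theta>\<close>. With \<open>s\<close> of order \<open>1 / n^2\<close>, the
    weights away from rest sum to at most \<open>\<theta>^2 / 120\<close>, below the permitted
    \<open>\<alpha>^2 / 4 = \<theta>^2 / 16\<close>.\<close>
  define \<theta> where "\<theta> = 1 / (4 * n)"
  define s where "s = 1 / (1024 * n\<^sup>2)"
  define w where "w i = (if i \<in> E then \<theta> else if i = rest then 1 else s)" for i
  define K where "K = real (card (- E - {rest}))"
  have K0: "0 \<le> K" by (simp add: K_def)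
  have Kn: "K \<le> n" unfolding K_def n_def by (simp add: card_mono)
  have rn: "real r \<le> n" using E unfolding n_def by (metis card_mono finite of_nat_mono subset_UNIV)
  have SE: "(\<Sum>e\<in>E. (w e)\<^sup>2) = real r * \<theta>\<^sup>2" using E by (simp add: w_def)
  have split: "(\<Sum>i\<in>UNIV. h i) = (\<Sum>e\<in>E. h e) + h rest + (\<Sum>f\<in>- E - {rest}. h f)" for h :: "'n \<Rightarrow> real"
  proof -
    have "(\<Sum>i\<in>UNIV. h i) = (\<Sum>e\<in>E. h e) + (\<Sum>f\<in>- E. h f)" by (subst sum.union_disjoint[symmetric]) auto
    also have "(\<Sum>f\<in>- E. h f) = h rest + (\<Sum>f\<in>- E - {rest}. h f)" using rest by (intro sum.remove) auto
    finally show ?thesis by simp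
  qed
  define S where "S = (\<Sum>i\<in>UNIV. (w i)\<^sup>2)"
  have S: "S = real r * \<theta>\<^sup>2 + 1 + K * s\<^sup>2"
    unfolding S_def split SE using rest by (simp add: w_def K_def)
  have S0: "0 < S" unfolding S using K0 by (simp add: add_nonneg_pos add_pos_nonneg)
  define \<kappa> where "\<kappa> = 2 / S"
  \<comment> \<open>The Sherman--Morrison denominator multiplied by \<open>S\<close>; its value
    between \<open>15/16\<close> and 2 controls the size of \<open>t\<close>.\<close>
  define D where "D = 1 + K * s\<^sup>2 - real r * \<theta>\<^sup>2"
  have r\<theta>: "real r * \<theta>\<^sup>2 \<le> 1 / 16"
  proof -
    have "real r * \<theta>\<^sup>2 \<le> n * \<theta>\<^sup>2" using rn by (intro mult_right_mono) auto
    also have "\<dots> = 1 / (16 * n)" using n1 by (simp add: \<theta>_def power2_eq_square field_simps)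
    also have "\<dots> \<le> 1 / 16" using n1 by (simp add: field_simps)
    finally show ?thesis .
  qed
  have Ks: "K * s \<le> 1 / (1024 * n)"
  proof -
    have "K * s \<le> n * s" using Kn by (intro mult_right_mono) (auto simp: s_def)
    then show ?thesis using n1 by (simp add: s_def power2_eq_square field_simps)
  qed
  have s1: "0 < s" "s \<le> 1"
  proof -
    show "0 < s" using n1 by (simp add: s_def)
    have "1 \<le> n\<^sup>2" using n1 by simp
    then have "1 \<le> 1024 * n\<^sup>2" by simp
    then show "s \<le> 1" by (simp add: s_def divide_le_eq_1)
  qed
  have "1 / (1024 * n) \<le> 1" using n1 by (simp add: field_simps)
  then have Ks2: "K * s\<^sup>2 \<le> 1"
    using mult_mono[of "K * s" 1 s 1] Ks K0 s1 by (simp add: power2_eq_square)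
  have "0 \<le> real r * \<theta>\<^sup>2" "0 \<le> K * s\<^sup>2" using K0 by simp_all
  then have Dl: "15 / 16 \<le> D" and Du: "D \<le> 2"
    unfolding D_def using r\<theta> Ks2 by linarith+
  have oneminus: "1 - \<kappa> * (\<Sum>e\<in>E. (w e)\<^sup>2) = D / S"
    unfolding SE \<kappa>_def D_def using S0 S by (simp add: field_simps)
  \<comment> \<open>The inverse of \<open>p\<close> permutes the columns so that column
    \<open>p j\<close> is column \<open>j\<close> of the reflection; in particular the first
    \<open>r\<close> columns are those belonging to \<open>E\<close>.\<close>
  define U0 :: "real^'n^'n" where
    "U0 = (\<chi> i j. (if i = inv_into UNIV p j then 1 else 0) - 2 / (\<Sum>i\<in>UNIV. (w i)\<^sup>2) * w i * w (inv_into UNIV p j))"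
  have orth: "orthogonal_matrix U0"
    unfolding U0_def using S0 by (intro householder_orthogonal bij_imp_bij_inv p) (simp add: S_def)
  have U0: "U0 $ i $ p j = (if i = j then 1 else 0) - \<kappa> * w i * w j" for i j
    using p(1) by (simp add: U0_def \<kappa>_def S_def bij_is_inj)
  have nz: "1 - \<kappa> * (\<Sum>e\<in>E. (w e)\<^sup>2) \<noteq> 0" unfolding oneminus using Dl S0 by simp
  have det0: "Determinants.det (completed E p U0) \<noteq> 0" by (rule solved_householder(1)[OF U0 nz])
  define t where "t = 2 * \<theta> / D"
  have sol: "solved E p U0 $ f $ e = t * w f" if "e \<in> E" "f \<notin> E" for e f
  proof -
    have "\<kappa> * w e / (D / S) = t" using that S0 by (simp add: \<kappa>_def w_def t_def)
    then show ?thesis using solved_householder(2)[OF U0 nz that] unfolding oneminus by simp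
  qed
  have th: "0 < \<theta>" using n1 by (simp add: \<theta>_def)
  have tl: "\<theta> \<le> t" unfolding t_def using Dl Du th by (simp add: field_simps)
  have tu: "t \<le> 32 / 15 * \<theta>" unfolding t_def using Dl th by (simp add: field_simps)
  have \<alpha>n: "\<alpha> = \<theta> / 2" using \<alpha> by (simp add: \<theta>_def n_def)
  have n\<theta>: "\<theta> \<le> 1 / 4" using n1 by (simp add: \<theta>_def field_simps)
  have c1: "0 < solved E p U0 $ f $ e" if "e \<in> E" "f \<in> - E" for e f
    using sol[of e f] that tl th s1 by (simp add: w_def)
  have others: "(\<Sum>f\<in>- E - {rest}. solved E p U0 $ f $ e) = t * (K * s)" if "e \<in> E" for e
    using sol[OF that] by (simp add: w_def K_def)
  have c4: "(\<Sum>f\<in>- E - {rest}. solved E p U0 $ f $ e) < \<alpha> / 4 * \<alpha>" if "e \<in> E" for e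
  proof -
    have "t * (K * s) \<le> (32 / 15 * \<theta>) * (1 / (1024 * n))"
      using tu Ks K0 s1 th by (intro mult_mono) auto
    also have "1 / (1024 * n) = \<theta> / 256" by (simp add: \<theta>_def)
    also have "(32 / 15 * \<theta>) * (\<theta> / 256) < \<alpha> / 4 * \<alpha>" unfolding \<alpha>n using th by (simp add: field_simps)
    finally show ?thesis using others[OF that] by simp
  qed
  have resteq: "solved E p U0 $ rest $ e = t" if "e \<in> E" for e using sol[OF that rest] rest by (simp add: w_def)
  have c3: "\<alpha> < solved E p U0 $ rest $ e" if "e \<in> E" for e
    using resteq[OF that] tl th \<alpha>n by simp
  have c2: "(\<Sum>f\<in>- E. solved E p U0 $ f $ e) < 1" if "e \<in> E" for e
  proof -
    have "(\<Sum>f\<in>- E. solved E p U0 $ f $ e) = t + (\<Sum>f\<in>- E - {rest}. solved E p U0 $ f $ e)"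
      using rest resteq[OF that] by (subst sum.remove[of _ rest]) auto
    also have "\<dots> < t + \<alpha> / 4 * \<alpha>" using c4[OF that] by simp
    also have "\<alpha> / 4 * \<alpha> \<le> 1 / 8 / 4 * (1 / 8)" unfolding \<alpha>n using n\<theta> th by (intro mult_mono) auto
    finally show ?thesis using tu n\<theta> by simp
  qed
  have tend: "((\<lambda>U. solved E p U $ f $ e) \<longlongrightarrow> solved E p U0 $ f $ e) (nhds U0)" for f e
    using isCont_solved[OF det0, of f e] tendsto_at_iff_tendsto_nhds[of "\<lambda>U. solved E p U $ f $ e" U0]
    by (simp add: isCont_def)
  have tdet: "((\<lambda>U. Determinants.det (completed E p U)) \<longlongrightarrow> Determinants.det (completed E p U0)) (nhds U0)"
    using continuous_det_completed[of E p]
      tendsto_at_iff_tendsto_nhds[of "\<lambda>U. Determinants.det (completed E p U)" U0]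
    by (simp add: continuous_on_eq_continuous_at isCont_def)
  \<comment> \<open>All inequalities are strict here, which makes them stable under small changes of
    the matrix; the weak ones of \<open>substitution_weights\<close> follow.\<close>
  define near where "near U \<longleftrightarrow> Determinants.det (completed E p U) \<noteq> 0 \<and>
      (\<forall>e\<in>E. \<forall>f\<in>- E. 0 < solved E p U $ f $ e) \<and> (\<forall>e\<in>E. (\<Sum>f\<in>- E. solved E p U $ f $ e) < 1) \<and>
      (\<forall>e\<in>E. \<alpha> < solved E p U $ rest $ e) \<and> (\<forall>e\<in>E. (\<Sum>f\<in>- E - {rest}. solved E p U $ f $ e) < \<alpha> / 4 * \<alpha>)" for U
  have "\<forall>\<^sub>F U in nhds U0. near U"
    unfolding near_def
  proof (intro eventually_conj eventually_ball_finite ballI finite)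
    show "\<forall>\<^sub>F U in nhds U0. Determinants.det (completed E p U) \<noteq> 0"
      by (rule tendsto_imp_eventually_ne[OF tdet det0])
  next
    fix e f assume "e \<in> E" "f \<in> - E"
    then show "\<forall>\<^sub>F U in nhds U0. 0 < solved E p U $ f $ e" using order_tendstoD(1)[OF tend] c1 by blast
  next
    fix e assume "e \<in> E"
    then show "\<forall>\<^sub>F U in nhds U0. (\<Sum>f\<in>- E. solved E p U $ f $ e) < 1"
      using c2 by (intro order_tendstoD(2)[OF tendsto_sum[OF tend]])
  next
    fix e assume "e \<in> E"
    then show "\<forall>\<^sub>F U in nhds U0. \<alpha> < solved E p U $ rest $ e" using order_tendstoD(1)[OF tend] c3 by blast
  next
    fix e assume "e \<in> E"
    then show "\<forall>\<^sub>F U in nhds U0. (\<Sum>f\<in>- E - {rest}. solved E p U $ f $ e) < \<alpha> / 4 * \<alpha>"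
      using c4 by (intro order_tendstoD(2)[OF tendsto_sum[OF tend]])
  qed
  then obtain N where N: "open N" "U0 \<in> N" and near: "\<forall>U\<in>N. near U"
    unfolding eventually_nhds by blast
  have "\<exists>a. substitution_weights E rest \<alpha> c r U a" if U: "U \<in> N" for U
    unfolding substitution_weights_def
  proof (rule exI[of _ "\<lambda>e f. solved E p U $ f $ e"], intro conjI ballI allI impI)
    fix v k assume v: "\<forall>e\<in>E. v e = (\<Sum>f\<in>- E. solved E p U $ f $ e * v f)" and k: "k < r"
    obtain e where e: "e \<in> E" "g e = k" using g k by (metis bij_betw_def imageE lessThan_iff)
    have "(\<Sum>i\<in>UNIV. U $ i $ p e * v i) = 0"
      by (rule annihilates_columns[of E p U e v]) (use bspec[OF near U, unfolded near_def] e v in auto)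
    then show "(\<Sum>i\<in>UNIV. U $ i $ c k * v i) = 0" using p(2)[OF e(1)] e(2) by simp
  qed (use bspec[OF near U, unfolded near_def] in \<open>auto intro: less_imp_le\<close>)
  then show ?thesis using N orth by blast
qed


section \<open>Label classes\<close>

text \<open>Here \<open>a\<close> and \<open>b\<close> are the class sizes of one direction, and the
  two directions use \<open>2 * m\<close> labels. A resting pair needs a spare pair in the product
  of classes or a spare label. For large \<open>d\<close>, the inequality
  \<open>10/189 < 1/16\<close> outweighs the rounding losses; small \<open>d\<close> are checked
  individually.\<close>

lemma label_count:
  fixes d r :: nat
  assumes "1 \<le> r" "189 * r \<le> 10 * d\<^sup>2" "m = d div 2" "a = m div 2" "b = m - a"
  shows "r \<le> a * b \<and> (r < a * b \<or> 2 * m < d)"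
proof (cases "d < 14")
  case True
  then have "d = 0 \<or> d = 1 \<or> d = 2 \<or> d = 3 \<or> d = 4 \<or> d = 5 \<or> d = 6 \<or> d = 7 \<or> d = 8 \<or> d = 9 \<or>
    d = 10 \<or> d = 11 \<or> d = 12 \<or> d = 13" by arith
  then show ?thesis using assms by (elim disjE) simp_all
next
  case False
  then have a3: "3 \<le> a" using assms by auto
  then have aa: "3 * a \<le> a * a" by (rule mult_le_mono1)
  have d: "d \<le> 2 * m + 1" using assms by auto
  have "r < a * b"
  proof (rule ccontr)
    assume "\<not> r < a * b"
    then have r: "a * b \<le> r" by simp
    consider "m = 2 * a" "b = a" | "m = 2 * a + 1" "b = a + 1" using assms by (cases "even m") (auto elim!: evenE oddE)
    then show False
    proof cases
      case 1
      have "d * d \<le> (4 * a + 1) * (4 * a + 1)" using d 1 by (intro mult_le_mono) auto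
      then have "189 * (a * a) \<le> 10 * ((4 * a + 1) * (4 * a + 1))"
        using assms(2) r 1 by (simp add: power2_eq_square)
      then have "29 * (a * a) \<le> 80 * a + 10" by (simp add: algebra_simps)
      then show False using aa a3 by linarith
    next
      case 2
      have "d * d \<le> (4 * a + 3) * (4 * a + 3)" using d 2 by (intro mult_le_mono) auto
      then have "189 * (a * a + a) \<le> 10 * ((4 * a + 3) * (4 * a + 3))"
        using assms(2) r 2 by (simp add: power2_eq_square)
      then have "29 * (a * a) \<le> 51 * a + 90" by (simp add: algebra_simps)
      then show False using aa a3 by linarith
    qed
  qed
  then show ?thesis by simp
qed

lemma ex_labelling:
  fixes r :: nat
  assumes "1 \<le> r" "189 * r \<le> 10 * (CARD('l::finite))\<^sup>2"
  shows "\<exists>(cls :: 'l \<Rightarrow> (bool \<times> bool) option) E rest.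
    (\<forall>i. card (E i) = r) \<and>
    (\<forall>i k l. (k, l) \<in> E i \<longrightarrow> cls k = Some (i, False) \<and> cls l = Some (i, True)) \<and>
    (\<forall>i. rest i \<notin> E i) \<and>
    (\<forall>i k l. rest i = (k, l) \<longrightarrow> cls k \<in> {None, Some (i, False)} \<and> cls l \<in> {None, Some (i, True)})"
proof -
  define d where "d = CARD('l)"
  define m where "m = d div 2"
  define a where "a = m div 2"
  define b where "b = m - a"
  have count: "r \<le> a * b" "r < a * b \<or> 2 * m < d"
    using label_count[OF assms(1) assms(2)[folded d_def] m_def a_def b_def] by blast+
  have am: "a \<le> m" "2 * m \<le> d" by (auto simp: a_def m_def)
  have "\<exists>g. bij_betw g (UNIV :: 'l set) {..<d}"
    by (rule finite_same_card_bij) (simp_all add: d_def)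
  then obtain g where g: "bij_betw g (UNIV :: 'l set) {..<d}" by blast
  \<comment> \<open>After numbering the labels by \<open>g\<close>, the classes are consecutive
    blocks of sizes \<open>a\<close>, \<open>b\<close>, \<open>a\<close>, \<open>b\<close>; at most
    a few labels at the end stay without a class.\<close>
  define cls where "cls k = (if g k < a then Some (False, False) else if g k < m then Some (False, True)
     else if g k < m + a then Some (True, False) else if g k < 2 * m then Some (True, True) else None)" for k
  have card_g: "card {k. g k \<in> X} = card X" if "X \<subseteq> {..<d}" for X
  proof -
    have "range g = {..<d}" using g by (simp add: bij_betw_def)
    then have img: "g ` (g -` X) = X" using that by (simp only: image_vimage_eq Int_absorb2)
    have "inj_on g (g -` X)" using g by (auto simp: bij_betw_def intro: inj_on_subset)
    from card_image[OF this] have "card (g -` X) = card X" unfolding img by (rule sym)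
    then show ?thesis by (simp add: vimage_def)
  qed
  define W where "W s = {k. cls k = Some s}" for s
  have cW: "card (W (i, False)) = a" for i
  proof -
    have "W (i, False) = {k. g k \<in> (if i then {m..<m + a} else {..<a})}"
      using am by (auto simp: W_def cls_def split: if_splits)
    moreover have "(if i then {m..<m + a} else {..<a}) \<subseteq> {..<d}" using am by auto
    ultimately have "card (W (i, False)) = card (if i then {m..<m + a} else {..<a})" by (simp only: card_g)
    then show ?thesis by (cases i) simp_all
  qed
  have cV: "card (W (i, True)) = b" for i
  proof -
    have "W (i, True) = {k. g k \<in> (if i then {m + a..<2 * m} else {a..<m})}"
      using am by (auto simp: W_def cls_def split: if_splits)
    moreover have "(if i then {m + a..<2 * m} else {a..<m}) \<subseteq> {..<d}" using am by auto
    ultimately have "card (W (i, True)) = card (if i then {m + a..<2 * m} else {a..<m})" by (simp only: card_g)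
    then show ?thesis using am by (cases i) (simp_all add: b_def)
  qed
  have cWV: "card (W (i, False) \<times> W (i, True)) = a * b" for i by (simp add: card_cartesian_product cW cV)
  have "\<exists>S. S \<subseteq> W (i, False) \<times> W (i, True) \<and> card S = r" for i
    using obtain_subset_with_card_n[of r "W (i, False) \<times> W (i, True)"] count(1) cWV by metis
  then obtain E where E: "\<And>i. E i \<subseteq> W (i, False) \<times> W (i, True)" "\<And>i. card (E i) = r" by metis
  \<comment> \<open>The resting pair is a pair of the class product left over by \<open>E i\<close>
    or, if there may be none, a label without class at both ends.\<close>
  have "\<exists>p. p \<notin> E i \<and> cls (fst p) \<in> {None, Some (i, False)} \<and> cls (snd p) \<in> {None, Some (i, True)}" for i
    using count(2)
  proof
    assume "r < a * b"
    then have "E i \<noteq> W (i, False) \<times> W (i, True)" using E(2)[of i] cWV[of i] by auto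
    then obtain p where "p \<in> W (i, False) \<times> W (i, True)" "p \<notin> E i" using E(1)[of i] by blast
    then show ?thesis by (intro exI[of _ p]) (auto simp: W_def)
  next
    assume "2 * m < d"
    then obtain k where k: "g k = 2 * m" using g by (metis bij_betw_def imageE lessThan_iff)
    then have "cls k = None" using am by (simp add: cls_def)
    moreover have "(k, k) \<notin> E i" using E(1)[of i] \<open>cls k = None\<close> by (auto simp: W_def)
    ultimately show ?thesis by (intro exI[of _ "(k, k)"]) simp
  qed
  then obtain rest where rest: "\<And>i. rest i \<notin> E i \<and> cls (fst (rest i)) \<in> {None, Some (i, False)} \<and> cls (snd (rest i)) \<in> {None, Some (i, True)}"
    by metis
  show ?thesis
  proof (intro exI[of _ cls] exI[of _ E] exI[of _ rest] conjI allI impI)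
    show "card (E i) = r" "rest i \<notin> E i" for i using E(2) rest by blast+
    show "cls k = Some (i, False)" "cls l = Some (i, True)" if "(k, l) \<in> E i" for i k l
      using E(1)[of i] that by (auto simp: W_def)
    show "cls k \<in> {None, Some (i, False)}" "cls l \<in> {None, Some (i, True)}" if "rest i = (k, l)" for i k l
      using rest[of i] that by auto
  qed
qed


section \<open>The area law\<close>

lemma power_one_plus_le:
  fixes x y :: real
  assumes "0 \<le> x" "real n * x \<le> y" "y \<le> 1"
  shows "(1 + x) ^ n - 1 \<le> 2 * y"
proof -
  have y0: "0 \<le> y" using assms(1,2) by (meson mult_nonneg_nonneg of_nat_0_le_iff order_trans)
  have "(1 + x) ^ n \<le> exp x ^ n" using assms(1) by (intro power_mono exp_ge_add_one_self) auto
  also have "\<dots> = exp (real n * x)" by (simp add: exp_of_nat_mult)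
  also have "\<dots> \<le> exp y" using assms(2) by simp
  also have "\<dots> \<le> 1 + y + y\<^sup>2" using y0 assms(3) by (rule exp_bound)
  also have "\<dots> \<le> 1 + 2 * y" using mult_left_mono[OF assms(3) y0] by (simp add: power2_eq_square)
  finally show ?thesis by simp
qed

lemma merge_left_eq: "z \<in> left_half L \<Longrightarrow> merge (left_half L) (right_half L) (\<sigma>, \<omega>) z = \<sigma> z"
  by (simp add: merge_def)

lemma merge_right_eq:
  "\<omega> \<in> configs (right_half L) \<Longrightarrow> z \<notin> left_half L \<Longrightarrow> merge (left_half L) (right_half L) (\<sigma>, \<omega>) z = \<omega> z"
  by (cases z) (auto simp: merge_def configs_def PiE_iff extensional_def)

lemma sum_configs_split:
  fixes h :: "(int \<times> int \<Rightarrow> 'd::finite) \<Rightarrow> real"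
  shows "(\<Sum>\<sigma>\<in>configs (left_half L). \<Sum>\<omega>\<in>configs (right_half L). h (merge (left_half L) (right_half L) (\<sigma>, \<omega>))) =
    (\<Sum>\<sigma>\<in>configs (lattice_box L). h \<sigma>)"
proof -
  have box: "lattice_box L = left_half L \<union> right_half L" by (auto simp: left_half_def right_half_def)
  have dis: "left_half L \<inter> right_half L = {}" by (auto simp: left_half_def right_half_def)
  have "(\<Sum>\<sigma>\<in>configs (left_half L). \<Sum>\<omega>\<in>configs (right_half L). h (merge (left_half L) (right_half L) (\<sigma>, \<omega>))) =
    (\<Sum>p\<in>configs (left_half L) \<times> configs (right_half L). h (merge (left_half L) (right_half L) p))"
    by (simp add: sum.cartesian_product split_def)
  also have "\<dots> = (\<Sum>\<sigma>\<in>configs (lattice_box L). h \<sigma>)"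
  proof (rule sum.reindex_bij_witness[of _ "\<lambda>\<sigma>. (restrict \<sigma> (left_half L), restrict \<sigma> (right_half L))" "merge (left_half L) (right_half L)"])
    fix p :: "(int \<times> int \<Rightarrow> 'd) \<times> (int \<times> int \<Rightarrow> 'd)" assume p: "p \<in> configs (left_half L) \<times> configs (right_half L)"
    obtain \<sigma> \<omega> where p': "p = (\<sigma>, \<omega>)" "\<sigma> \<in> configs (left_half L)" "\<omega> \<in> configs (right_half L)" using p by auto
    have "restrict (merge (left_half L) (right_half L) (\<sigma>, \<omega>)) (left_half L) = \<sigma>"
      using p'(2) by (auto simp: fun_eq_iff restrict_def merge_def configs_def PiE_iff extensional_def)
    moreover have "restrict (merge (left_half L) (right_half L) (\<sigma>, \<omega>)) (right_half L) = \<omega>"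
      using p'(3) dis by (auto simp: fun_eq_iff restrict_def merge_def configs_def PiE_iff extensional_def)
    ultimately show "(restrict (merge (left_half L) (right_half L) p) (left_half L), restrict (merge (left_half L) (right_half L) p) (right_half L)) = p"
      using p'(1) by simp
    show "merge (left_half L) (right_half L) p \<in> configs (lattice_box L)"
      using merge_in_configs p' by blast
  next
    fix \<sigma> :: "int \<times> int \<Rightarrow> 'd" assume s: "\<sigma> \<in> configs (lattice_box L)"
    show "merge (left_half L) (right_half L) (restrict \<sigma> (left_half L), restrict \<sigma> (right_half L)) = \<sigma>"
      using s unfolding box by (auto simp: fun_eq_iff merge_def configs_def PiE_iff extensional_def)
    show "(restrict \<sigma> (left_half L), restrict \<sigma> (right_half L)) \<in> configs (left_half L) \<times> configs (right_half L)"
      by (auto simp: configs_def)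
  qed simp
  finally show ?thesis .
qed

lemma card_configs_left: "card (configs (left_half L) :: (int \<times> int \<Rightarrow> 'd::finite) set) \<le> CARD('d) ^ (4 * L\<^sup>2)"
proof -
  have "card (configs (left_half L) :: (int \<times> int \<Rightarrow> 'd) set) = CARD('d) ^ card (left_half L)"
    unfolding configs_def using finite_halves by (subst card_PiE) auto
  also have "\<dots> \<le> CARD('d) ^ (4 * L\<^sup>2)"
  proof (rule power_increasing)
    show "card (left_half L) \<le> 4 * L\<^sup>2"
      unfolding card_lattice_box[symmetric] using finite_lattice_box by (intro card_mono) (auto simp: left_half_def)
  qed (simp add: Suc_le_eq)
  finally show ?thesis .
qed

text \<open>After \<open>T\<close> sweeps the relative error is at most \<open>1/L\<close> at every
  configuration, so the squared error of the normalized amplitudes is at most \<open>1/L^2\<close>.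
  Restricting the two factors of each product to the halves gives the low-rank approximation
  required by the entropy bound.\<close>

lemma low_entropy_amplitudes:
  fixes a :: "bool \<Rightarrow> 'd::finite \<times> 'd \<Rightarrow> 'd \<times> 'd \<Rightarrow> real"
  assumes rw: "rewriting cls E rest a (lattice_bonds bc L) \<alpha> q" and L: "1 \<le> L"
    and T: "16 * real L ^ 3 / \<alpha> \<le> 2 ^ T"
  shows "\<exists>\<phi> :: (int \<times> int \<Rightarrow> 'd) \<Rightarrow> real.
    normalized_on (configs (lattice_box L)) (\<lambda>\<sigma>. of_real (\<phi> \<sigma>)) \<and>
    (\<forall>i x y \<sigma> e. (i, x, y) \<in> lattice_bonds bc L \<longrightarrow> e \<in> E i \<longrightarrow>
       \<phi> (\<sigma>(x := fst e, y := snd e)) = (\<Sum>f\<in>- E i. a i e f * \<phi> (\<sigma>(x := fst f, y := snd f)))) \<and>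
    entanglement_entropy L (\<lambda>\<sigma>. of_real (\<phi> \<sigma>)) \<le>
      ln (2 * (real CARD('d))\<^sup>2 ^ (T * (4 * L))) + 1 / (real L)\<^sup>2 * ln (2 * real CARD('d) ^ (4 * L\<^sup>2))"
proof -
  interpret rewriting cls E rest a "lattice_bonds bc L" \<alpha> q by (rule rw)
  let ?I = "configs (lattice_box L) :: (int \<times> int \<Rightarrow> 'd) set"
  let ?J = "configs (left_half L) :: (int \<times> int \<Rightarrow> 'd) set"
  let ?K = "configs (right_half L) :: (int \<times> int \<Rightarrow> 'd) set"
  let ?n = "card ?J"
  let ?m = "merge (left_half L) (right_half L) :: (int \<times> int \<Rightarrow> 'd) \<times> (int \<times> int \<Rightarrow> 'd) \<Rightarrow> _"
  let ?f = "from_nat_into ?J"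
  have finI: "finite ?I" and finJ: "finite ?J" and finK: "finite ?K"
    using finite_configs finite_lattice_box finite_halves by blast+
  have neI: "?I \<noteq> {}" and neJ: "?J \<noteq> {}" unfolding configs_def by (auto simp: PiE_eq_empty_iff)
  define Z where "Z = (\<Sum>\<sigma>\<in>?I. (limit_state \<sigma>)\<^sup>2)"
  have Z0: "0 < Z" unfolding Z_def by (intro sum_pos finI neI zero_less_power limit_state_pos)
  define \<phi> where "\<phi> \<sigma> = limit_state \<sigma> / sqrt Z" for \<sigma>
  have \<phi>2: "(\<Sum>\<sigma>\<in>?I. (\<phi> \<sigma>)\<^sup>2) = 1"
    unfolding \<phi>_def power_divide sum_divide_distrib[symmetric] Z_def[symmetric] using Z0 by simp
  have norm: "normalized_on ?I (\<lambda>\<sigma>. of_real (\<phi> \<sigma>))"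
    unfolding normalized_on_def using \<phi>2 by simp
  have eqs: "\<phi> (\<sigma>(x := fst e, y := snd e)) = (\<Sum>f\<in>- E i. a i e f * \<phi> (\<sigma>(x := fst f, y := snd f)))"
    if b: "(i, x, y) \<in> lattice_bonds bc L" and e: "e \<in> E i" for i x y \<sigma> e
  proof -
    let ?\<tau> = "upd \<sigma> (i, x, y) e"
    have \<tau>: "?\<tau> = \<sigma>(x := fst e, y := snd e)" by (cases e) simp
    have u: "upd ?\<tau> (i, x, y) f = \<sigma>(x := fst f, y := snd f)" for f
      unfolding upd_upd by (cases f) simp
    have pa: "pair_at ?\<tau> (i, x, y) = e" by (rule pair_at_upd[OF b])
    have "limit_state ?\<tau> = step (i, x, y) limit_state ?\<tau>" using limit_state_fixed[OF b] by simp
    also have "\<dots> = (\<Sum>f\<in>- E i. a i e f * limit_state (\<sigma>(x := fst f, y := snd f)))"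
      unfolding step_def u pa using bad_upd[OF b] e by (simp del: upd.simps)
    finally show ?thesis unfolding \<phi>_def \<tau> by (simp add: sum_divide_distrib)
  qed
  define M where "M = T * card (crossing (left_half L))"
  obtain F G where FG: "separation (left_half L) M (approx T) F G"
    using separable_approx[of "left_half L" T] by (auto simp: separable_def M_def)
  let ?R = "{s :: ('d \<times> 'd) list. length s = M}"
  have cardR: "card ?R = (CARD('d)\<^sup>2) ^ M" and finR: "finite ?R"
    using card_lists_length_eq[of "UNIV :: ('d \<times> 'd) set" M] finite_lists_length_eq[of "UNIV :: ('d \<times> 'd) set" M]
    by (simp_all add: card_prod power2_eq_square)
  have neR: "?R \<noteq> {}" by (auto intro: exI[of _ "replicate M undefined"])
  have F: "F s (?m (\<sigma>, \<omega>)) = F s \<sigma>" for s \<sigma> \<omega>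
    using separationD(1)[OF FG, of s] merge_left_eq unfolding depends_on_def by blast
  have G: "G s (?m (\<sigma>, \<omega>)) = G s \<omega>" if "\<omega> \<in> ?K" for s \<sigma> \<omega>
    using separationD(2)[OF FG, of s] merge_right_eq[OF that] unfolding depends_on_def by blast
  obtain u e where d: "diag_on ?n (indexed ?J (rho_left L (\<lambda>\<sigma>. of_real (\<phi> \<sigma>)))) u e"
    using ex_diag_on[of ?n "indexed ?J (rho_left L (\<lambda>\<sigma>. of_real (\<phi> \<sigma>)))"] rho_left_hermitian by metis
  \<comment> \<open>The relative error after \<open>T\<close> sweeps. There are at most
    \<open>8 * L^2\<close> bonds, each with excess at most \<open>1 / (\<alpha> * 2^T)\<close>, and
    the assumption on \<open>T\<close> bounds the total excess by \<open>1 / (2 * L)\<close>;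
    exponentiating at most doubles it.\<close>
  define \<delta> where "\<delta> = (1 + (1 / \<alpha> - 1) / 2 ^ T) ^ card (lattice_bonds bc L) - 1"
  have "1 \<le> 1 / \<alpha>" using alpha by simp
  then have x0: "0 \<le> (1 / \<alpha> - 1) / 2 ^ T" by simp
  then have \<delta>0: "0 \<le> \<delta>" unfolding \<delta>_def by (simp add: one_le_power)
  have "\<delta> \<le> 2 * (1 / (2 * real L))"
    unfolding \<delta>_def
  proof (rule power_one_plus_le[OF x0])
    have L3: "real L ^ 3 = (real L)\<^sup>2 * real L" by (simp add: power3_eq_cube power2_eq_square)
    have "real (card (lattice_bonds bc L)) * ((1 / \<alpha> - 1) / 2 ^ T) \<le> (8 * (real L)\<^sup>2) * ((1 / \<alpha>) / 2 ^ T)"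
    proof (rule mult_mono)
      have "real (card (lattice_bonds bc L)) \<le> real (8 * L\<^sup>2)" using card_lattice_bonds of_nat_le_iff by blast
      then show "real (card (lattice_bonds bc L)) \<le> 8 * (real L)\<^sup>2" by simp
      show "(1 / \<alpha> - 1) / 2 ^ T \<le> (1 / \<alpha>) / 2 ^ T" by (intro divide_right_mono) auto
    qed (use x0 in auto)
    also have "\<dots> \<le> 1 / (2 * real L)"
    proof -
      have "16 * (real L)\<^sup>2 * real L * (1 / \<alpha>) \<le> 2 ^ T" using T by (simp add: L3 mult.assoc)
      then have "(8 * (real L)\<^sup>2) * (1 / \<alpha>) * (2 * real L) \<le> 1 * 2 ^ T" by (simp add: mult_ac)
      moreover have "0 < 2 * real L" using L by simp
      ultimately have "(8 * (real L)\<^sup>2) * (1 / \<alpha>) / 2 ^ T \<le> 1 / (2 * real L)"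
        by (subst frac_le_eq, simp, simp, subst divide_nonpos_pos) auto
      then show ?thesis by simp
    qed
    finally show "real (card (lattice_bonds bc L)) * ((1 / \<alpha> - 1) / 2 ^ T) \<le> 1 / (2 * real L)" .
    show "1 / (2 * real L) \<le> 1" using L by simp
  qed
  then have \<delta>L: "\<delta> \<le> 1 / real L" by simp
  have "\<delta>\<^sup>2 \<le> (1 / real L)\<^sup>2" using \<delta>0 \<delta>L by (intro power_mono)
  then have \<delta>2: "\<delta>\<^sup>2 \<le> 1 / (real L)\<^sup>2" by (simp add: power_divide)
  have close: "(\<phi> \<sigma> - approx T \<sigma> / sqrt Z)\<^sup>2 \<le> \<delta>\<^sup>2 * (\<phi> \<sigma>)\<^sup>2" for \<sigma>
  proof -
    have "0 \<le> approx T \<sigma> - limit_state \<sigma>" using limit_state_le by simp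
    moreover have "approx T \<sigma> - limit_state \<sigma> \<le> \<delta> * limit_state \<sigma>"
      using approx_le[of T \<sigma>] by (simp add: \<delta>_def algebra_simps)
    ultimately have "\<bar>approx T \<sigma> / sqrt Z - \<phi> \<sigma>\<bar> \<le> \<delta> * \<phi> \<sigma>"
      unfolding \<phi>_def using Z0 by (simp add: diff_divide_distrib[symmetric] divide_right_mono)
    then have "\<bar>approx T \<sigma> / sqrt Z - \<phi> \<sigma>\<bar>\<^sup>2 \<le> (\<delta> * \<phi> \<sigma>)\<^sup>2" by (intro power_mono) auto
    then show ?thesis by (simp add: power_mult_distrib power2_commute)
  qed
  have "entanglement_entropy L (\<lambda>\<sigma>. of_real (\<phi> \<sigma>)) = - (\<Sum>k<?n. e k * ln (e k))"
    using von_neumann_entropy_diag[OF d] by (simp add: entanglement_entropy_def mat_on_def)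
  also have "\<dots> \<le> ln (2 * real (card ?R)) + \<delta>\<^sup>2 * ln (2 * real ?n)"
  proof (rule diag_on_entropy_le[OF d _ finK finR neR, where \<psi> = "\<lambda>i \<omega>. \<phi> (?m (?f i, \<omega>))"
        and f = "\<lambda>s i. F s (?f i) / sqrt Z" and g = G])
    show "0 < ?n" using finJ neJ by (simp add: card_gt_0_iff)
    show "indexed ?J (rho_left L (\<lambda>\<sigma>. complex_of_real (\<phi> \<sigma>))) i j =
        complex_of_real (\<Sum>\<omega>\<in>?K. \<phi> (?m (?f i, \<omega>)) * \<phi> (?m (?f j, \<omega>)))" for i j
      by (simp add: rho_left_def)
    show "(\<Sum>i<?n. \<Sum>\<omega>\<in>?K. (\<phi> (?m (?f i, \<omega>)))\<^sup>2) = 1"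
      using \<phi>2 sum_configs_split[of "\<lambda>\<sigma>. (\<phi> \<sigma>)\<^sup>2" L]
      by (simp add: sum_from_nat_into[OF finJ, of "\<lambda>\<sigma>. \<Sum>\<omega>\<in>?K. (\<phi> (?m (\<sigma>, \<omega>)))\<^sup>2"])
    have "(\<Sum>i<?n. \<Sum>\<omega>\<in>?K. (\<phi> (?m (?f i, \<omega>)) - (\<Sum>s\<in>?R. F s (?f i) / sqrt Z * G s \<omega>))\<^sup>2) =
      (\<Sum>i<?n. \<Sum>\<omega>\<in>?K. (\<phi> (?m (?f i, \<omega>)) - approx T (?m (?f i, \<omega>)) / sqrt Z)\<^sup>2)"
      by (intro sum.cong refl) (simp add: separationD(3)[OF FG] F G sum_divide_distrib)
    also have "\<dots> \<le> (\<Sum>i<?n. \<Sum>\<omega>\<in>?K. \<delta>\<^sup>2 * (\<phi> (?m (?f i, \<omega>)))\<^sup>2)"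
      by (intro sum_mono close)
    also have "\<dots> = \<delta>\<^sup>2"
      using \<phi>2 sum_configs_split[of "\<lambda>\<sigma>. (\<phi> \<sigma>)\<^sup>2" L]
      by (simp add: sum_distrib_left[symmetric] sum_from_nat_into[OF finJ, of "\<lambda>\<sigma>. \<Sum>\<omega>\<in>?K. (\<phi> (?m (\<sigma>, \<omega>)))\<^sup>2"])
    finally show "(\<Sum>i<?n. \<Sum>\<omega>\<in>?K. (\<phi> (?m (?f i, \<omega>)) - (\<Sum>s\<in>?R. F s (?f i) / sqrt Z * G s \<omega>))\<^sup>2) \<le> \<delta>\<^sup>2" .
  qed
  also have "\<dots> \<le> ln (2 * (real CARD('d))\<^sup>2 ^ (T * (4 * L))) + 1 / (real L)\<^sup>2 * ln (2 * real CARD('d) ^ (4 * L\<^sup>2))"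
  proof (intro add_mono mult_mono)
    have D1: "1 \<le> real CARD('d)" by (simp add: Suc_le_eq)
    have "M \<le> T * (4 * L)" unfolding M_def crossing_def using card_crossing_lattice_bonds by (intro mult_le_mono2)
    then have "(real CARD('d))\<^sup>2 ^ M \<le> (real CARD('d))\<^sup>2 ^ (T * (4 * L))"
      using D1 by (intro power_increasing) auto
    moreover have "0 < (real CARD('d))\<^sup>2 ^ M" using D1 by simp
    ultimately show "ln (2 * real (card ?R)) \<le> ln (2 * (real CARD('d))\<^sup>2 ^ (T * (4 * L)))"
      unfolding cardR by (subst ln_le_cancel_iff) auto
    have n0: "0 < ?n" using finJ neJ by (simp add: card_gt_0_iff)
    have "real ?n \<le> real (CARD('d) ^ (4 * L\<^sup>2))" using card_configs_left of_nat_le_iff by blast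
    then have "real ?n \<le> real CARD('d) ^ (4 * L\<^sup>2)" by simp
    then show "ln (2 * real ?n) \<le> ln (2 * real CARD('d) ^ (4 * L\<^sup>2))"
      using n0 by (subst ln_le_cancel_iff) auto
    show "0 \<le> ln (2 * real ?n)" using n0 by simp
  qed (use \<delta>2 in auto)
  finally have "entanglement_entropy L (\<lambda>\<sigma>. of_real (\<phi> \<sigma>)) \<le>
      ln (2 * (real CARD('d))\<^sup>2 ^ (T * (4 * L))) + 1 / (real L)\<^sup>2 * ln (2 * real CARD('d) ^ (4 * L\<^sup>2))" .
  then show ?thesis using norm eqs by blast
qed

section \<open>Comparison of \<open>L log L\<close> with the stated growth\<close>

lemma one_plus_le_exp_powr:
  fixes y :: real
  assumes "0 \<le> y" shows "1 + y \<le> 3 * exp (y powr (4 / 5))"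
proof (cases "y < 1")
  case True
  have "1 \<le> exp (y powr (4 / 5))" by simp
  then show ?thesis using True by linarith
next
  case False
  let ?z = "y powr (4 / 5)"
  \<comment> \<open>For \<open>y \<ge> 1\<close> one has \<open>y \<le> y powr (8/5)\<close>, the
    square of \<open>?z\<close>, so the quadratic Taylor term of the exponential already dominates
    \<open>y\<close>.\<close>
  have "y powr 1 \<le> y powr (8 / 5)" using False by (intro powr_mono) auto
  also have "\<dots> = ?z\<^sup>2" by (simp add: power2_eq_square powr_add[symmetric])
  finally have z: "y \<le> ?z\<^sup>2" using assms by simp
  have "1 + ?z + ?z\<^sup>2 / 2 \<le> exp ?z" by (rule exp_lower_Taylor_quadratic) simp
  moreover have "0 \<le> ?z" by simp
  ultimately show ?thesis using z False by linarith
qed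

text \<open>With \<open>y = ln x\<close> the extra factor \<open>x powr (y powr (-1/5))\<close>
  equals \<open>exp (y powr (4/5))\<close>, which exceeds any power of \<open>y\<close> eventually,
  and \<open>1 + y\<close> up to the constant 3 everywhere.\<close>

lemma linear_log_le_area:
  fixes x :: real
  assumes "2 \<le> x"
  shows "x * (1 + ln x) \<le> 3 * x powr (1 + ln x powr (- 1 / 5))"
proof -
  have y: "0 < ln x" using assms by simp
  have "ln x powr (- 1 / 5) * ln x = ln x powr (- 1 / 5) * ln x powr 1" using y by simp
  also have "\<dots> = ln x powr (4 / 5)" by (simp only: powr_add[symmetric]) simp
  finally have "x powr (ln x powr (- 1 / 5)) = exp (ln x powr (4 / 5))"
    using assms by (simp add: powr_def)
  then have "x powr (1 + ln x powr (- 1 / 5)) = x * exp (ln x powr (4 / 5))"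
    using assms by (simp add: powr_add)
  moreover have "x * (1 + ln x) \<le> x * (3 * exp (ln x powr (4 / 5)))"
    using one_plus_le_exp_powr[of "ln x"] y assms by (intro mult_left_mono) auto
  ultimately show ?thesis by simp
qed

text \<open>The number of sweeps is the logarithm of \<open>16 * L^3 / \<alpha>\<close> to base 2,
  rounded up. The rank term is then of order \<open>L * (1 + ln L)\<close>, and the error term is
  bounded because \<open>1/L^2\<close> cancels the volume.\<close>

lemma entropy_constant:
  fixes D \<alpha> :: real
  assumes D: "1 \<le> D" and \<alpha>: "0 < \<alpha>" "\<alpha> \<le> 1"
  shows "\<exists>C>0. \<forall>L::nat. 2 \<le> L \<longrightarrow> (\<exists>T. 16 * real L ^ 3 / \<alpha> \<le> 2 ^ T \<and>
    ln (2 * D\<^sup>2 ^ (T * (4 * L))) + 1 / (real L)\<^sup>2 * ln (2 * D ^ (4 * L\<^sup>2))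
      \<le> C * real L powr (1 + ln (real L) powr (- 1 / 5)))"
proof -
  define l where "l = ln D"
  have l: "0 \<le> l" using D by (simp add: l_def)
  \<comment> \<open>The summand 5 is \<open>log 2 16\<close> plus 1 for rounding up the number of
    sweeps.\<close>
  define A where "A = 5 + log 2 (1 / \<alpha>)"
  have A: "0 \<le> A" unfolding A_def using \<alpha> by (intro add_nonneg_nonneg) auto
  define C where "C = 2 * ln 2 + 8 * l * A + 24 * l / ln 2 + 4 * l"
  have C: "0 < C" unfolding C_def using l A by (intro add_pos_nonneg) auto
  have "\<exists>T. 16 * real L ^ 3 / \<alpha> \<le> 2 ^ T \<and>
    ln (2 * D\<^sup>2 ^ (T * (4 * L))) + 1 / (real L)\<^sup>2 * ln (2 * D ^ (4 * L\<^sup>2))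
      \<le> 3 * C * real L powr (1 + ln (real L) powr (- 1 / 5))" if L: "2 \<le> L" for L :: nat
  proof -
    let ?x = "real L" and ?y = "ln (real L)"
    have x: "2 \<le> ?x" using L by simp
    have y: "0 \<le> ?y" using x by simp
    define X where "X = 16 * ?x ^ 3 / \<alpha>"
    have X0: "0 < X" unfolding X_def using x \<alpha> by simp
    have logX: "log 2 X = A - 1 + 3 * (?y / ln 2)"
    proof -
      have "ln X = ln 16 + 3 * ?y + ln (1 / \<alpha>)"
        unfolding X_def using x \<alpha> by (simp add: ln_div ln_mult ln_realpow)
      moreover have "ln (16 :: real) = 4 * ln 2" using ln_realpow[of 2 4] by simp
      ultimately show ?thesis unfolding A_def log_def by (simp add: add_divide_distrib)
    qed
    have logX0: "0 \<le> log 2 X"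
    proof -
      have "0 \<le> A - 1" unfolding A_def using \<alpha> by (simp add: add_nonneg_nonneg)
      then show ?thesis unfolding logX using y by (intro add_nonneg_nonneg) auto
    qed
    define T where "T = nat \<lceil>log 2 X\<rceil>"
    have T1: "log 2 X \<le> real T" unfolding T_def by linarith
    have T2: "real T \<le> log 2 X + 1" unfolding T_def using logX0 by linarith
    have "X = 2 powr (log 2 X)" using X0 by simp
    also have "\<dots> \<le> 2 powr real T" using T1 by (intro powr_mono) auto
    finally have XT: "X \<le> 2 ^ T" by (simp add: powr_realpow)
    have "ln (2 * D\<^sup>2 ^ (T * (4 * L))) = ln 2 + 8 * ?x * l * real T"
      using D by (simp add: ln_mult ln_realpow l_def)
    also have "\<dots> \<le> ln 2 + 8 * ?x * l * (A + 3 * (?y / ln 2))"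
      using T2 logX l by (intro add_left_mono mult_left_mono) auto
    finally have 1: "ln (2 * D\<^sup>2 ^ (T * (4 * L))) \<le> ln 2 + 8 * ?x * l * (A + 3 * (?y / ln 2))" .
    have "1 / ?x\<^sup>2 * ln (2 * D ^ (4 * L\<^sup>2)) = 1 / ?x\<^sup>2 * ln 2 + 4 * l"
      using D x by (simp add: ln_mult ln_realpow l_def field_simps)
    also have "\<dots> \<le> ln 2 + 4 * l"
    proof -
      have "1 \<le> ?x\<^sup>2" using x by (simp add: one_le_power)
      then have "1 / ?x\<^sup>2 * ln 2 \<le> 1 * ln 2" by (intro mult_right_mono) (auto simp: divide_le_eq_1)
      then show ?thesis by simp
    qed
    finally have 2: "1 / ?x\<^sup>2 * ln (2 * D ^ (4 * L\<^sup>2)) \<le> ln 2 + 4 * l" .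
    have "2 * ln 2 + 4 * l \<le> ?x * (1 + ?y) * (2 * ln 2 + 4 * l)"
    proof -
      have "1 \<le> ?x * (1 + ?y)" using mult_mono[of 1 ?x 1 "1 + ?y"] x y by simp
      then show ?thesis using mult_right_mono[of 1 "?x * (1 + ?y)" "2 * ln 2 + 4 * l"] l by simp
    qed
    moreover have "8 * ?x * l * (A + 3 * (?y / ln 2)) \<le> ?x * (1 + ?y) * (8 * l * A + 24 * l / ln 2)"
    proof -
      have eq: "?x * (1 + ?y) * (8 * l * A + 24 * l / ln 2) - 8 * ?x * l * (A + 3 * (?y / ln 2))
          = ?x * (?y * (8 * l * A) + 24 * l / ln 2)"
        by (simp add: algebra_simps add_divide_distrib)
      have "0 \<le> ?x * (?y * (8 * l * A) + 24 * l / ln 2)" using x y l A by simp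
      then show ?thesis unfolding eq[symmetric] by (simp only: diff_ge_0_iff_ge)
    qed
    ultimately have "ln (2 * D\<^sup>2 ^ (T * (4 * L))) + 1 / ?x\<^sup>2 * ln (2 * D ^ (4 * L\<^sup>2)) \<le> ?x * (1 + ?y) * C"
      using 1 2 unfolding C_def by (simp add: distrib_left)
    also have "\<dots> \<le> (3 * ?x powr (1 + ?y powr (- 1 / 5))) * C"
      using linear_log_le_area[OF x] C by (intro mult_right_mono) auto
    finally show ?thesis using XT unfolding X_def by (intro exI[of _ T]) (simp add: mult_ac)
  qed
  then show ?thesis using C by (intro exI[of _ "3 * C"]) simp
qed

text \<open>The eighth power of the quadratic Taylor bound at \<open>1/8\<close> gives
  \<open>e \<ge> 27/10\<close>. Divided by 7, this becomes the rational rank bound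
  \<open>10/189\<close>.\<close>

lemma exp_minus_one_le: "exp (- 1) \<le> (10 / 27 :: real)"
proof -
  have "145 / 128 \<le> exp (1 / 8 :: real)"
    using exp_lower_Taylor_quadratic[of "1 / 8"] by (simp add: power2_eq_square)
  then have "(145 / 128) ^ 8 \<le> exp (1 / 8 :: real) ^ 8" by (intro power_mono) auto
  also have "\<dots> = exp 1" by (simp add: exp_of_nat_mult[symmetric])
  finally have "27 / 10 \<le> exp (1 :: real)" by (simp add: field_simps)
  then show ?thesis by (simp add: exp_minus field_simps)
qed

theorem corollary2p10:
  fixes \<mu> :: "(real^('d::finite \<times> 'd)^('d \<times> 'd)) measure"
    and c :: "nat \<Rightarrow> 'd \<times> 'd"
    and d r :: nat
    and bc :: boundary
  assumes "haar_orthogonal \<mu>"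
    and "bij_betw c {..<d\<^sup>2} UNIV"
    and "d = CARD('d)"
    and "d \<ge> 2" and "r \<ge> 1"
    and "real r \<le> min (real_of_int \<lfloor>(real d)\<^sup>2 / 4\<rfloor> / 2) (exp (-1) / 7 * (real d)\<^sup>2)"
  shows "\<exists>p>0. \<exists>C>0. \<forall>L::nat. L \<ge> 2 \<longrightarrow>
    \<P>((U1, U2) in \<mu> \<Otimes>\<^sub>M \<mu>.
       \<exists>\<psi> :: (int \<times> int \<Rightarrow> 'd) \<Rightarrow> complex.
         normalized_on (configs (lattice_box L)) \<psi> \<and>
         ground_state
           (mat_on (configs (lattice_box L)) (hamiltonian bc L (columns_proj c r U1) (columns_proj c r U2)))
           (vec_on (configs (lattice_box L)) \<psi>) \<and>
         entanglement_entropy L \<psi> \<le> C * real L powr (1 + ln (real L) powr (- 1 / 5)))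
      \<ge> p"
  (is "\<exists>p>0. \<exists>C>0. \<forall>L::nat. _ \<longrightarrow> ?prob C L \<ge> p")
proof -
  have "real r \<le> exp (- 1) / 7 * (real d)\<^sup>2" using assms(6) by simp
  also have "\<dots> \<le> (10 / 27) / 7 * (real d)\<^sup>2"
    using exp_minus_one_le by (intro mult_right_mono divide_right_mono) auto
  finally have "real (189 * r) \<le> real (10 * d\<^sup>2)" by simp
  then have r189: "189 * r \<le> 10 * d\<^sup>2" unfolding of_nat_le_iff .
  obtain cls :: "'d \<Rightarrow> (bool \<times> bool) option" and E rest where
    cardE: "\<forall>i. card (E i) = r" and
    E_cls: "\<forall>i k l. (k, l) \<in> E i \<longrightarrow> cls k = Some (i, False) \<and> cls l = Some (i, True)" and
    rest: "\<forall>i. rest i \<notin> E i" and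
    rest_cls: "\<forall>i k l. rest i = (k, l) \<longrightarrow> cls k \<in> {None, Some (i, False)} \<and> cls l \<in> {None, Some (i, True)}"
    using ex_labelling[OF assms(5) r189[unfolded assms(3)]] by (elim exE conjE) (rule that)
  \<comment> \<open>The projections act on pairs of labels, so the dimension in the neighbourhood
    lemma is the number of pairs.\<close>
  define \<alpha> where "\<alpha> = 1 / (8 * real CARD('d \<times> 'd))"
  have \<alpha>: "0 < \<alpha>" "\<alpha> \<le> 1"
  proof -
    have "1 \<le> real CARD('d \<times> 'd)" by (metis One_nat_def Suc_leI of_nat_1 of_nat_le_iff zero_less_card_finite)
    then show "0 < \<alpha>" "\<alpha> \<le> 1" unfolding \<alpha>_def by (auto simp: divide_le_eq_1)
  qed
  have "r \<le> d\<^sup>2" using r189 by simp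
  then have inj: "inj_on c {..<r}" using assms(2) by (auto simp: bij_betw_def intro: inj_on_subset)
  let ?weights = "\<lambda>i. substitution_weights (E i) (rest i) \<alpha> c r"
  have "\<exists>N U0. open N \<and> U0 \<in> N \<and> orthogonal_matrix U0 \<and> (\<forall>U\<in>N. \<exists>a. ?weights i U a)" for i
    by (rule open_neighbourhood_coefficients[OF inj spec[OF cardE] spec[OF rest] \<alpha>_def])
  then obtain N U0 where N: "\<And>i. open (N i)" "\<And>i. U0 i \<in> N i" "\<And>i. orthogonal_matrix (U0 i)"
    and weights: "\<And>i U. U \<in> N i \<Longrightarrow> \<exists>a. ?weights i U a" by metis
  have pos: "0 < measure \<mu> (N i)" for i
    by (rule haar_orthogonal_open_pos[OF assms(1) N])
  obtain C where C: "0 < C" and CT: "\<And>L::nat. 2 \<le> L \<Longrightarrow> \<exists>T. 16 * real L ^ 3 / \<alpha> \<le> 2 ^ T \<and>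
    ln (2 * (real CARD('d))\<^sup>2 ^ (T * (4 * L))) + 1 / (real L)\<^sup>2 * ln (2 * real CARD('d) ^ (4 * L\<^sup>2))
      \<le> C * real L powr (1 + ln (real L) powr (- 1 / 5))"
    using entropy_constant[of "real CARD('d)" \<alpha>] \<alpha> assms(3,4) by auto
  interpret \<mu>: prob_space \<mu> using assms(1) by (simp add: haar_orthogonal_def)
  interpret pair: pair_prob_space \<mu> \<mu> ..
  have sets: "sets \<mu> = sets borel" using assms(1) by (simp add: haar_orthogonal_def)
  have space: "space \<mu> = UNIV" using sets_eq_imp_space_eq[OF sets] by simp
  \<comment> \<open>The product of the two Borel algebras is the Borel algebra of the product space,
    so closed sets of pairs are events.\<close>
  have sets2: "sets (\<mu> \<Otimes>\<^sub>M \<mu>) = sets borel"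
    unfolding sets_pair_measure_cong[OF sets sets] borel_prod ..
  \<comment> \<open>The labelling and the neighbourhoods were chosen without reference to
    \<open>L\<close>, so one probability serves all boxes. By independence the two projections fall
    into their neighbourhoods with the product of the measures.\<close>
  have main: "\<exists>C>0. \<forall>L::nat. L \<ge> 2 \<longrightarrow> ?prob C L \<ge> measure \<mu> (N False) * measure \<mu> (N True)"
  proof (intro exI[of _ C] conjI allI impI)
    fix L :: nat assume L: "2 \<le> L"
    let ?K = "C * real L powr (1 + ln (real L) powr (- 1 / 5))"
    let ?P = "\<lambda>p. \<exists>\<psi> :: (int \<times> int \<Rightarrow> 'd) \<Rightarrow> complex.
         normalized_on (configs (lattice_box L)) \<psi> \<and>
         ground_state
           (mat_on (configs (lattice_box L)) (hamiltonian bc L (columns_proj c r (fst p)) (columns_proj c r (snd p))))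
           (vec_on (configs (lattice_box L)) \<psi>) \<and>
         entanglement_entropy L \<psi> \<le> ?K"
    have event: "{p. ?P p} \<in> sets (\<mu> \<Otimes>\<^sub>M \<mu>)"
      unfolding sets2 by (rule borel_closed[OF closed_low_entropy_ground_state])
    obtain T where T: "16 * real L ^ 3 / \<alpha> \<le> 2 ^ T"
      "ln (2 * (real CARD('d))\<^sup>2 ^ (T * (4 * L))) + 1 / (real L)\<^sup>2 * ln (2 * real CARD('d) ^ (4 * L\<^sup>2)) \<le> ?K"
      using CT[OF L] by blast
    have "?P (U1, U2)" if U: "U1 \<in> N False" "U2 \<in> N True" for U1 U2
    proof -
      define U where "U i = (if i then U2 else U1)" for i
      have "\<exists>a. ?weights i (U i) a" for i using weights[of "U i" i] U by (cases i) (auto simp: U_def)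
      then obtain a where a: "\<And>i. ?weights i (U i) (a i)" by metis
      have ann: "(\<forall>e\<in>E i. v e = (\<Sum>f\<in>- E i. a i e f * v f)) \<longrightarrow> (\<forall>k<r. (\<Sum>p\<in>UNIV. U i $ p $ c k * v p) = 0)" for i v
        using a[of i] unfolding substitution_weights_def by blast
      have rw: "rewriting cls E rest a (lattice_bonds bc L) \<alpha> (\<alpha> / 4)"
      proof
        show "cls k = Some (i, False) \<and> cls l = Some (i, True)" if "(k, l) \<in> E i" for k l i
          using E_cls that by blast
        show "rest i \<notin> E i" for i using rest by blast
        show "cls k \<in> {None, Some (i, False)} \<and> cls l \<in> {None, Some (i, True)}" if "rest i = (k, l)" for i k l
          using rest_cls that by blast
        show "0 \<le> a i e f" if "e \<in> E i" "f \<notin> E i" for i e f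
          using a[of i] that unfolding substitution_weights_def by blast
        show "(\<Sum>f\<in>- E i. a i e f) \<le> 1" "\<alpha> \<le> a i e (rest i)"
          "(\<Sum>f\<in>- E i - {rest i}. a i e f) \<le> \<alpha> / 4 * \<alpha>" if "e \<in> E i" for i e
          using a[of i] that unfolding substitution_weights_def by blast+
        show "finite (lattice_bonds bc L)" by (rule finite_lattice_bonds)
      qed (use \<alpha> L lattice_bonds_unique[of L] in auto)
      obtain \<phi> :: "(int \<times> int \<Rightarrow> 'd) \<Rightarrow> real" where
        norm: "normalized_on (configs (lattice_box L)) (\<lambda>\<sigma>. complex_of_real (\<phi> \<sigma>))" and
        eqs: "\<forall>i x y \<sigma> e. (i, x, y) \<in> lattice_bonds bc L \<longrightarrow> e \<in> E i \<longrightarrow>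
          \<phi> (\<sigma>(x := fst e, y := snd e)) = (\<Sum>f\<in>- E i. a i e f * \<phi> (\<sigma>(x := fst f, y := snd f)))" and
        ent: "entanglement_entropy L (\<lambda>\<sigma>. complex_of_real (\<phi> \<sigma>)) \<le>
          ln (2 * (real CARD('d))\<^sup>2 ^ (T * (4 * L))) + 1 / (real L)\<^sup>2 * ln (2 * real CARD('d) ^ (4 * L\<^sup>2))"
        using low_entropy_amplitudes[OF rw _ T(1)] L by auto
      have "ground_state (mat_on (configs (lattice_box L)) (hamiltonian bc L (columns_proj c r U1) (columns_proj c r U2)))
           (vec_on (configs (lattice_box L)) (\<lambda>\<sigma>. complex_of_real (\<phi> \<sigma>)))"
      proof (rule annihilated_ground_state)
        show "1 \<le> L" using L by simp
        show "\<exists>\<sigma>\<in>configs (lattice_box L). complex_of_real (\<phi> \<sigma>) \<noteq> 0"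
        proof (rule ccontr)
          assume "\<not> ?thesis"
          then show False using norm by (simp add: normalized_on_def)
        qed
        fix i x y k and \<sigma> :: "int \<times> int \<Rightarrow> 'd"
        assume b: "(i, x, y) \<in> lattice_bonds bc L" and k: "k < r"
        have "\<forall>e\<in>E i. \<phi> (\<sigma>(x := fst e, y := snd e)) = (\<Sum>f\<in>- E i. a i e f * \<phi> (\<sigma>(x := fst f, y := snd f)))"
          using eqs b by blast
        then have "(\<Sum>p\<in>UNIV. U i $ p $ c k * \<phi> (\<sigma>(x := fst p, y := snd p))) = 0"
          using ann[of i "\<lambda>p. \<phi> (\<sigma>(x := fst p, y := snd p))"] k by blast
        then have "complex_of_real (\<Sum>p\<in>UNIV. U i $ p $ c k * \<phi> (\<sigma>(x := fst p, y := snd p))) = 0" by simp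
        then show "(\<Sum>p\<in>UNIV. complex_of_real ((if i then U2 else U1) $ p $ c k) * complex_of_real (\<phi> (\<sigma>(x := fst p, y := snd p)))) = 0"
          by (simp add: U_def)
      qed
      then show ?thesis using norm order_trans[OF ent T(2)] by auto
    qed
    then have "N False \<times> N True \<subseteq> {p. ?P p}" by blast
    then have "measure (\<mu> \<Otimes>\<^sub>M \<mu>) (N False \<times> N True) \<le> measure (\<mu> \<Otimes>\<^sub>M \<mu>) {p. ?P p}"
      using event by (intro pair.P.finite_measure_mono)
    moreover have "measure (\<mu> \<Otimes>\<^sub>M \<mu>) (N False \<times> N True) = measure \<mu> (N False) * measure \<mu> (N True)"
    proof -
      have "emeasure (\<mu> \<Otimes>\<^sub>M \<mu>) (N False \<times> N True) = emeasure \<mu> (N False) * emeasure \<mu> (N True)"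
        using N(1) sets by (intro \<mu>.emeasure_pair_measure_Times) auto
      then show ?thesis by (simp add: measure_def enn2real_mult)
    qed
    ultimately show "measure \<mu> (N False) * measure \<mu> (N True) \<le> ?prob C L"
      by (simp add: space_pair_measure space split_def)
  qed (rule C)
  show ?thesis
    by (rule exI[of _ "measure \<mu> (N False) * measure \<mu> (N True)"], rule conjI,
        rule mult_pos_pos[OF pos pos], rule main)
qed

end
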